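(* Let $\Omega>0$, and let the classes $\mathcal K$ (depending on $\Omega$), $\widehat{\mathcal K}$, $\mathcal X_L$, $\mathcal X_H$ and the notions of predictability be as defined in the context. Then: (i) The classes $\mathcal X_L$ and $\mathcal X_H$ are $L_2$-predictable in the weak sense. (ii) The classes $\mathcal X_L$ and $\mathcal X_H$ are $L_\infty$-predictable in the weak sense uniformly with respect to the norm $\|\cdot\|_{L_2(\mathbf R)}$. (iii) For any $q>2$, the classes $\mathcal X_L$ and $\mathcal X_H$ are $L_2$-predictable in the weak sense uniformly with respect to the norm $\|\cdot\|_{L_q(\mathbf R)}$.
   Context: Notation. $i=\sqrt{-1}$ and $\mathbf C^+=\{z\in\mathbf C:\ \mathrm{Re}\, z>0\}$. For a complex-valued $x\in L_1(\mathbf R)$ or $x\in L_2(\mathbf R)$, $X=\mathcal F x$ denotes the Fourier transform $X(i\omega)=\int_{-\infty}^{\infty}e^{-i\omega t}x(t)\,dt$, $\omega\in\mathbf R$ (for $x\in L_2(\mathbf R)$ it is understood as an element of $L_2(\mathbf R)$); it is regarded as a function of $\omega\in\mathbf R$ and also written $X(\omega)$. For $v\in L_2(\mathbf R)$ with $v(t)=0$ for $t<0$, $\mathcal L v$ denotes the Laplace transform $(\mathcal L v)(p)=\int_0^\infty e^{-pt}v(t)\,dt$, $p\in\mathbf C^+$. For $r\in[1,+\infty]$, $H^r$ is the Hardy space of functions $h$ holomorphic on $\mathbf C^+$ with finite norm $\|h\|_{H^r}=\sup_{s>0}\|h(s+i\,\cdot)\|_{L_r(\mathbf R)}$. Kernels.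 Fix $\Omega>0$. $\mathcal K$ is the class of functions $k:\mathbf R\to\mathbf R$ such that $k(t)=0$ for $t>0$ and such that $K=\mathcal F k$ has the form $K(i\omega)=d(i\omega)/\delta(i\omega)$, where $d$ and $\delta$ are polynomials with $\deg d<\deg\delta$, and such that if $\delta(p)=0$ for $p\in\mathbf C$, then $\mathrm{Re}\,p>0$ and $|\mathrm{Im}\,p|<\Omega$. $\widehat{\mathcal K}$ is the class of functions $\widehat k:\mathbf R\to\mathbf R$ such that $\widehat k(t)=0$ for $t<0$ and $\mathcal L\widehat k\in H^2\cap H^\infty$. Predictability. Let $\mathcal X$ be a class of functions $x:\mathbf R\to\mathbf C$ and let $r\in[1,+\infty]$. For $k\in\mathcal K$ and $x\in\mathcal X$ put $y(t)=\int_t^{+\infty}k(t-s)x(s)\,ds$. (a) $\mathcal X$ is $L_r$-predictable in the weak sense if, for any $k\in\mathcal K$, there exists a sequence $\{\widehat k_m\}_{m=1}^{\infty}\subset\widehat{\mathcal K}$ (depending on $\mathcal X$ and $k$ but not on $x$) such that $\|y-\widehat y_m\|_{L_r(\mathbf R)}\to0$ as $m\to+\infty$ for all $x\in\mathcal X$, where $\widehat y_m(t)=\int_{-\infty}^t\widehat k_m(t-s)x(s)\,ds$. (b) Given a norm $\|\cdot\|$ on the set $\{X=\mathcal F x:\ x\in\mathcal X\}$, $\mathcal X$ is $L_r$-predictable in the weak sense uniformly with respect to the norm $\|\cdot\|$ if, for any $k\in\mathcal K$ and any $\eta>0$, there exists $\widehat k\in\widehat{\mathcal K}$ (depending on $\mathcal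 X,k,\|\cdot\|,\eta$ but not on $x$) such that $\|y-\widehat y\|_{L_r(\mathbf R)}\le\eta\|X\|$ for all $x\in\mathcal X$, where $X=\mathcal F x$ and $\widehat y(t)=\int_{-\infty}^t\widehat k(t-s)x(s)\,ds$. If $\|X\|_{L_q(\mathbf R)}=+\infty$ for some $x$, the inequality is regarded as trivially satisfied for that $x$. Classes of processes (complex-valued functions on $\mathbf R$), with the same $\Omega$ as in the definition of $\mathcal K$: $\mathcal X_L=\{x\in L_2(\mathbf R):\ X(\omega)=0\ \text{if}\ |\omega|>\Omega,\ X=\mathcal F x\}$ and $\mathcal X_H=\{x\in L_2(\mathbf R):\ X(\omega)=0\ \text{if}\ |\omega|<\Omega,\ X=\mathcal F x\}$ (vanishing understood for almost every such $\omega$). *)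

theory Defs
  imports
    "HOL-Analysis.Analysis"
    "HOL-Computational_Algebra.Polynomial"
    "HOL-Probability.Essential_Supremum"
begin

(* The extended-valued L_r norm on R for 1 <= r <= infinity; functions that are not Lebesgue
   measurable get the value infinity, so that a finite norm means membership in L_r. *)
definition Lnorm :: "ennreal \<Rightarrow> (real \<Rightarrow> complex) \<Rightarrow> ennreal" where
  "Lnorm r f =
    (if f \<notin> borel_measurable lebesgue then \<infinity>
     else if r = \<infinity> then esssup lebesgue (\<lambda>t. ennreal (cmod (f t)))
     else (let I = (\<integral>\<^sup>+ t. ennreal (cmod (f t) powr enn2real r) \<partial>lebesgue)
           in if I = \<infinity> then \<infinity> else ennreal (enn2real I powr (1 / enn2real r))))"

definition Lspace :: "ennreal \<Rightarrow> (real \<Rightarrow> complex) set" where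
  "Lspace r = {f. f \<in> borel_measurable lebesgue \<and> Lnorm r f < \<infinity>}"

definition fourier_integral :: "(real \<Rightarrow> complex) \<Rightarrow> real \<Rightarrow> complex" where
  "fourier_integral x \<omega> = (LINT t|lebesgue. exp (- (\<i> * of_real \<omega> * of_real t)) * x t)"

(* The Fourier transform on L_2, as a relation because it is only determined almost everywhere:
   X is the limit in L_2 of the Fourier integrals of x over [-T,T] as T tends to infinity. *)
definition has_fourier_L2 :: "(real \<Rightarrow> complex) \<Rightarrow> (real \<Rightarrow> complex) \<Rightarrow> bool" where
  "has_fourier_L2 x X \<longleftrightarrow> x \<in> Lspace 2 \<and> X \<in> Lspace 2 \<and>
     ((\<lambda>T::real. Lnorm 2 (\<lambda>\<omega>. X \<omega> - fourier_integral (\<lambda>t. indicator {-T..T} t * x t) \<omega>))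
        \<longlongrightarrow> 0) at_top"

definition has_fourier :: "(real \<Rightarrow> complex) \<Rightarrow> (real \<Rightarrow> complex) \<Rightarrow> bool" where
  "has_fourier x X \<longleftrightarrow> (x \<in> Lspace 1 \<and> X = fourier_integral x) \<or> has_fourier_L2 x X"

definition laplace :: "(real \<Rightarrow> complex) \<Rightarrow> complex \<Rightarrow> complex" where
  "laplace v p = (LINT t:{0..}|lebesgue. exp (- (p * of_real t)) * v t)"

definition hardy :: "ennreal \<Rightarrow> (complex \<Rightarrow> complex) set" where
  "hardy r = {h. h holomorphic_on {p. Re p > 0} \<and>
                 (SUP s\<in>{0<..}. Lnorm r (\<lambda>\<omega>. h (Complex s \<omega>))) < \<infinity>}"

(* The equation for K holds almost everywhere, since the transform of a function in L_2
   is only determined up to null sets. *)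
definition kernels :: "real \<Rightarrow> (real \<Rightarrow> real) set" where
  "kernels \<Omega> = {k. (\<forall>t>0. k t = 0) \<and>
     (\<exists>K (d :: complex poly) (\<delta> :: complex poly).
        has_fourier (\<lambda>t. of_real (k t)) K \<and>
        (AE \<omega> in lebesgue. K \<omega> = poly d (\<i> * of_real \<omega>) / poly \<delta> (\<i> * of_real \<omega>)) \<and>
        degree d < degree \<delta> \<and>
        (\<forall>p. poly \<delta> p = 0 \<longrightarrow> Re p > 0 \<and> \<bar>Im p\<bar> < \<Omega>))}"

definition causal_kernels :: "(real \<Rightarrow> real) set" where
  "causal_kernels = {k. (\<lambda>t. of_real (k t)) \<in> Lspace 2 \<and> (\<forall>t<0. k t = 0) \<and>
     laplace (\<lambda>t. of_real (k t)) \<in> hardy 2 \<inter> hardy \<infinity>}"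

definition anticausal_conv :: "(real \<Rightarrow> real) \<Rightarrow> (real \<Rightarrow> complex) \<Rightarrow> real \<Rightarrow> complex" where
  "anticausal_conv k x t = (LINT s:{t..}|lebesgue. of_real (k (t - s)) * x s)"

definition causal_conv :: "(real \<Rightarrow> real) \<Rightarrow> (real \<Rightarrow> complex) \<Rightarrow> real \<Rightarrow> complex" where
  "causal_conv k x t = (LINT s:{..t}|lebesgue. of_real (k (t - s)) * x s)"

definition weakly_predictable :: "real \<Rightarrow> ennreal \<Rightarrow> (real \<Rightarrow> complex) set \<Rightarrow> bool" where
  "weakly_predictable \<Omega> r \<X> \<longleftrightarrow>
    (\<forall>k\<in>kernels \<Omega>. \<exists>kh :: nat \<Rightarrow> real \<Rightarrow> real. (\<forall>m. kh m \<in> causal_kernels) \<and>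
      (\<forall>x\<in>\<X>. (\<lambda>m. Lnorm r (\<lambda>t. anticausal_conv k x t - causal_conv (kh m) x t))
                \<longlonglongrightarrow> 0))"

(* N is the norm on Fourier transforms. It may take the value infinity (as an L_q norm can),
   and then the inequality holds trivially because \<eta> > 0. *)
definition weakly_predictable_uniformly ::
    "real \<Rightarrow> ennreal \<Rightarrow> (real \<Rightarrow> complex) set \<Rightarrow> ((real \<Rightarrow> complex) \<Rightarrow> ennreal) \<Rightarrow> bool" where
  "weakly_predictable_uniformly \<Omega> r \<X> N \<longleftrightarrow>
    (\<forall>k\<in>kernels \<Omega>. \<forall>\<eta>::real. \<eta> > 0 \<longrightarrow> (\<exists>kh\<in>causal_kernels.
      \<forall>x\<in>\<X>. \<forall>X. has_fourier x X \<longrightarrow>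
        Lnorm r (\<lambda>t. anticausal_conv k x t - causal_conv kh x t) \<le> ennreal \<eta> * N X))"

definition low_freq :: "real \<Rightarrow> (real \<Rightarrow> complex) set" where
  "low_freq \<Omega> = {x. \<exists>X. has_fourier_L2 x X \<and> (AE \<omega> in lebesgue. \<bar>\<omega>\<bar> > \<Omega> \<longrightarrow> X \<omega> = 0)}"

definition high_freq :: "real \<Rightarrow> (real \<Rightarrow> complex) set" where
  "high_freq \<Omega> = {x. \<exists>X. has_fourier_L2 x X \<and> (AE \<omega> in lebesgue. \<bar>\<omega>\<bar> < \<Omega> \<longrightarrow> X \<omega> = 0)}"

end

theory Submission
  imports
    Defs
    "HOL-Probability.Probability"
    "HOL-Complex_Analysis.Complex_Analysis"
    "HOL-Computational_Algebra.Fundamental_Theorem_Algebra"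
    "HOL-Real_Asymp.Real_Asymp"
begin

text \<open>
The kernel \<open>k\<close> lives on \<open>t \<le> 0\<close> and a predictor \<open>kh\<close> on \<open>t \<ge> 0\<close>, so both outputs are convolutions of
\<open>x\<close> over the whole line and the prediction error is \<open>g * x\<close> with \<open>g = k - kh\<close>. On the frequency side the
error is \<open>(K - Kh) X\<close>, and \<open>X\<close> vanishes off the band \<open>D\<close>, which is \<open>{\<bar>\<omega>\<bar> < \<Omega>}\<close> or \<open>{\<bar>\<omega>\<bar> > \<Omega>}\<close>. It therefore
suffices to approximate \<open>K\<close> on \<open>D\<close> alone by transforms \<open>Kh\<close> of causal kernels: pointwise on \<open>D\<close>, with
\<open>\<bar>K - Kh\<bar> \<le> C / (1 + \<bar>\<omega>\<bar>)\<close> on \<open>D\<close> uniformly along the sequence. This is \<open>predictable_symbol\<close>.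

The approximation replaces each pole of \<open>K\<close> by an essential singularity in the left half-plane. For a
pole \<open>\<alpha>\<close> with \<open>Re \<alpha> > 0\<close> and \<open>\<bar>Im \<alpha>\<bar> < \<Omega>\<close> put \<open>\<mu> = (\<Omega>\<^sup>2 - (Im \<alpha>)\<^sup>2) / Re \<alpha> + \<i> Im \<alpha>\<close> and
\<open>W(p) = (p - \<alpha>) / (p + \<mu>)\<close>. The bound on \<open>Im \<alpha>\<close> says exactly that \<open>Re \<mu> > 0\<close>, and \<open>\<mu>\<close> is chosen so that
\<open>Re W(\<i>\<omega>) = (\<omega>\<^sup>2 - \<Omega>\<^sup>2) / \<bar>\<i>\<omega> + \<mu>\<bar>\<^sup>2\<close> changes sign precisely at \<open>\<plusminus>\<Omega>\<close>. Hence for \<open>\<gamma>\<close> tending to \<open>+\<infinity>\<close> (low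
band) or \<open>-\<infinity>\<close> (high band) the factor \<open>V = 1 - exp(\<gamma> W)\<close> tends to 1 on \<open>D\<close> while \<open>\<bar>1 - V\<bar> \<le> 1\<close> there; and
\<open>V(\<alpha>) = 0\<close>, so \<open>V / (p - \<alpha>)\<close> has no pole left. It is an entire function of \<open>1 / (p + \<mu>)\<close> vanishing at 0,
and every such function is the Laplace transform of an explicit causal, exponentially decaying kernel
(\<open>entire_function_laplace_kernel\<close>). Partial fractions carry the construction from powers
\<open>1 / (p - \<alpha>) ^ l\<close> to all of \<open>K\<close> (\<open>predictable_symbol_rational\<close>), and taking real parts of the kernels
keeps the estimates because the bands are symmetric.

The transfer between time and frequency uses only kernels \<open>g\<close> that decay exponentially and are
continuous off a finite set (\<open>tame\<close>). For these, Gaussian regularisation gives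
\<open>2 \<pi> (g * x)(t) = \<integral> X(\<omega>) G(\<omega>) e\<^sup>i\<^sup>\<omega>\<^sup>t d\<omega>\<close> for every \<open>x\<close> in \<open>L\<^sub>2\<close> (\<open>parseval_convolution\<close>), and the inequality
half of Plancherel's theorem (\<open>fourier_energy_le\<close>) turns this into bounds of \<open>g * x\<close> in \<open>L\<^sub>2\<close> and
\<open>L\<^sub>\<infinity>\<close> by \<open>X G\<close> in \<open>L\<^sub>2\<close> and \<open>L\<^sub>1\<close>. The three parts of the theorem then follow from dominated convergence, from
Cauchy-Schwarz, and from Young's inequality with exponents \<open>q/2\<close> and its conjugate.
\<close>

section \<open>Fourier integrals of integrable functions\<close>

abbreviation \<F> :: "(real \<Rightarrow> complex) \<Rightarrow> real \<Rightarrow> complex" where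
  "\<F> \<equiv> fourier_integral"

abbreviation wave :: "real \<Rightarrow> real \<Rightarrow> complex" where
  "wave t \<omega> \<equiv> exp (\<i> * of_real \<omega> * of_real t)"

abbreviation gaussian :: "real \<Rightarrow> real \<Rightarrow> complex" where
  "gaussian \<epsilon> \<omega> \<equiv> of_real (exp (- (\<epsilon> * \<omega>)\<^sup>2 / 2))"

lemma sigma_finite_lebesgue: "sigma_finite_measure (lebesgue :: real measure)"
proof
  show "\<exists>A. countable A \<and> A \<subseteq> sets (lebesgue :: real measure) \<and> \<Union>A = space lebesgue \<and> (\<forall>a\<in>A. emeasure lebesgue a \<noteq> \<infinity>)"
  proof (intro exI conjI)
    show "countable (range (\<lambda>n. {- real n..real n}))" by simp
    show "range (\<lambda>n. {- real n..real n}) \<subseteq> sets lebesgue" by auto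
    show "\<Union> (range (\<lambda>n. {- real n..real n})) = space lebesgue"
      by (auto simp: abs_le_iff[symmetric] minus_le_iff intro: real_arch_simple)
        (metis abs_le_iff minus_le_iff real_arch_simple)
    show "\<forall>a\<in>range (\<lambda>n. {- real n..real n}). emeasure lebesgue a \<noteq> \<infinity>" by auto
  qed
qed

lemma pair_sigma_finite_lebesgue: "pair_sigma_finite (lebesgue :: real measure) (lebesgue :: real measure)"
  by (intro pair_sigma_finite.intro sigma_finite_lebesgue)

lemma id_borel_measurable_lebesgue [measurable]: "(\<lambda>t::real. t) \<in> borel_measurable lebesgue"
  by (simp add: measurable_completion)

lemma borel_imp_lebesgue: "f \<in> borel_measurable borel \<Longrightarrow> (f :: real \<Rightarrow> 'a::topological_space) \<in> borel_measurable lebesgue"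
  by (simp add: measurable_completion)

lemma fourier_integral_measurable [measurable]:
  assumes [measurable]: "f \<in> borel_measurable lebesgue"
  shows "\<F> f \<in> borel_measurable lebesgue"
proof -
  interpret pair_sigma_finite "lebesgue :: real measure" "lebesgue :: real measure"
    by (rule pair_sigma_finite_lebesgue)
  show ?thesis
    unfolding fourier_integral_def [abs_def]
    by (rule M1.borel_measurable_lebesgue_integral) measurable
qed

lemma cmod_exp_imaginary [simp]: "cmod (exp (- (\<i> * of_real a * of_real b))) = 1"
  "cmod (exp (\<i> * of_real a * of_real b)) = 1"
  by (simp_all add: norm_exp_eq_Re)

lemma integrable_modulate:
  assumes "integrable lebesgue f" "g \<in> borel_measurable lebesgue" "\<And>t. cmod (g t) \<le> B"
  shows "integrable lebesgue (\<lambda>t::real. g t * f t :: complex)"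
proof (rule Bochner_Integration.integrable_bound)
  show "integrable lebesgue (\<lambda>t. B * cmod (f t))"
    using assms by auto
  show "(\<lambda>t. g t * f t) \<in> borel_measurable lebesgue"
    using assms by measurable
  show "AE t in lebesgue. cmod (g t * f t) \<le> norm (B * cmod (f t))"
  proof (rule AE_I2)
    fix t show "cmod (g t * f t) \<le> norm (B * cmod (f t))"
      using mult_right_mono[OF assms(3), of "cmod (f t)"] by (simp add: norm_mult abs_mult)
        (smt (verit) mult_right_mono norm_ge_zero)
  qed
qed

lemma integrable_fourier_kernel:
  fixes f :: "real \<Rightarrow> complex"
  assumes "integrable lebesgue f"
  shows "integrable lebesgue (\<lambda>t. exp (- (\<i> * of_real \<omega> * of_real t)) * f t)"
  by (rule integrable_modulate[OF assms, where B = 1]) simp_all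

lemma fourier_integral_bound:
  fixes f :: "real \<Rightarrow> complex"
  assumes "integrable lebesgue f"
  shows "cmod (\<F> f \<omega>) \<le> (LINT t|lebesgue. cmod (f t))"
  unfolding fourier_integral_def
  by (rule order_trans[OF integral_norm_bound]) (simp add: norm_mult)

text \<open>
Fubini's theorem for the function \<open>(s, \<omega>) \<mapsto> exp (- \<i> \<omega> s) f(s) g(\<omega>)\<close>. The product is formed over Lebesgue (not
Borel) measurable functions, which is harmless because only products of functions of one variable and
continuous functions of \<open>(s, \<omega>)\<close> occur.
\<close>

lemma fourier_multiplication_formula:
  fixes f g :: "real \<Rightarrow> complex"
  assumes f: "integrable lebesgue f" and g: "integrable lebesgue g"
  shows "(LINT \<omega>|lebesgue. \<F> f \<omega> * g \<omega>) = (LINT s|lebesgue. f s * \<F> g s)"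
proof -
  interpret pair_sigma_finite "lebesgue :: real measure" "lebesgue :: real measure"
    by (rule pair_sigma_finite_lebesgue)
  have [measurable]: "f \<in> borel_measurable lebesgue" "g \<in> borel_measurable lebesgue"
    using f g by auto
  define h where "h = (\<lambda>s \<omega>. exp (- (\<i> * of_real \<omega> * of_real s)) * f s * g \<omega>)"
  have meas: "case_prod h \<in> borel_measurable (lebesgue \<Otimes>\<^sub>M lebesgue)"
    unfolding h_def by measurable
  have "integrable (lebesgue \<Otimes>\<^sub>M lebesgue) (case_prod h)"
  proof (rule Fubini_integrable[OF meas])
    show "integrable lebesgue (\<lambda>s. LINT \<omega>|lebesgue. norm (case_prod h (s, \<omega>)))"
      using f by (simp add: h_def norm_mult)
    show "AE s in lebesgue. integrable lebesgue (\<lambda>\<omega>. case_prod h (s, \<omega>))"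
    proof (rule AE_I2)
      fix s
      show "integrable lebesgue (\<lambda>\<omega>. case_prod h (s, \<omega>))"
        unfolding h_def prod.case
        by (rule integrable_modulate[OF g, where B = "cmod (f s)"]) (measurable, simp add: norm_mult)
    qed
  qed
  from Fubini_integral[OF this]
  have "(LINT \<omega>|lebesgue. LINT s|lebesgue. h s \<omega>) = (LINT s|lebesgue. LINT \<omega>|lebesgue. h s \<omega>)"
    by simp
  moreover have "(LINT s|lebesgue. h s \<omega>) = \<F> f \<omega> * g \<omega>" for \<omega>
    by (simp add: h_def fourier_integral_def)
  moreover have "(LINT \<omega>|lebesgue. h s \<omega>) = f s * \<F> g s" for s
    by (simp add: h_def fourier_integral_def mult_ac flip: integral_mult_right_zero)
  ultimately show ?thesis by simp
qed

lemma normal_density_scale: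
  assumes "\<epsilon> > 0"
  shows "normal_density 0 \<epsilon> u = normal_density 0 1 (u / \<epsilon>) / \<epsilon>"
  using assms by (simp add: normal_density_def real_sqrt_mult power_divide field_simps)

text \<open>
After rescaling, this is the characteristic function of the standard normal distribution.
\<close>

lemma fourier_gaussian:
  assumes "\<epsilon> > 0"
  shows "integrable lebesgue (\<lambda>\<omega>. gaussian \<epsilon> \<omega>)"
    and "\<F> (\<lambda>\<omega>. gaussian \<epsilon> \<omega>) u = complex_of_real (2 * pi * normal_density 0 \<epsilon> u)"
proof -
  have int1: "integrable lborel (\<lambda>x. std_normal_density x)"
    using integrable_normal_density[of 1 0] by simp
  have eq: "std_normal_density (\<epsilon> * \<omega>) = exp (- (\<epsilon> * \<omega>)\<^sup>2 / 2) / sqrt (2 * pi)" for \<omega>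
    by (simp add: normal_density_def)
  have "integrable lborel (\<lambda>\<omega>. std_normal_density (0 + \<epsilon> * \<omega>))"
    using lborel_integrable_real_affine[OF int1, of \<epsilon> 0] assms by simp
  hence "integrable lborel (\<lambda>\<omega>. sqrt (2 * pi) * std_normal_density (0 + \<epsilon> * \<omega>))"
    by (rule integrable_mult_right)
  hence "integrable lborel (\<lambda>\<omega>. exp (- (\<epsilon> * \<omega>)\<^sup>2 / 2))"
    by (simp add: eq)
  hence "integrable lebesgue (\<lambda>\<omega>. exp (- (\<epsilon> * \<omega>)\<^sup>2 / 2))"
    by (simp add: integrable_completion)
  thus "integrable lebesgue (\<lambda>\<omega>. gaussian \<epsilon> \<omega>)"
    by (rule integrable_of_real)
  have "complex_of_real (exp (- (u/\<epsilon>)\<^sup>2 / 2)) = char std_normal_distribution (- u / \<epsilon>)"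
    by (simp add: char_std_normal_distribution)
  also have "\<dots> = (CLINT x|lborel. std_normal_density x *\<^sub>R iexp (- u / \<epsilon> * x))"
    unfolding char_def by (subst integral_density) auto
  also have "\<dots> = \<epsilon> *\<^sub>R (CLINT x|lborel. std_normal_density (0 + \<epsilon> * x) *\<^sub>R iexp (- u / \<epsilon> * (0 + \<epsilon> * x)))"
    using assms by (subst lborel_integral_real_affine[where c = \<epsilon> and t = 0]) auto
  also have "\<dots> = \<epsilon> *\<^sub>R (CLINT x|lborel. complex_of_real (1 / sqrt (2 * pi)) * (exp (- (\<i> * of_real u * of_real x)) * complex_of_real (exp (- (\<epsilon> * x)\<^sup>2 / 2))))"
    using assms by (intro arg_cong[where f = "\<lambda>z. \<epsilon> *\<^sub>R z"] Bochner_Integration.integral_cong refl)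
       (simp add: eq scaleR_conv_of_real mult.assoc)
  also have "\<dots> = \<epsilon> *\<^sub>R (complex_of_real (1 / sqrt (2 * pi)) * (CLINT x|lborel. exp (- (\<i> * of_real u * of_real x)) * complex_of_real (exp (- (\<epsilon> * x)\<^sup>2 / 2))))"
    by (subst integral_mult_right_zero) simp
  also have "(CLINT x|lborel. exp (- (\<i> * of_real u * of_real x)) * complex_of_real (exp (- (\<epsilon> * x)\<^sup>2 / 2)))
     = \<F> (\<lambda>\<omega>. gaussian \<epsilon> \<omega>) u"
    unfolding fourier_integral_def by (subst integral_completion) auto
  finally have "\<F> (\<lambda>\<omega>. gaussian \<epsilon> \<omega>) u
      = complex_of_real (sqrt (2 * pi) / \<epsilon> * exp (- (u/\<epsilon>)\<^sup>2 / 2))"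
    using assms by (simp add: scaleR_conv_of_real field_simps)
  also have "sqrt (2 * pi) / \<epsilon> * exp (- (u/\<epsilon>)\<^sup>2 / 2) = 2 * pi * normal_density 0 \<epsilon> u"
  proof -
    have "2 * pi = sqrt (2 * pi) * sqrt (2 * pi)" by simp
    thus ?thesis
      unfolding normal_density_def using assms
      by (simp add: real_sqrt_mult field_simps power_divide)
  qed
  finally show "\<F> (\<lambda>\<omega>. gaussian \<epsilon> \<omega>) u = complex_of_real (2 * pi * normal_density 0 \<epsilon> u)" .
qed

section \<open>The energy inequality of Plancherel\<close>

text \<open>
The square of the \<open>L\<^sub>2\<close> norm. As a nonnegative integral it needs no integrability side conditions.
\<close>

definition energy :: "(real \<Rightarrow> complex) \<Rightarrow> ennreal" where
  "energy f = (\<integral>\<^sup>+ t. (ennreal (cmod (f t)))\<^sup>2 \<partial>lebesgue)"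

lemma cauchy_schwarz_energy:
  fixes f g :: "real \<Rightarrow> complex"
  assumes [measurable]: "f \<in> borel_measurable lebesgue" "g \<in> borel_measurable lebesgue"
  shows "(\<integral>\<^sup>+ t. ennreal (cmod (f t * g t)) \<partial>lebesgue)\<^sup>2 \<le> energy f * energy g"
  using Cauchy_Schwarz_nn_integral[of "\<lambda>t. ennreal (cmod (f t))" lebesgue "\<lambda>t. ennreal (cmod (g t))"]
  by (simp add: energy_def norm_mult ennreal_mult)

lemma integrable_L2_product:
  fixes f g :: "real \<Rightarrow> complex"
  assumes [measurable]: "f \<in> borel_measurable lebesgue" "g \<in> borel_measurable lebesgue"
    and "energy f < \<infinity>" "energy g < \<infinity>"
  shows "integrable lebesgue (\<lambda>t. f t * g t)"
proof (rule integrableI_bounded)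
  have "energy f * energy g < \<infinity>"
    using assms by (simp add: ennreal_mult_less_top)
  with cauchy_schwarz_energy[OF assms(1,2)]
  have "(\<integral>\<^sup>+ t. ennreal (cmod (f t * g t)) \<partial>lebesgue)\<^sup>2 < \<infinity>"
    by (rule order.strict_trans1)
  thus "(\<integral>\<^sup>+ t. ennreal (cmod (f t * g t)) \<partial>lebesgue) < \<infinity>"
    by (simp add: power2_eq_square ennreal_mult_less_top) (auto simp: top.not_eq_extremum[symmetric])
qed measurable

lemma norm_integral_le_nn_integral:
  fixes f :: "'a \<Rightarrow> complex"
  shows "ennreal (cmod (integral\<^sup>L M f)) \<le> (\<integral>\<^sup>+ x. ennreal (cmod (f x)) \<partial>M)"
  by (cases "integrable M f") (auto simp: integral_norm_bound_ennreal not_integrable_integral_eq)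

lemma nn_integral_limit_le:
  fixes u :: "nat \<Rightarrow> 'a \<Rightarrow> ennreal"
  assumes [measurable]: "\<And>n. u n \<in> borel_measurable M"
    and lim: "AE x in M. (\<lambda>n. u n x) \<longlonglongrightarrow> v x"
    and le: "\<And>n. integral\<^sup>N M (u n) \<le> c"
  shows "integral\<^sup>N M v \<le> c"
proof -
  have "integral\<^sup>N M v = (\<integral>\<^sup>+ x. liminf (\<lambda>n. u n x) \<partial>M)"
    using lim by (intro nn_integral_cong_AE) (auto simp: lim_imp_Liminf elim!: eventually_mono)
  also have "\<dots> \<le> liminf (\<lambda>n. integral\<^sup>N M (u n))"
    by (rule nn_integral_liminf) simp
  also have "\<dots> \<le> liminf (\<lambda>n. c)"
    by (intro Liminf_mono always_eventually allI le)
  also have "\<dots> = c" by (simp add: Liminf_const)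
  finally show ?thesis .
qed

lemma normal_density_sym: "normal_density 0 \<epsilon> (- u) = normal_density 0 \<epsilon> u"
  by (simp add: normal_density_def)

lemma nn_integral_normal_density_lebesgue:
  assumes "\<epsilon> > 0"
  shows "(\<integral>\<^sup>+ r. ennreal (normal_density 0 \<epsilon> (s - r)) \<partial>lebesgue) = 1"
proof -
  have "(\<integral>\<^sup>+ r. ennreal (normal_density 0 \<epsilon> r) \<partial>lebesgue) = (\<integral>\<^sup>+ r. ennreal (normal_density 0 \<epsilon> r) \<partial>lborel)"
    by (rule nn_integral_completion)
  also have "\<dots> = 1"
    using assms by (subst nn_integral_eq_integral) auto
  finally have 1: "(\<integral>\<^sup>+ r. ennreal (normal_density 0 \<epsilon> r) \<partial>lebesgue) = 1" .
  show ?thesis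
    using nn_integral_real_affine_lebesgue[of "\<lambda>r. ennreal (normal_density 0 \<epsilon> r)" "-1" s] 1
    by (simp add: borel_imp_lebesgue)
qed

text \<open>
Regularised inversion of a product of transforms: the Gaussian factor makes the frequency integral
absolutely convergent, and two uses of the multiplication formula move both transforms off \<open>f\<close> and \<open>g\<close>,
leaving the convolution with the heat kernel.
\<close>

lemma fourier_gaussian_parseval:
  fixes f g :: "real \<Rightarrow> complex"
  assumes f: "integrable lebesgue f" and g: "integrable lebesgue g" and \<epsilon>: "\<epsilon> > 0"
  shows "integrable lebesgue (\<lambda>\<omega>. \<F> g \<omega> * wave t \<omega>
            * gaussian \<epsilon> \<omega>)" (is ?int)
    and "(LINT \<omega>|lebesgue. \<F> f \<omega> * (\<F> g \<omega> * wave t \<omega>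
            * gaussian \<epsilon> \<omega>))
       = 2 * pi * (LINT s|lebesgue. f s * (LINT r|lebesgue. g r * complex_of_real (normal_density 0 \<epsilon> (t - s - r))))" (is ?eq)
proof -
  have [measurable]: "f \<in> borel_measurable lebesgue" "g \<in> borel_measurable lebesgue"
    using f g by auto
  define G where "G = (\<lambda>\<omega>. gaussian \<epsilon> \<omega>)"
  have intG: "integrable lebesgue G"
    unfolding G_def by (rule fourier_gaussian(1)[OF \<epsilon>])
  define E where "E = (\<lambda>t \<omega>. wave t \<omega>)"
  have [measurable]: "E t \<in> borel_measurable lebesgue" for t
    unfolding E_def by measurable
  have intEG: "integrable lebesgue (\<lambda>\<omega>. E t \<omega> * G \<omega>)" for t
    by (rule integrable_modulate[OF intG, where B = 1]) (simp_all add: E_def)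
  have int: "integrable lebesgue (\<lambda>\<omega>. \<F> g \<omega> * (E t \<omega> * G \<omega>))"
    by (rule integrable_modulate[OF intEG fourier_integral_measurable fourier_integral_bound[OF g]]) simp
  thus ?int by (simp add: E_def G_def mult.assoc)
  have FEG: "\<F> (\<lambda>\<omega>. E u \<omega> * G \<omega>) r = complex_of_real (2 * pi * normal_density 0 \<epsilon> (u - r))" for u r
  proof -
    have "\<F> (\<lambda>\<omega>. E u \<omega> * G \<omega>) r = \<F> G (r - u)"
      unfolding fourier_integral_def E_def
    proof (intro Bochner_Integration.integral_cong refl)
      fix \<omega>
      have "exp (- (\<i> * complex_of_real (r - u) * complex_of_real \<omega>))
         = exp (- (\<i> * of_real r * of_real \<omega>)) * wave u \<omega>"
        by (simp add: algebra_simps flip: exp_add)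
      thus "exp (- (\<i> * of_real r * of_real \<omega>)) * (wave u \<omega> * G \<omega>)
         = exp (- (\<i> * complex_of_real (r - u) * complex_of_real \<omega>)) * G \<omega>"
        by (simp only: mult_ac)
    qed
    also have "\<dots> = complex_of_real (2 * pi * normal_density 0 \<epsilon> (r - u))"
      unfolding G_def by (rule fourier_gaussian(2)[OF \<epsilon>])
    finally show ?thesis using normal_density_sym[of \<epsilon> "u - r"] by simp
  qed
  have "\<F> (\<lambda>\<omega>. \<F> g \<omega> * (E t \<omega> * G \<omega>)) s
      = 2 * pi * (LINT r|lebesgue. g r * complex_of_real (normal_density 0 \<epsilon> (t - s - r)))" for s
  proof -
    have "\<F> (\<lambda>\<omega>. \<F> g \<omega> * (E t \<omega> * G \<omega>)) s
      = (LINT \<omega>|lebesgue. \<F> g \<omega> * (E (t - s) \<omega> * G \<omega>))"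
      unfolding fourier_integral_def[of _ s] E_def
    proof (intro Bochner_Integration.integral_cong refl)
      fix \<omega>
      have "wave (t - s) \<omega>
         = exp (- (\<i> * of_real s * of_real \<omega>)) * wave t \<omega>"
        by (simp add: algebra_simps flip: exp_add)
      thus "exp (- (\<i> * of_real s * of_real \<omega>)) *
         (\<F> g \<omega> * (wave t \<omega> * G \<omega>)) =
         \<F> g \<omega> * (wave (t - s) \<omega> * G \<omega>)"
        by (simp only: mult_ac)
    qed
    also have "\<dots> = (LINT r|lebesgue. g r * \<F> (\<lambda>\<omega>. E (t - s) \<omega> * G \<omega>) r)"
      by (rule fourier_multiplication_formula[OF g intEG])
    also have "\<dots> = (LINT r|lebesgue. (2 * pi) * (g r * complex_of_real (normal_density 0 \<epsilon> (t - s - r))))"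
      unfolding FEG by (intro Bochner_Integration.integral_cong refl) simp
    also have "\<dots> = 2 * pi * (LINT r|lebesgue. g r * complex_of_real (normal_density 0 \<epsilon> (t - s - r)))"
      by (rule integral_mult_right_zero)
    finally show ?thesis .
  qed
  with fourier_multiplication_formula[OF f int]
  have "(LINT \<omega>|lebesgue. \<F> f \<omega> * (\<F> g \<omega> * (E t \<omega> * G \<omega>)))
     = (LINT s|lebesgue. 2 * pi * (f s * (LINT r|lebesgue. g r * complex_of_real (normal_density 0 \<epsilon> (t - s - r)))))"
    by (simp add: mult_ac)
  thus ?eq
    by (simp add: E_def G_def mult.assoc flip: integral_mult_right_zero)
qed

lemma fourier_integral_cnj_reflect:
  "\<F> (\<lambda>r. cnj (f (- r))) \<omega> = cnj (\<F> f \<omega>)"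
proof -
  have "\<F> (\<lambda>r. cnj (f (- r))) \<omega> = (LINT r|lebesgue. cnj (exp (- (\<i> * of_real \<omega> * of_real r)) * f r))"
    unfolding fourier_integral_def
    by (subst lebesgue_integral_real_affine[of "-1" _ 0]) (simp_all add: exp_cnj)
  thus ?thesis by (simp only: fourier_integral_def Bochner_Integration.integral_cnj)
qed

text \<open>
Taking \<open>g(r) = cnj (f (- r))\<close> in the regularised identity turns its left-hand side into the energy of the
transform with a Gaussian weight. The right-hand side is at most \<open>2 \<pi>\<close> times the energy of \<open>f\<close>, since
\<open>\<bar>f(s) f(r)\<bar> \<le> (\<bar>f(s)\<bar>\<^sup>2 + \<bar>f(r)\<bar>\<^sup>2) / 2\<close> and the heat kernel has mass 1. Fatou's lemma removes the weight.
\<close>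

theorem fourier_energy_le:
  fixes f :: "real \<Rightarrow> complex"
  assumes f: "integrable lebesgue f"
  shows "energy (\<F> f) \<le> 2 * pi * energy f"
proof -
  interpret pair_sigma_finite "lebesgue :: real measure" "lebesgue :: real measure"
    by (rule pair_sigma_finite_lebesgue)
  have [measurable]: "f \<in> borel_measurable lebesgue"
    using f by auto
  define g where "g = (\<lambda>r. cnj (f (- r)))"
  have "integrable lebesgue (\<lambda>r. f (0 + (-1) * r))"
    by (rule lebesgue_integrable_real_affine[OF f]) simp
  hence g: "integrable lebesgue g"
    by (simp add: g_def)
  hence [measurable]: "g \<in> borel_measurable lebesgue" by auto
  have energy_g: "energy g = energy f"
    unfolding energy_def g_def
    by (subst (2) nn_integral_real_affine_lebesgue[of _ "-1" 0]) (simp_all)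
  have smooth: "(\<integral>\<^sup>+ \<omega>. (ennreal (cmod (\<F> f \<omega>)))\<^sup>2 * ennreal (exp (- (\<epsilon> * \<omega>)\<^sup>2 / 2)) \<partial>lebesgue) \<le> 2 * pi * energy f"
    if \<epsilon>: "\<epsilon> > 0" for \<epsilon>
  proof -
    define n where "n = (\<lambda>s r. normal_density 0 \<epsilon> (0 - s - r))"
    have [measurable]: "case_prod n \<in> borel_measurable (lebesgue \<Otimes>\<^sub>M lebesgue)"
      unfolding n_def normal_density_def by measurable
    have n_nonneg: "n s r \<ge> 0" for s r by (simp add: n_def)
    have n1: "(\<integral>\<^sup>+ r. ennreal (n s r) \<partial>lebesgue) = 1" for s
      unfolding n_def by (rule nn_integral_normal_density_lebesgue[OF \<epsilon>])
    have "n s r = n r s" for s r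
      by (simp add: n_def normal_density_def power2_commute add.commute)
    hence n1': "(\<integral>\<^sup>+ s. ennreal (n s r) \<partial>lebesgue) = 1" for r
      using n1[of r] by presburger
    define R where "R = (\<lambda>\<omega>. (cmod (\<F> f \<omega>))\<^sup>2 * exp (- (\<epsilon> * \<omega>)\<^sup>2 / 2))"
    have R_eq: "complex_of_real (R \<omega>) = \<F> f \<omega> * (\<F> g \<omega> * wave 0 \<omega>
            * gaussian \<epsilon> \<omega>)" for \<omega>
      unfolding g_def fourier_integral_cnj_reflect R_def of_real_mult complex_norm_square by simp
    have "integrable lebesgue (\<lambda>\<omega>. complex_of_real (R \<omega>))"
      unfolding R_eq
      by (rule integrable_modulate[OF fourier_gaussian_parseval(1)[OF f g \<epsilon>] fourier_integral_measurable fourier_integral_bound[OF f]]) simp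
    from integrable_Re[OF this] have intR: "integrable lebesgue R" by simp
    have "(\<integral>\<^sup>+ \<omega>. (ennreal (cmod (\<F> f \<omega>)))\<^sup>2 * ennreal (exp (- (\<epsilon> * \<omega>)\<^sup>2 / 2)) \<partial>lebesgue) = (\<integral>\<^sup>+ \<omega>. ennreal (R \<omega>) \<partial>lebesgue)"
      by (simp add: R_def ennreal_mult ennreal_power)
    also have "\<dots> = ennreal (LINT \<omega>|lebesgue. R \<omega>)"
      by (rule nn_integral_eq_integral[OF intR]) (simp add: R_def)
    also have "\<dots> \<le> ennreal (cmod (complex_of_real (LINT \<omega>|lebesgue. R \<omega>)))"
      by (rule ennreal_leI) simp
    also have "complex_of_real (LINT \<omega>|lebesgue. R \<omega>) = (LINT \<omega>|lebesgue. complex_of_real (R \<omega>))"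
      by simp
    also have "\<dots> = 2 * pi * (LINT s|lebesgue. f s * (LINT r|lebesgue. g r * complex_of_real (n s r)))"
      unfolding R_eq n_def by (rule fourier_gaussian_parseval(2)[OF f g \<epsilon>])
    also have "ennreal (cmod \<dots>) = ennreal (2 * pi) * ennreal (cmod (LINT s|lebesgue. f s * (LINT r|lebesgue. g r * complex_of_real (n s r))))"
      by (simp add: norm_mult ennreal_mult)
    finally have A: "(\<integral>\<^sup>+ \<omega>. (ennreal (cmod (\<F> f \<omega>)))\<^sup>2 * ennreal (exp (- (\<epsilon> * \<omega>)\<^sup>2 / 2)) \<partial>lebesgue)
       \<le> ennreal (2 * pi) * ennreal (cmod (LINT s|lebesgue. f s * (LINT r|lebesgue. g r * complex_of_real (n s r))))" .
    have "ennreal (cmod (LINT s|lebesgue. f s * (LINT r|lebesgue. g r * complex_of_real (n s r))))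
        \<le> (\<integral>\<^sup>+ s. ennreal (cmod (f s * (LINT r|lebesgue. g r * complex_of_real (n s r)))) \<partial>lebesgue)"
      by (rule norm_integral_le_nn_integral)
    also have "\<dots> \<le> (\<integral>\<^sup>+ s. (\<integral>\<^sup>+ r. ennreal (cmod (f s)) * (ennreal (cmod (g r)) * ennreal (n s r)) \<partial>lebesgue) \<partial>lebesgue)"
    proof (rule nn_integral_mono)
      fix s
      have "ennreal (cmod (f s * (LINT r|lebesgue. g r * complex_of_real (n s r))))
         = ennreal (cmod (f s)) * ennreal (cmod (LINT r|lebesgue. g r * complex_of_real (n s r)))"
        by (simp add: norm_mult ennreal_mult)
      also have "\<dots> \<le> ennreal (cmod (f s)) * (\<integral>\<^sup>+ r. ennreal (cmod (g r * complex_of_real (n s r))) \<partial>lebesgue)"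
        by (intro mult_left_mono norm_integral_le_nn_integral) simp
      also have "\<dots> = (\<integral>\<^sup>+ r. ennreal (cmod (f s)) * (ennreal (cmod (g r)) * ennreal (n s r)) \<partial>lebesgue)"
        by (subst nn_integral_cmult[symmetric]) (auto simp: norm_mult ennreal_mult n_nonneg)
      finally show "ennreal (cmod (f s * (LINT r|lebesgue. g r * complex_of_real (n s r)))) \<le> \<dots>" .
    qed
    also have "\<dots> \<le> (\<integral>\<^sup>+ s. (\<integral>\<^sup>+ r. ennreal (1/2) * ((ennreal (cmod (f s)))\<^sup>2 * ennreal (n s r)) + ennreal (1/2) * ((ennreal (cmod (g r)))\<^sup>2 * ennreal (n s r)) \<partial>lebesgue) \<partial>lebesgue)"
    proof (intro nn_integral_mono)
      fix s r
      have le: "cmod (f s) * (cmod (g r) * n s r) \<le> (1/2) * ((cmod (f s))\<^sup>2 * n s r) + (1/2) * ((cmod (g r))\<^sup>2 * n s r)"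
      proof -
        have "0 \<le> (1/2) * ((cmod (f s) - cmod (g r))\<^sup>2 * n s r)"
          using n_nonneg[of s r] by simp
        thus ?thesis by (simp add: power2_diff algebra_simps)
      qed
      moreover have "ennreal (1/2) * ((ennreal (cmod z))\<^sup>2 * ennreal (n s r)) = ennreal ((1/2) * ((cmod z)\<^sup>2 * n s r))" for z
      proof -
        have "ennreal ((1/2) * ((cmod z)\<^sup>2 * n s r)) = ennreal (1/2) * ennreal ((cmod z)\<^sup>2 * n s r)"
          by (rule ennreal_mult) (simp_all add: n_nonneg)
        also have "ennreal ((cmod z)\<^sup>2 * n s r) = (ennreal (cmod z))\<^sup>2 * ennreal (n s r)"
          by (simp add: ennreal_mult n_nonneg ennreal_power)
        finally show ?thesis by simp
      qed
      moreover have "ennreal (cmod (f s)) * (ennreal (cmod (g r)) * ennreal (n s r)) = ennreal (cmod (f s) * (cmod (g r) * n s r))"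
        by (simp add: n_nonneg ennreal_mult)
      moreover have "ennreal ((1/2) * ((cmod (f s))\<^sup>2 * n s r) + (1/2) * ((cmod (g r))\<^sup>2 * n s r))
         = ennreal ((1/2) * ((cmod (f s))\<^sup>2 * n s r)) + ennreal ((1/2) * ((cmod (g r))\<^sup>2 * n s r))"
        by (rule ennreal_plus) (simp_all add: n_nonneg)
      ultimately show "ennreal (cmod (f s)) * (ennreal (cmod (g r)) * ennreal (n s r)) \<le> ennreal (1/2) * ((ennreal (cmod (f s)))\<^sup>2 * ennreal (n s r)) + ennreal (1/2) * ((ennreal (cmod (g r)))\<^sup>2 * ennreal (n s r))"
        using ennreal_leI[OF le] by simp
    qed
    also have "\<dots> = (\<integral>\<^sup>+ s. (\<integral>\<^sup>+ r. ennreal (1/2) * ((ennreal (cmod (f s)))\<^sup>2 * ennreal (n s r)) \<partial>lebesgue) \<partial>lebesgue)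
         + (\<integral>\<^sup>+ s. (\<integral>\<^sup>+ r. ennreal (1/2) * ((ennreal (cmod (g r)))\<^sup>2 * ennreal (n s r)) \<partial>lebesgue) \<partial>lebesgue)"
      by (subst nn_integral_add[symmetric], measurable) (auto intro!: nn_integral_cong nn_integral_add)
    also have "(\<integral>\<^sup>+ s. (\<integral>\<^sup>+ r. ennreal (1/2) * ((ennreal (cmod (f s)))\<^sup>2 * ennreal (n s r)) \<partial>lebesgue) \<partial>lebesgue) = ennreal (1/2) * energy f"
      unfolding energy_def by (simp add: nn_integral_cmult n1)
    also have "(\<integral>\<^sup>+ s. (\<integral>\<^sup>+ r. ennreal (1/2) * ((ennreal (cmod (g r)))\<^sup>2 * ennreal (n s r)) \<partial>lebesgue) \<partial>lebesgue)
       = (\<integral>\<^sup>+ r. (\<integral>\<^sup>+ s. ennreal (1/2) * ((ennreal (cmod (g r)))\<^sup>2 * ennreal (n s r)) \<partial>lebesgue) \<partial>lebesgue)"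
      by (rule Fubini') measurable
    also have "\<dots> = ennreal (1/2) * energy g"
      unfolding energy_def by (simp add: nn_integral_cmult n1')
    also have "ennreal (1/2) * energy f + ennreal (1/2) * energy g = energy f"
      unfolding energy_g distrib_right[symmetric] by (subst ennreal_plus[symmetric]) simp_all
    finally have "ennreal (cmod (LINT s|lebesgue. f s * (LINT r|lebesgue. g r * complex_of_real (n s r)))) \<le> energy f" .
    thus ?thesis
      by (rule order_trans[OF A mult_left_mono]) simp
  qed
  have "energy (\<F> f) = (\<integral>\<^sup>+ \<omega>. (ennreal (cmod (\<F> f \<omega>)))\<^sup>2 \<partial>lebesgue)"
    by (simp add: energy_def)
  also have "\<dots> \<le> 2 * pi * energy f"
  proof (rule nn_integral_limit_le)
    show "(\<integral>\<^sup>+ \<omega>. (ennreal (cmod (\<F> f \<omega>)))\<^sup>2 * ennreal (exp (- (inverse (real (Suc n)) * \<omega>)\<^sup>2 / 2)) \<partial>lebesgue) \<le> 2 * pi * energy f" for n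
      by (rule smooth) simp
    show "AE \<omega> in lebesgue. (\<lambda>n. (ennreal (cmod (\<F> f \<omega>)))\<^sup>2 * ennreal (exp (- (inverse (real (Suc n)) * \<omega>)\<^sup>2 / 2)))
       \<longlonglongrightarrow> (ennreal (cmod (\<F> f \<omega>)))\<^sup>2"
    proof (rule AE_I2)
      fix \<omega>
      have "(\<lambda>n. exp (- (inverse (real (Suc n)) * \<omega>)\<^sup>2 / 2)) \<longlonglongrightarrow> exp (- (0 * \<omega>)\<^sup>2 / 2)"
        by (intro tendsto_intros LIMSEQ_inverse_real_of_nat) simp
      hence "(\<lambda>n. (cmod (\<F> f \<omega>))\<^sup>2 * exp (- (inverse (real (Suc n)) * \<omega>)\<^sup>2 / 2)) \<longlonglongrightarrow> (cmod (\<F> f \<omega>))\<^sup>2 * exp (- (0 * \<omega>)\<^sup>2 / 2)"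
        by (rule tendsto_mult_left)
      from tendsto_ennrealI[OF this]
      show "(\<lambda>n. (ennreal (cmod (\<F> f \<omega>)))\<^sup>2 * ennreal (exp (- (inverse (real (Suc n)) * \<omega>)\<^sup>2 / 2)))
       \<longlonglongrightarrow> (ennreal (cmod (\<F> f \<omega>)))\<^sup>2"
        by (simp add: ennreal_mult ennreal_power)
    qed
  qed measurable
  finally show ?thesis .
qed

lemma truncation_tendsto:
  fixes f :: "real \<Rightarrow> complex"
  shows "(\<lambda>n. indicator {- real n..real n} s * f s) \<longlonglongrightarrow> f s"
proof (rule Lim_transform_eventually[OF tendsto_const])
  obtain N where N: "\<bar>s\<bar> \<le> real N" using real_arch_simple by blast
  show "\<forall>\<^sub>F n in sequentially. f s = indicator {- real n..real n} s * f s"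
    using eventually_ge_at_top[of N]
  proof eventually_elim
    case (elim n)
    hence "\<bar>s\<bar> \<le> real n" using N by linarith
    thus ?case by (auto simp: indicator_def)
  qed
qed

section \<open>Square-integrable functions and exponentially decaying kernels\<close>

lemma Lnorm_2_square:
  assumes "f \<in> borel_measurable lebesgue"
  shows "(Lnorm 2 f)\<^sup>2 = energy f"
proof -
  have "ennreal (cmod (f t) powr enn2real 2) = (ennreal (cmod (f t)))\<^sup>2" for t
    by (cases "f t = 0") (simp_all add: ennreal_power)
  hence "(\<integral>\<^sup>+ t. ennreal (cmod (f t) powr enn2real 2) \<partial>lebesgue) = energy f"
    by (simp add: energy_def)
  with assms show ?thesis
    by (cases "energy f = \<infinity>")
      (auto simp: Lnorm_def Let_def ennreal_power power2_eq_square powr_add[symmetric] less_top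
        simp flip: ennreal_mult)
qed

lemma Lspace_2_iff: "f \<in> Lspace 2 \<longleftrightarrow> f \<in> borel_measurable lebesgue \<and> energy f < \<infinity>"
proof (cases "f \<in> borel_measurable lebesgue")
  case True
  from Lnorm_2_square[OF this] show ?thesis
    using True by (auto simp: Lspace_def power2_eq_square ennreal_mult_less_top less_top[symmetric] ennreal_mult_eq_top_iff)
qed (simp add: Lspace_def)

lemma Lspace_1_imp_integrable:
  fixes f :: "real \<Rightarrow> complex"
  assumes "f \<in> Lspace 1"
  shows "integrable lebesgue f"
proof (rule integrableI_bounded)
  show "f \<in> borel_measurable lebesgue"
    using assms by (simp add: Lspace_def)
  with assms show "(\<integral>\<^sup>+ t. ennreal (cmod (f t)) \<partial>lebesgue) < \<infinity>"
    by (auto simp: Lspace_def Lnorm_def Let_def less_top split: if_splits)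
qed

lemma tendsto_zero_of_square_le:
  assumes "\<And>n. (ennreal (cmod (z n)))\<^sup>2 \<le> a n" and "(a \<longlongrightarrow> 0) F"
  shows "(z \<longlongrightarrow> 0) F"
proof -
  have "((\<lambda>n. ennreal ((cmod (z n))\<^sup>2)) \<longlongrightarrow> ennreal 0) F"
  proof (rule tendsto_sandwich)
    show "\<forall>\<^sub>F n in F. ennreal 0 \<le> ennreal ((cmod (z n))\<^sup>2)"
      by (intro always_eventually allI ennreal_leI) simp
    show "\<forall>\<^sub>F n in F. ennreal ((cmod (z n))\<^sup>2) \<le> a n"
      using assms(1) by (intro always_eventually allI) (simp add: ennreal_power)
    show "(a \<longlongrightarrow> ennreal 0) F" using assms(2) by simp
  qed (rule tendsto_const)
  hence "((\<lambda>n. (cmod (z n))\<^sup>2) \<longlongrightarrow> 0) F"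
    by (subst (asm) tendsto_ennreal_iff) auto
  from tendsto_real_sqrt[OF this] show ?thesis
    by (simp add: tendsto_norm_zero_iff)
qed

text \<open>
The class of kernels for which convolutions are computed on the frequency side. Decay gives
integrability, boundedness and finite energy; continuity off a finite set makes Gaussian smoothings
converge almost everywhere. Interval indicators belong to the class, so that tame functions also serve
as test functions.
\<close>

definition tame :: "(real \<Rightarrow> complex) \<Rightarrow> bool" where
  "tame g \<longleftrightarrow> g \<in> borel_measurable borel \<and>
     (\<exists>C a. 0 < a \<and> (\<forall>t. cmod (g t) \<le> C * exp (- (a * \<bar>t\<bar>)))) \<and>
     (\<exists>S. finite S \<and> (\<forall>t. t \<notin> S \<longrightarrow> isCont g t))"

lemma tameI:
  assumes "g \<in> borel_measurable borel" "0 < a" "\<And>t. cmod (g t) \<le> C * exp (- (a * \<bar>t\<bar>))"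
    "finite S" "\<And>t. t \<notin> S \<Longrightarrow> isCont g t"
  shows "tame g"
  unfolding tame_def
proof (intro conjI)
  show "\<exists>C a. 0 < a \<and> (\<forall>t. cmod (g t) \<le> C * exp (- (a * \<bar>t\<bar>)))"
    by (intro exI[of _ C] exI[of _ a] conjI allI assms)
  show "\<exists>S. finite S \<and> (\<forall>t. t \<notin> S \<longrightarrow> isCont g t)"
    by (intro exI[of _ S] conjI allI impI assms)
qed fact

lemma tameD:
  "tame g \<Longrightarrow> \<exists>a C S. 0 < a \<and> (\<forall>t. cmod (g t) \<le> C * exp (- (a * \<bar>t\<bar>))) \<and> finite S \<and> (\<forall>t. t \<notin> S \<longrightarrow> isCont g t)"
  unfolding tame_def by (elim conjE exE) (intro exI conjI; assumption)

text \<open>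
Comparison with \<open>1 / (1 + t\<^sup>2)\<close>, using \<open>exp u \<ge> 1 + u\<^sup>2 / 2\<close> for \<open>u \<ge> 0\<close>.
\<close>

lemma integrable_exp_abs:
  assumes "a > 0"
  shows "integrable lebesgue (\<lambda>t::real. exp (- (a * \<bar>t\<bar>)))"
proof (rule Bochner_Integration.integrable_bound)
  have "integrable lborel (\<lambda>x::real. inverse (1 + x\<^sup>2))"
    using integrable_inverse_1_plus_square by (simp add: set_integrable_def)
  hence "integrable lebesgue (\<lambda>x::real. inverse (1 + x\<^sup>2))"
    by (simp add: integrable_completion)
  thus "integrable lebesgue (\<lambda>x::real. (1 + 2 / a\<^sup>2) * inverse (1 + x\<^sup>2))"
    by simp
  show "AE t in lebesgue. norm (exp (- (a * \<bar>t\<bar>))) \<le> norm ((1 + 2 / a\<^sup>2) * inverse (1 + t\<^sup>2))"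
  proof (rule AE_I2)
    fix t :: real
    have "1 + (a * \<bar>t\<bar>)\<^sup>2 / 2 \<le> exp (a * \<bar>t\<bar>)"
      using exp_lower_Taylor_quadratic[of "a * \<bar>t\<bar>"] assms by (smt (verit) zero_le_mult_iff abs_ge_zero)
    hence "1 + t\<^sup>2 \<le> (1 + 2 / a\<^sup>2) * exp (a * \<bar>t\<bar>)"
    proof -
      have "1 + t\<^sup>2 \<le> (1 + 2 / a\<^sup>2) * (1 + (a * \<bar>t\<bar>)\<^sup>2 / 2)"
        using assms by (simp add: field_simps power_mult_distrib)
      also have "\<dots> \<le> (1 + 2 / a\<^sup>2) * exp (a * \<bar>t\<bar>)"
        by (rule mult_left_mono) (fact, simp)
      finally show ?thesis .
    qed
    from mult_left_mono[OF this, of "exp (- (a * \<bar>t\<bar>))"]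
    moreover have "exp (- (a * \<bar>t\<bar>)) * ((1 + 2 / a\<^sup>2) * exp (a * \<bar>t\<bar>)) = 1 + 2 / a\<^sup>2"
      by (simp add: exp_minus)
    ultimately have "exp (- (a * \<bar>t\<bar>)) * (1 + t\<^sup>2) \<le> 1 + 2 / a\<^sup>2"
      by simp
    moreover have pos: "0 < 1 + t\<^sup>2" by (simp add: add_pos_nonneg)
    ultimately have "exp (- (a * \<bar>t\<bar>)) \<le> (1 + 2 / a\<^sup>2) * inverse (1 + t\<^sup>2)"
      by (simp only: pos_le_divide_eq divide_inverse[symmetric])
    moreover have "0 \<le> (1 + 2 / a\<^sup>2) * inverse (1 + t\<^sup>2)"
      using pos by simp
    ultimately show "norm (exp (- (a * \<bar>t\<bar>))) \<le> norm ((1 + 2 / a\<^sup>2) * inverse (1 + t\<^sup>2))"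
      by simp
  qed
qed (simp add: borel_imp_lebesgue)

lemma tame_measurable: "tame g \<Longrightarrow> g \<in> borel_measurable borel"
  by (simp add: tame_def)

lemma tame_measurable_lebesgue: "tame g \<Longrightarrow> g \<in> borel_measurable lebesgue"
  by (simp add: tame_def borel_imp_lebesgue)

lemma tame_integrable:
  assumes "tame g" shows "integrable lebesgue g"
proof -
  from tameD[OF assms] obtain a C where "0 < a" and "\<forall>t. cmod (g t) \<le> C * exp (- (a * \<bar>t\<bar>))"
    by blast
  hence le: "\<And>t. cmod (g t) \<le> C * exp (- (a * \<bar>t\<bar>))" by simp
  show ?thesis
  proof (rule Bochner_Integration.integrable_bound)
    show "integrable lebesgue (\<lambda>t. C * exp (- (a * \<bar>t\<bar>)))"
      using integrable_exp_abs[OF \<open>0 < a\<close>] by simp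
    show "AE t in lebesgue. norm (g t) \<le> norm (C * exp (- (a * \<bar>t\<bar>)))"
      using le by (intro AE_I2) (metis abs_ge_self order_trans real_norm_def)
  qed (rule tame_measurable_lebesgue[OF assms])
qed

lemma tame_bounded:
  assumes "tame g" shows "\<exists>B\<ge>0. \<forall>t. cmod (g t) \<le> B"
proof -
  from tameD[OF assms] obtain a C where "0 < a" and "\<forall>t. cmod (g t) \<le> C * exp (- (a * \<bar>t\<bar>))"
    by blast
  hence le: "\<And>t. cmod (g t) \<le> C * exp (- (a * \<bar>t\<bar>))" by simp
  have "cmod (g 0) \<le> C" using le[of 0] by simp
  hence C: "C \<ge> 0" by (rule order_trans[OF norm_ge_zero])
  have "cmod (g t) \<le> C" for t
    using order_trans[OF le[of t], of C] C \<open>0 < a\<close> by (simp add: mult_left_le)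
  with C show ?thesis by blast
qed

lemma energy_finite_of_bounded:
  fixes f :: "real \<Rightarrow> complex"
  assumes f: "integrable lebesgue f" and B: "\<And>t. cmod (f t) \<le> B"
  shows "energy f < \<infinity>"
proof -
  have "energy f \<le> (\<integral>\<^sup>+ t. ennreal B * ennreal (cmod (f t)) \<partial>lebesgue)"
    unfolding energy_def power2_eq_square
    by (intro nn_integral_mono mult_right_mono ennreal_leI B) simp
  also have "\<dots> = ennreal B * (\<integral>\<^sup>+ t. ennreal (cmod (f t)) \<partial>lebesgue)"
    using f by (intro nn_integral_cmult) auto
  also have "\<dots> < \<infinity>"
    using f by (simp add: ennreal_mult_less_top integrable_iff_bounded)
  finally show ?thesis .
qed

lemma tame_energy: "tame g \<Longrightarrow> energy g < \<infinity>"
  using tame_bounded[of g] energy_finite_of_bounded[OF tame_integrable] by blast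

lemma tame_add:
  assumes "tame f" "tame g" shows "tame (\<lambda>t. f t + g t)"
proof -
  from tameD[OF assms(1)] obtain a C S where *: "0 < a" "\<forall>t. cmod (f t) \<le> C * exp (- (a * \<bar>t\<bar>))" "finite S" "\<forall>t. t \<notin> S \<longrightarrow> isCont f t"
    by blast
  note 1 = *[rule_format]
  from tameD[OF assms(2)] obtain b D T where *: "0 < b" "\<forall>t. cmod (g t) \<le> D * exp (- (b * \<bar>t\<bar>))" "finite T" "\<forall>t. t \<notin> T \<longrightarrow> isCont g t"
    by blast
  note 2 = *[rule_format]
  have "cmod (f 0) \<le> C" "cmod (g 0) \<le> D" using 1(2)[of 0] 2(2)[of 0] by simp_all
  hence CD: "C \<ge> 0" "D \<ge> 0" by (auto intro: order_trans[OF norm_ge_zero])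
  have "cmod (f t + g t) \<le> (C + D) * exp (- (min a b * \<bar>t\<bar>))" for t
  proof -
    have "C * exp (- (a * \<bar>t\<bar>)) \<le> C * exp (- (min a b * \<bar>t\<bar>))" "D * exp (- (b * \<bar>t\<bar>)) \<le> D * exp (- (min a b * \<bar>t\<bar>))"
      using CD by (intro mult_left_mono; simp add: mult_right_mono)+
    thus ?thesis
      using norm_triangle_ineq[of "f t" "g t"] 1(2)[of t] 2(2)[of t] by (simp add: distrib_right)
  qed
  moreover have "min a b > 0" using 1 2 by simp
  moreover have "\<forall>t. t \<notin> S \<union> T \<longrightarrow> isCont (\<lambda>t. f t + g t) t" using 1 2 by auto
  ultimately show ?thesis
    using 1(3) 2(3) tame_measurable[OF assms(1)] tame_measurable[OF assms(2)]
    by (intro tameI[of _ "min a b" "C + D" "S \<union> T"]) simp_all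
qed

lemma tame_cmult:
  assumes "tame f" shows "tame (\<lambda>t. c * f t)"
proof -
  from tameD[OF assms] obtain a C S where *: "0 < a" "\<forall>t. cmod (f t) \<le> C * exp (- (a * \<bar>t\<bar>))" "finite S" "\<forall>t. t \<notin> S \<longrightarrow> isCont f t"
    by blast
  note 1 = *[rule_format]
  have "cmod (c * f t) \<le> (cmod c * C) * exp (- (a * \<bar>t\<bar>))" for t
    using mult_left_mono[OF 1(2)[of t], of "cmod c"] by (simp add: norm_mult mult.assoc)
  thus ?thesis
    using 1 tame_measurable[OF assms] by (intro tameI[of _ a "cmod c * C" S]) simp_all
qed

lemma tame_diff: "tame f \<Longrightarrow> tame g \<Longrightarrow> tame (\<lambda>t. f t - g t)"
  using tame_add[of f "\<lambda>t. -1 * g t"] tame_cmult[of g "-1"] by simp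

lemma tame_cnj:
  assumes "tame f" shows "tame (\<lambda>t. cnj (f t))"
proof -
  from tameD[OF assms] obtain a C S where *: "0 < a" "\<forall>t. cmod (f t) \<le> C * exp (- (a * \<bar>t\<bar>))" "finite S" "\<forall>t. t \<notin> S \<longrightarrow> isCont f t"
    by blast
  note 1 = *[rule_format]
  have "(\<lambda>t. cnj (f t)) \<in> borel_measurable borel"
    by (rule measurable_compose[OF tame_measurable[OF assms] borel_measurable_continuous_onI]) (intro continuous_intros)
  thus ?thesis
    using 1 by (intro tameI[of _ a C S]) simp_all
qed

lemma tame_reflect:
  assumes "tame f" shows "tame (\<lambda>t. f (- t))"
proof -
  from tameD[OF assms] obtain a C S where *: "0 < a" "\<forall>t. cmod (f t) \<le> C * exp (- (a * \<bar>t\<bar>))" "finite S" "\<forall>t. t \<notin> S \<longrightarrow> isCont f t"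
    by blast
  note 1 = *[rule_format]
  have "isCont (\<lambda>t. f (- t)) t" if "t \<notin> uminus ` S" for t
  proof -
    have "- t \<notin> S" using that by force
    from 1(4)[OF this] show ?thesis
      using isCont_o2[of t uminus f] by simp
  qed
  moreover have "(\<lambda>t. f (- t)) \<in> borel_measurable borel"
    using tame_measurable[OF assms] by measurable
  moreover have "\<forall>t. cmod (f (- t)) \<le> C * exp (- (a * \<bar>t\<bar>))"
    using 1(2) by (metis abs_minus_cancel)
  ultimately show ?thesis
    using 1 by (intro tameI[of _ a C "uminus ` S"]) simp_all
qed

lemma tame_indicator: "tame (\<lambda>t. indicator {a..b} t)"
proof -
  define B where "B = max \<bar>a\<bar> \<bar>b\<bar>"
  have "cmod (indicator {a..b} t) \<le> exp B * exp (- (1 * \<bar>t\<bar>))" for t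
    by (auto simp: indicator_def B_def simp flip: exp_add)
  moreover have "isCont (\<lambda>t. indicator {a..b} t :: complex) t" if "t \<notin> {a, b}" for t
  proof -
    have "t \<notin> frontier {a..b}"
      using that by (cases "a \<le> b") (auto simp: frontier_def)
    hence "isCont (\<lambda>t. complex_of_real (indicator {a..b} t)) t"
      by (intro continuous_of_real) (simp add: isCont_indicator)
    thus ?thesis by (simp add: of_real_indicator)
  qed
  ultimately show ?thesis
    by (intro tameI[of _ 1 "exp B" "{a, b}"]) simp_all
qed

lemma energy_reflect_shift:
  fixes f :: "real \<Rightarrow> complex"
  assumes "f \<in> borel_measurable lebesgue"
  shows "energy (\<lambda>s. f (t - s)) = energy f" "(\<lambda>s. f (t - s)) \<in> borel_measurable lebesgue"
proof -
  have "(\<lambda>r. (ennreal (cmod (f r)))\<^sup>2) \<in> borel_measurable lebesgue"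
    using assms by measurable
  from nn_integral_real_affine_lebesgue[OF this, of "-1" t]
  show "energy (\<lambda>s. f (t - s)) = energy f"
    by (simp add: energy_def)
  show "(\<lambda>s. f (t - s)) \<in> borel_measurable lebesgue"
    using borel_measurable_affine[OF assms, of "-1" t] by simp
qed

text \<open>
Substituting \<open>r = u - \<epsilon> q\<close> moves the parameter from the Gaussian into \<open>g\<close>, where continuity at \<open>u\<close> applies.
\<close>

lemma gaussian_smoothing_tendsto:
  fixes g :: "real \<Rightarrow> complex"
  assumes g: "g \<in> borel_measurable borel" and B: "\<And>t. cmod (g t) \<le> B" and cont: "isCont g u"
  shows "(\<lambda>n. LINT r|lebesgue. g r * complex_of_real (normal_density 0 (inverse (real (Suc n))) (u - r))) \<longlonglongrightarrow> g u"
proof -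
  note [measurable] = g
  have intd: "integrable lborel (\<lambda>r. std_normal_density r)" and int1: "(LINT r|lborel. std_normal_density r) = 1"
    by simp_all
  have eq: "(LINT r|lebesgue. g r * complex_of_real (normal_density 0 \<epsilon> (u - r)))
       = (LINT q|lborel. g (u - \<epsilon> * q) * complex_of_real (std_normal_density q))" if \<epsilon>: "\<epsilon> > 0" for \<epsilon>
  proof -
    have "(LINT r|lebesgue. g r * complex_of_real (normal_density 0 \<epsilon> (u - r)))
        = (LINT r|lborel. g r * complex_of_real (normal_density 0 \<epsilon> (u - r)))"
      by (subst integral_completion) auto
    also have "\<dots> = \<epsilon> *\<^sub>R (LINT q|lborel. g (u + (- \<epsilon>) * q) * complex_of_real (normal_density 0 \<epsilon> (u - (u + (- \<epsilon>) * q))))"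
      using \<epsilon> by (subst lborel_integral_real_affine[where c = "- \<epsilon>" and t = u]) auto
    also have "\<dots> = (LINT q|lborel. \<epsilon> *\<^sub>R (g (u + (- \<epsilon>) * q) * complex_of_real (normal_density 0 \<epsilon> (u - (u + (- \<epsilon>) * q)))))"
      by simp
    also have "\<dots> = (LINT q|lborel. g (u - \<epsilon> * q) * complex_of_real (std_normal_density q))"
      using \<epsilon> by (intro Bochner_Integration.integral_cong refl) (simp add: normal_density_scale[OF \<epsilon>] scaleR_conv_of_real)
    finally show ?thesis .
  qed
  have "(\<lambda>n. LINT q|lborel. g (u - inverse (real (Suc n)) * q) * complex_of_real (std_normal_density q))
      \<longlonglongrightarrow> (LINT q|lborel. g u * complex_of_real (std_normal_density q))"
  proof (rule integral_dominated_convergence)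
    show "integrable lborel (\<lambda>q. B * std_normal_density q)" using intd by simp
    show "AE q in lborel. norm (g (u - inverse (real (Suc n)) * q) * complex_of_real (std_normal_density q)) \<le> B * std_normal_density q" for n
      using B by (intro AE_I2) (simp add: norm_mult mult_right_mono)
    show "AE q in lborel. (\<lambda>n. g (u - inverse (real (Suc n)) * q) * complex_of_real (std_normal_density q)) \<longlonglongrightarrow> g u * complex_of_real (std_normal_density q)"
    proof (intro AE_I2 tendsto_mult tendsto_const)
      fix q
      have "(\<lambda>n. u - inverse (real (Suc n)) * q) \<longlonglongrightarrow> u - 0 * q"
        by (intro tendsto_intros LIMSEQ_inverse_real_of_nat)
      with cont show "(\<lambda>n. g (u - inverse (real (Suc n)) * q)) \<longlonglongrightarrow> g u"
        by (intro isCont_tendsto_compose[where g = g]) auto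
    qed
    show "(\<lambda>q. g (u - inverse (real (Suc n)) * q) * complex_of_real (std_normal_density q)) \<in> borel_measurable lborel" for n
      by (intro borel_measurable_times measurable_compose[OF _ g]) simp_all
  qed simp
  also have "(LINT q|lborel. g u * complex_of_real (std_normal_density q)) = g u"
    using int1 by simp
  finally show ?thesis by (subst eq) auto
qed

lemma fourier_gaussian_parseval_limit:
  fixes f g :: "real \<Rightarrow> complex"
  assumes f: "integrable lebesgue f" and g: "tame g"
  shows "(\<lambda>n. LINT \<omega>|lebesgue. \<F> f \<omega> * (\<F> g \<omega> * wave t \<omega>
            * gaussian (inverse (real (Suc n))) \<omega>)) \<longlonglongrightarrow> 2 * pi * (LINT s|lebesgue. g (t - s) * f s)"
proof -
  from tame_bounded[OF g] obtain B where "B \<ge> 0" and "\<forall>t. cmod (g t) \<le> B" by (elim exE conjE)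
  hence B: "\<And>t. cmod (g t) \<le> B" by simp
  from tameD[OF g] obtain S where "finite S" "\<forall>t. t \<notin> S \<longrightarrow> isCont g t"
    by blast
  note S = this[rule_format]
  note [measurable] = tame_measurable[OF g] tame_measurable_lebesgue[OF g]
  define h where "h = (\<lambda>n u. LINT r|lebesgue. g r * complex_of_real (normal_density 0 (inverse (real (Suc n))) (u - r)))"
  have h_le: "cmod (h n u) \<le> B" for n u
  proof -
    have "ennreal (cmod (h n u)) \<le> (\<integral>\<^sup>+ r. ennreal (cmod (g r * complex_of_real (normal_density 0 (inverse (real (Suc n))) (u - r)))) \<partial>lebesgue)"
      unfolding h_def by (rule norm_integral_le_nn_integral)
    also have "\<dots> \<le> (\<integral>\<^sup>+ r. ennreal B * ennreal (normal_density 0 (inverse (real (Suc n))) (u - r)) \<partial>lebesgue)"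
      using B by (intro nn_integral_mono) (simp add: norm_mult ennreal_mult mult_right_mono ennreal_leI)
    also have "\<dots> = ennreal B"
      by (subst nn_integral_cmult) (measurable, simp add: nn_integral_normal_density_lebesgue)
    finally show ?thesis
      using order_trans[OF norm_ge_zero B[of 0]] by (simp add: ennreal_le_iff)
  qed
  have hmeas [measurable]: "(\<lambda>s. h n (t - s)) \<in> borel_measurable lebesgue" for n
  proof -
    interpret sigma_finite_measure "lebesgue :: real measure" by (rule sigma_finite_lebesgue)
    show ?thesis
      unfolding h_def normal_density_def by (rule borel_measurable_lebesgue_integral) measurable
  qed
  have "(\<lambda>n. LINT s|lebesgue. f s * h n (t - s)) \<longlonglongrightarrow> (LINT s|lebesgue. f s * g (t - s))"
  proof (rule integral_dominated_convergence)
    show "integrable lebesgue (\<lambda>s. B * cmod (f s))" using f by simp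
    show "AE s in lebesgue. norm (f s * h n (t - s)) \<le> B * cmod (f s)" for n
      using h_le by (intro AE_I2) (simp add: norm_mult mult_left_mono mult.commute[of B])
    have "finite ((\<lambda>v. t - v) ` S)" using S by simp
    hence "AE s in lebesgue. s \<notin> (\<lambda>v. t - v) ` S"
      by (intro AE_not_in null_sets_completionI finite_imp_null_set_lborel)
    thus "AE s in lebesgue. (\<lambda>n. f s * h n (t - s)) \<longlonglongrightarrow> f s * g (t - s)"
    proof eventually_elim
      case (elim s)
      hence "t - s \<notin> S" by (metis diff_diff_eq2 diff_add_cancel imageI add_diff_cancel_left')
      thus ?case unfolding h_def
        by (intro tendsto_mult tendsto_const gaussian_smoothing_tendsto[OF _ B] S) simp_all
    qed
    show "(\<lambda>s. f s * h n (t - s)) \<in> borel_measurable lebesgue" for n using f by measurable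
    show "(\<lambda>s. f s * g (t - s)) \<in> borel_measurable lebesgue"
      using f energy_reflect_shift(2)[of g t] by measurable
  qed
  hence lim: "(\<lambda>n. 2 * pi * (LINT s|lebesgue. f s * h n (t - s))) \<longlonglongrightarrow> 2 * pi * (LINT s|lebesgue. f s * g (t - s))"
    by (intro tendsto_mult tendsto_const)
  have eq: "(LINT \<omega>|lebesgue. \<F> f \<omega> * (\<F> g \<omega> * wave t \<omega>
            * gaussian (inverse (real (Suc n))) \<omega>)) = 2 * pi * (LINT s|lebesgue. f s * h n (t - s))" for n
    unfolding h_def by (rule fourier_gaussian_parseval(2)[OF f tame_integrable[OF g]]) simp
  have comm: "(LINT s|lebesgue. g (t - s) * f s) = (LINT s|lebesgue. f s * g (t - s))"
    by (simp only: mult.commute)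
  show ?thesis
    unfolding eq comm by (rule lim)
qed

section \<open>Convolutions in terms of the Fourier transform\<close>

lemma energy_modulate: "energy (\<lambda>\<omega>. f \<omega> * wave t \<omega>) = energy f"
  by (simp add: energy_def norm_mult)

lemma fourier_energy_finite:
  fixes f :: "real \<Rightarrow> complex"
  assumes "integrable lebesgue f" "energy f < \<infinity>"
  shows "energy (\<F> f) < \<infinity>"
  using fourier_energy_le[OF assms(1)] assms(2)
  by (auto simp: ennreal_mult_less_top intro: order.strict_trans1)

lemma parseval_integrable:
  fixes f g :: "real \<Rightarrow> complex"
  assumes "f \<in> borel_measurable lebesgue" "energy f < \<infinity>" "tame g"
  shows "integrable lebesgue (\<lambda>\<omega>. f \<omega> * (\<F> g \<omega> * wave t \<omega>))"
proof (rule integrable_L2_product)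
  have [measurable]: "g \<in> borel_measurable lebesgue" using assms(3) by (rule tame_measurable_lebesgue)
  show "(\<lambda>\<omega>. \<F> g \<omega> * wave t \<omega>) \<in> borel_measurable lebesgue"
    by measurable
  show "energy (\<lambda>\<omega>. \<F> g \<omega> * wave t \<omega>) < \<infinity>"
    unfolding energy_modulate using assms(3) by (intro fourier_energy_finite tame_integrable tame_energy)
qed fact+

text \<open>
Both transforms have finite energy, so their product is integrable and dominates the integrands of the
regularised identity.
\<close>

lemma parseval_convolution_integrable:
  fixes f g :: "real \<Rightarrow> complex"
  assumes f: "integrable lebesgue f" "energy f < \<infinity>" and g: "tame g"
  shows "2 * pi * (LINT s|lebesgue. g (t - s) * f s)
     = (LINT \<omega>|lebesgue. \<F> f \<omega> * (\<F> g \<omega> * wave t \<omega>))"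
proof (rule LIMSEQ_unique[OF fourier_gaussian_parseval_limit[OF f(1) g]])
  have [measurable]: "f \<in> borel_measurable lebesgue" "g \<in> borel_measurable lebesgue"
    using f tame_measurable_lebesgue[OF g] by auto
  define P where "P = (\<lambda>\<omega>. \<F> f \<omega> * (\<F> g \<omega> * wave t \<omega>))"
  have P: "integrable lebesgue P"
    unfolding P_def by (rule parseval_integrable[OF _ fourier_energy_finite[OF f] g]) measurable
  have "(\<lambda>n. LINT \<omega>|lebesgue. P \<omega> * gaussian (inverse (real (Suc n))) \<omega>) \<longlonglongrightarrow> (LINT \<omega>|lebesgue. P \<omega>)"
  proof (rule integral_dominated_convergence)
    show "integrable lebesgue (\<lambda>\<omega>. cmod (P \<omega>))" using P by simp
    show "AE \<omega> in lebesgue. norm (P \<omega> * gaussian (inverse (real (Suc n))) \<omega>) \<le> cmod (P \<omega>)" for n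
      by (intro AE_I2) (simp add: norm_mult mult_left_le)
    show "AE \<omega> in lebesgue. (\<lambda>n. P \<omega> * gaussian (inverse (real (Suc n))) \<omega>) \<longlonglongrightarrow> P \<omega>"
    proof (rule AE_I2)
      fix \<omega>
      have "(\<lambda>n. P \<omega> * gaussian (inverse (real (Suc n))) \<omega>) \<longlonglongrightarrow> P \<omega> * complex_of_real (exp (- (0 * \<omega>)\<^sup>2 / 2))"
        by (intro tendsto_intros LIMSEQ_inverse_real_of_nat) simp
      thus "(\<lambda>n. P \<omega> * gaussian (inverse (real (Suc n))) \<omega>) \<longlonglongrightarrow> P \<omega>" by simp
    qed
  qed (use P in measurable)
  thus "(\<lambda>n. LINT \<omega>|lebesgue. \<F> f \<omega> * (\<F> g \<omega> * wave t \<omega>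
            * gaussian (inverse (real (Suc n))) \<omega>))
      \<longlonglongrightarrow> (LINT \<omega>|lebesgue. \<F> f \<omega> * (\<F> g \<omega> * wave t \<omega>))"
    by (simp add: P_def mult.assoc)
qed

lemma truncation_integrable:
  fixes x :: "real \<Rightarrow> complex"
  assumes [measurable]: "x \<in> borel_measurable lebesgue" and "energy x < \<infinity>"
  shows "integrable lebesgue (\<lambda>t. indicator {- T..T} t * x t)" "energy (\<lambda>t. indicator {- T..T} t * x t) < \<infinity>"
proof -
  have m [measurable]: "(indicator {- T..T} :: real \<Rightarrow> complex) \<in> borel_measurable lebesgue"
    by (simp add: borel_imp_lebesgue)
  show "integrable lebesgue (\<lambda>t. indicator {- T..T} t * x t)"
    using tame_energy[OF tame_indicator] assms by (intro integrable_L2_product m) auto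
  have "energy (\<lambda>t. indicator {- T..T} t * x t) \<le> energy x"
    unfolding energy_def by (intro nn_integral_mono) (auto simp: indicator_def)
  thus "energy (\<lambda>t. indicator {- T..T} t * x t) < \<infinity>"
    using assms(2) by (rule order.strict_trans1)
qed

lemma has_fourier_L2D:
  assumes "has_fourier_L2 x X"
  shows "x \<in> borel_measurable lebesgue" "energy x < \<infinity>" "X \<in> borel_measurable lebesgue" "energy X < \<infinity>"
    "(\<lambda>n. energy (\<lambda>\<omega>. X \<omega> - \<F> (\<lambda>t. indicator {- real n..real n} t * x t) \<omega>)) \<longlonglongrightarrow> 0"
proof -
  from assms show *: "x \<in> borel_measurable lebesgue" "energy x < \<infinity>" "X \<in> borel_measurable lebesgue" "energy X < \<infinity>"
    by (auto simp: has_fourier_L2_def Lspace_2_iff)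
  define L where "L = (\<lambda>T. Lnorm 2 (\<lambda>\<omega>. X \<omega> - \<F> (\<lambda>t. indicator {- T..T} t * x t) \<omega>))"
  have "(L \<longlongrightarrow> 0) at_top"
    using assms by (simp add: has_fourier_L2_def L_def)
  from filterlim_compose[OF this filterlim_real_sequentially]
  have L: "(\<lambda>n. L (real n)) \<longlonglongrightarrow> 0" .
  have "(\<lambda>n. L (real n) * L (real n)) \<longlonglongrightarrow> 0 * 0"
    by (rule tendsto_mult_ennreal[OF L L]) simp
  moreover have "L T * L T = energy (\<lambda>\<omega>. X \<omega> - \<F> (\<lambda>t. indicator {- T..T} t * x t) \<omega>)" for T
  proof -
    have [measurable]: "(\<lambda>t. indicator {- T..T} t * x t) \<in> borel_measurable lebesgue"
      using truncation_integrable(1)[OF *(1,2)] by auto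
    show ?thesis
      unfolding L_def using *(3) by (subst Lnorm_2_square[symmetric]) (auto simp: power2_eq_square)
  qed
  ultimately show "(\<lambda>n. energy (\<lambda>\<omega>. X \<omega> - \<F> (\<lambda>t. indicator {- real n..real n} t * x t) \<omega>)) \<longlonglongrightarrow> 0"
    by simp
qed

text \<open>
Truncations of \<open>x\<close> are integrable, their transforms converge to \<open>X\<close> in \<open>L\<^sub>2\<close> by definition, and both sides are
continuous in \<open>x\<close> with respect to the \<open>L\<^sub>2\<close> norm by Cauchy-Schwarz.
\<close>

theorem parseval_convolution:
  fixes x X g :: "real \<Rightarrow> complex"
  assumes x: "has_fourier_L2 x X" and g: "tame g"
  shows "2 * pi * (LINT s|lebesgue. g (t - s) * x s)
     = (LINT \<omega>|lebesgue. X \<omega> * (\<F> g \<omega> * wave t \<omega>))"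
proof (rule LIMSEQ_unique)
  note [measurable] = has_fourier_L2D(1,3)[OF x] tame_measurable_lebesgue[OF g]
  define u where "u = (\<lambda>n t. indicator {- real n..real n} t * x t)"
  have u: "integrable lebesgue (u n)" "energy (u n) < \<infinity>" for n
    unfolding u_def using truncation_integrable has_fourier_L2D(1,2)[OF x] by auto
  have [measurable]: "u n \<in> borel_measurable lebesgue" for n using u(1) by auto
  have gs: "(\<lambda>s. g (t - s)) \<in> borel_measurable lebesgue" "energy (\<lambda>s. g (t - s)) < \<infinity>"
    using energy_reflect_shift[OF tame_measurable_lebesgue[OF g], of t] tame_energy[OF g] by auto
  have int: "integrable lebesgue (\<lambda>s. g (t - s) * x s)"
    by (rule integrable_L2_product) (use gs has_fourier_L2D[OF x] in auto)
  have "(\<lambda>n. LINT s|lebesgue. g (t - s) * u n s) \<longlonglongrightarrow> (LINT s|lebesgue. g (t - s) * x s)"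
  proof (rule integral_dominated_convergence)
    show "integrable lebesgue (\<lambda>s. cmod (g (t - s) * x s))" using int by simp
    show "AE s in lebesgue. norm (g (t - s) * u n s) \<le> cmod (g (t - s) * x s)" for n
      by (intro AE_I2) (auto simp: u_def indicator_def)
    show "AE s in lebesgue. (\<lambda>n. g (t - s) * u n s) \<longlonglongrightarrow> g (t - s) * x s"
      unfolding u_def by (intro AE_I2 tendsto_mult tendsto_const truncation_tendsto)
  qed (use gs(1) in measurable)
  from tendsto_mult_left[OF this, of "2 * pi"]
  show "(\<lambda>n. 2 * pi * (LINT s|lebesgue. g (t - s) * u n s)) \<longlonglongrightarrow> 2 * pi * (LINT s|lebesgue. g (t - s) * x s)" by simp
  define h where "h = (\<lambda>\<omega>. \<F> g \<omega> * wave t \<omega>)"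
  have [measurable]: "h \<in> borel_measurable lebesgue" unfolding h_def by measurable
  have h: "energy h < \<infinity>"
    unfolding h_def energy_modulate using g by (intro fourier_energy_finite tame_integrable tame_energy)
  define D where "D = (\<lambda>n. LINT \<omega>|lebesgue. (X \<omega> - \<F> (u n) \<omega>) * h \<omega>)"
  have D_eq: "D n = (LINT \<omega>|lebesgue. X \<omega> * h \<omega>) - 2 * pi * (LINT s|lebesgue. g (t - s) * u n s)" for n
  proof -
    have "D n = (LINT \<omega>|lebesgue. X \<omega> * h \<omega> - \<F> (u n) \<omega> * h \<omega>)"
      by (simp add: D_def algebra_simps)
    also have "\<dots> = (LINT \<omega>|lebesgue. X \<omega> * h \<omega>) - (LINT \<omega>|lebesgue. \<F> (u n) \<omega> * h \<omega>)"
      unfolding h_def using has_fourier_L2D[OF x] fourier_energy_finite[OF u] g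
      by (intro Bochner_Integration.integral_diff parseval_integrable) auto
    also have "(LINT \<omega>|lebesgue. \<F> (u n) \<omega> * h \<omega>) = 2 * pi * (LINT s|lebesgue. g (t - s) * u n s)"
      unfolding h_def by (rule parseval_convolution_integrable[OF u g, symmetric])
    finally show ?thesis .
  qed
  have "D \<longlonglongrightarrow> 0"
  proof (rule tendsto_zero_of_square_le)
    show "(ennreal (cmod (D n)))\<^sup>2 \<le> energy (\<lambda>\<omega>. X \<omega> - \<F> (u n) \<omega>) * energy h" for n
    proof -
      have "(ennreal (cmod (D n)))\<^sup>2 \<le> (\<integral>\<^sup>+ \<omega>. ennreal (cmod ((X \<omega> - \<F> (u n) \<omega>) * h \<omega>)) \<partial>lebesgue)\<^sup>2"
        unfolding D_def by (intro power_mono norm_integral_le_nn_integral) simp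
      also have "\<dots> \<le> energy (\<lambda>\<omega>. X \<omega> - \<F> (u n) \<omega>) * energy h"
        by (rule cauchy_schwarz_energy) measurable
      finally show ?thesis .
    qed
    have "(\<lambda>n. energy (\<lambda>\<omega>. X \<omega> - \<F> (u n) \<omega>) * energy h) \<longlonglongrightarrow> 0 * energy h"
      using has_fourier_L2D(5)[OF x] h unfolding u_def by (intro tendsto_mult_ennreal tendsto_const) auto
    thus "(\<lambda>n. energy (\<lambda>\<omega>. X \<omega> - \<F> (u n) \<omega>) * energy h) \<longlonglongrightarrow> 0" by simp
  qed
  from tendsto_diff[OF tendsto_const[of "LINT \<omega>|lebesgue. X \<omega> * h \<omega>"] this]
  show "(\<lambda>n. 2 * pi * (LINT s|lebesgue. g (t - s) * u n s))
     \<longlonglongrightarrow> (LINT \<omega>|lebesgue. X \<omega> * (\<F> g \<omega> * wave t \<omega>))"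
    by (simp add: D_eq h_def)
qed

text \<open>
Lebesgue differentiation: almost everywhere, \<open>f\<close> is a limit of its averages over short intervals.
\<close>

lemma AE_zero_of_interval_integrals:
  fixes f :: "real \<Rightarrow> complex"
  assumes int: "\<And>a b. integrable lebesgue (\<lambda>t. indicator {a..b} t * f t)"
    and zero: "\<And>a b. (LINT t|lebesgue. indicator {a..b} t * f t) = 0"
  shows "AE t in lebesgue. f t = 0"
proof -
  have eq: "(\<lambda>t. indicator {a..b} t * f t) = (\<lambda>t. indicat_real {a..b} t *\<^sub>R f t)" for a b
    by (auto simp: indicator_def)
  have set_int: "set_integrable lebesgue {a..b} f" for a b
    using int[of a b] unfolding set_integrable_def eq .
  have zero': "integral {a..b} f = 0" for a b
    using set_lebesgue_integral_eq_integral(2)[OF set_int[of a b]] zero[of a b]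
    unfolding set_lebesgue_integral_def eq by simp
  have "f integrable_on cbox a b" for a b
    using set_lebesgue_integral_eq_integral(1)[OF set_int[of a b]] by simp
  from integrable_ccontinuous_explicit[OF this]
  obtain N where N: "negligible N" and lim: "\<And>x e. \<lbrakk>x \<notin> N; 0 < e\<rbrakk> \<Longrightarrow>
      \<exists>d>0. \<forall>h. 0 < h \<and> h < d \<longrightarrow> norm (integral (cbox x (x + h *\<^sub>R One)) f /\<^sub>R h ^ DIM(real) - f x) < e"
    by blast
  have "f x = 0" if "x \<notin> N" for x
  proof (rule ccontr)
    assume "f x \<noteq> 0"
    with lim[OF that, of "cmod (f x)"] obtain d where d: "d > 0"
      and "\<forall>h. 0 < h \<and> h < d \<longrightarrow> norm (integral (cbox x (x + h *\<^sub>R One)) f /\<^sub>R h ^ DIM(real) - f x) < cmod (f x)"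
      by auto
    from this(2)[rule_format, of "d / 2"] d show False
      by (simp add: zero')
  qed
  moreover have "AE x in lebesgue. x \<notin> N"
    using N by (intro AE_not_in) (simp add: negligible_iff_null_sets)
  ultimately show ?thesis by (auto elim: eventually_mono)
qed

text \<open>
Testing against indicators of intervals through the Parseval identities, both for integrable and for
square-integrable \<open>x\<close>, shows that \<open>x\<close> and \<open>g\<close> have the same integrals over all intervals. It is used to identify
an arbitrary kernel with rational transform with an explicit exponential one.
\<close>

lemma fourier_determines_tame:
  fixes x X g :: "real \<Rightarrow> complex"
  assumes x: "has_fourier x X" and g: "tame g" and eq: "AE \<omega> in lebesgue. X \<omega> = \<F> g \<omega>"
  shows "AE t in lebesgue. x t = g t"
proof -
  have xm [measurable]: "x \<in> borel_measurable lebesgue"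
    using x by (auto simp: has_fourier_def has_fourier_L2_def Lspace_def)
  have gm [measurable]: "g \<in> borel_measurable lebesgue"
    using tame_measurable_lebesgue[OF g] .
  have im [measurable]: "(indicator {a..b} :: real \<Rightarrow> complex) \<in> borel_measurable lebesgue" for a b :: real
    by (simp add: borel_imp_lebesgue)
  have gi: "integrable lebesgue (\<lambda>t. indicator {a..b} t * g t)" for a b
    using tame_energy[OF tame_indicator] tame_energy[OF g] by (intro integrable_L2_product) auto
  have "integrable lebesgue (\<lambda>t. indicator {a..b} t * x t) \<and>
      (LINT t|lebesgue. indicator {a..b} t * x t) = (LINT t|lebesgue. indicator {a..b} t * g t)" for a b :: real
  proof -
    define h where "h = (\<lambda>t::real. indicator {a..b} (- t) :: complex)"
    have h: "tame h" unfolding h_def by (rule tame_reflect[OF tame_indicator])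
    have [measurable]: "h \<in> borel_measurable lebesgue" using tame_measurable_lebesgue[OF h] .
    have hi: "h (0 - s) = indicator {a..b} s" for s by (simp add: h_def)
    consider (L1) "x \<in> Lspace 1" "X = \<F> x" | (L2) "has_fourier_L2 x X"
      using x unfolding has_fourier_def by blast
    thus ?thesis
    proof cases
      case L1
      have xi: "integrable lebesgue x" using L1(1) by (rule Lspace_1_imp_integrable)
      have "integrable lebesgue (\<lambda>t. indicator {a..b} t * x t)"
        by (rule integrable_modulate[OF xi im, where B = 1]) (simp add: indicator_def)
      moreover have "2 * pi * (LINT s|lebesgue. h (0 - s) * x s) = 2 * pi * (LINT s|lebesgue. h (0 - s) * g s)"
      proof (rule LIMSEQ_unique)
        show "(\<lambda>n. LINT \<omega>|lebesgue. \<F> x \<omega> * (\<F> h \<omega> * wave 0 \<omega>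
            * gaussian (inverse (real (Suc n))) \<omega>)) \<longlonglongrightarrow> 2 * pi * (LINT s|lebesgue. h (0 - s) * x s)"
          by (rule fourier_gaussian_parseval_limit[OF xi h])
        have "(LINT \<omega>|lebesgue. \<F> x \<omega> * (\<F> h \<omega> * wave 0 \<omega>
            * gaussian (inverse (real (Suc n))) \<omega>))
          = (LINT \<omega>|lebesgue. \<F> g \<omega> * (\<F> h \<omega> * wave 0 \<omega>
            * gaussian (inverse (real (Suc n))) \<omega>))" for n
          by (rule integral_cong_AE; (measurable)?) (use eq L1 in \<open>auto elim!: eventually_mono\<close>)
        thus "(\<lambda>n. LINT \<omega>|lebesgue. \<F> x \<omega> * (\<F> h \<omega> * wave 0 \<omega>
            * gaussian (inverse (real (Suc n))) \<omega>)) \<longlonglongrightarrow> 2 * pi * (LINT s|lebesgue. h (0 - s) * g s)"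
          using fourier_gaussian_parseval_limit[OF tame_integrable[OF g] h, of 0] by presburger
      qed
      ultimately show ?thesis unfolding hi by simp
    next
      case L2
      have "integrable lebesgue (\<lambda>t. indicator {a..b} t * x t)"
        using tame_energy[OF tame_indicator] has_fourier_L2D[OF L2] by (intro integrable_L2_product) auto
      moreover have "2 * pi * (LINT s|lebesgue. h (0 - s) * x s) = 2 * pi * (LINT s|lebesgue. h (0 - s) * g s)"
        unfolding parseval_convolution[OF L2 h] parseval_convolution_integrable[OF tame_integrable[OF g] tame_energy[OF g] h]
        by (rule integral_cong_AE; (measurable)?) (use eq has_fourier_L2D[OF L2] in \<open>auto elim!: eventually_mono\<close>)
      ultimately show ?thesis unfolding hi by simp
    qed
  qed
  hence "AE t in lebesgue. x t - g t = 0"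
    using gi by (intro AE_zero_of_interval_integrals) (simp_all add: right_diff_distrib)
  thus ?thesis by simp
qed

lemma energy_diff_le: "energy (\<lambda>t. f t - g t) \<le> 2 * energy (\<lambda>t. f t - h t) + 2 * energy (\<lambda>t. g t - h t)"
  if [measurable]: "f \<in> borel_measurable lebesgue" "g \<in> borel_measurable lebesgue" "h \<in> borel_measurable lebesgue"
proof -
  have "energy (\<lambda>t. f t - g t) \<le> (\<integral>\<^sup>+ t. 2 * (ennreal (cmod (f t - h t)))\<^sup>2 + 2 * (ennreal (cmod (g t - h t)))\<^sup>2 \<partial>lebesgue)"
    unfolding energy_def
  proof (rule nn_integral_mono)
    fix t
    have "cmod (f t - g t) \<le> cmod (f t - h t) + cmod (g t - h t)"
      by (metis norm_triangle_sub norm_minus_commute diff_add_cancel add_diff_eq norm_diff_triangle_ineq norm_triangle_ineq4 diff_diff_eq2)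
    hence "(cmod (f t - g t))\<^sup>2 \<le> (cmod (f t - h t) + cmod (g t - h t))\<^sup>2"
      by (rule power_mono) simp
    also have "\<dots> \<le> 2 * (cmod (f t - h t))\<^sup>2 + 2 * (cmod (g t - h t))\<^sup>2"
      using zero_le_power2[of "cmod (f t - h t) - cmod (g t - h t)"] by (simp add: power2_sum power2_diff)
    finally have "ennreal ((cmod (f t - g t))\<^sup>2) \<le> ennreal (2 * (cmod (f t - h t))\<^sup>2 + 2 * (cmod (g t - h t))\<^sup>2)"
      by (rule ennreal_leI)
    thus "(ennreal (cmod (f t - g t)))\<^sup>2 \<le> 2 * (ennreal (cmod (f t - h t)))\<^sup>2 + 2 * (ennreal (cmod (g t - h t)))\<^sup>2"
      by (simp add: ennreal_power ennreal_mult)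
  qed
  also have "\<dots> = 2 * energy (\<lambda>t. f t - h t) + 2 * energy (\<lambda>t. g t - h t)"
    unfolding energy_def by (subst nn_integral_add) (auto simp: nn_integral_cmult)
  finally show ?thesis .
qed

lemma energy_zero_imp_AE:
  assumes "energy f = 0" and [measurable]: "f \<in> borel_measurable lebesgue"
  shows "AE t in lebesgue. f t = 0"
  using assms(1) unfolding energy_def by (subst (asm) nn_integral_0_iff_AE) auto

text \<open>
If \<open>x\<close> is integrable as well, the truncated transforms converge both pointwise to the Fourier integral
and in \<open>L\<^sub>2\<close> to \<open>X\<close>, and Fatou's lemma identifies the limits.
\<close>

lemma fourier_transform_unique:
  fixes x X :: "real \<Rightarrow> complex"
  assumes x: "has_fourier_L2 x X" and x': "has_fourier x X'"
  shows "AE \<omega> in lebesgue. X \<omega> = X' \<omega>"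
proof -
  note [measurable] = has_fourier_L2D(1,3)[OF x]
  define u where "u = (\<lambda>n t. indicator {- real n..real n} t * x t)"
  have [measurable]: "u n \<in> borel_measurable lebesgue" for n
    unfolding u_def using truncation_integrable(1)[OF has_fourier_L2D(1,2)[OF x], of "real n"] by auto
  have lim: "(\<lambda>n. energy (\<lambda>\<omega>. X \<omega> - \<F> (u n) \<omega>)) \<longlonglongrightarrow> 0"
    using has_fourier_L2D(5)[OF x] by (simp add: u_def)
  consider (L1) "x \<in> Lspace 1" "X' = \<F> x" | (L2) "has_fourier_L2 x X'"
    using x' unfolding has_fourier_def by blast
  thus ?thesis
  proof cases
    case L1
    have xi: "integrable lebesgue x" using L1(1) by (rule Lspace_1_imp_integrable)
    have pw: "(\<lambda>n. \<F> (u n) \<omega>) \<longlonglongrightarrow> X' \<omega>" for \<omega>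
      unfolding L1(2) fourier_integral_def
    proof (rule integral_dominated_convergence)
      show "integrable lebesgue (\<lambda>t. cmod (x t))" using xi by simp
      show "AE t in lebesgue. norm (exp (- (\<i> * of_real \<omega> * of_real t)) * u n t) \<le> cmod (x t)" for n
        by (intro AE_I2) (auto simp: u_def indicator_def norm_mult)
      show "AE t in lebesgue. (\<lambda>n. exp (- (\<i> * of_real \<omega> * of_real t)) * u n t) \<longlonglongrightarrow> exp (- (\<i> * of_real \<omega> * of_real t)) * x t"
        unfolding u_def by (intro AE_I2 tendsto_mult tendsto_const truncation_tendsto)
    qed measurable
    have le: "energy (\<lambda>\<omega>. X \<omega> - X' \<omega>) \<le> e" if "e > 0" for e
    proof -
      obtain N where N: "\<And>n. n \<ge> N \<Longrightarrow> energy (\<lambda>\<omega>. X \<omega> - \<F> (u n) \<omega>) < e"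
        using order_tendstoD(2)[OF lim \<open>e > 0\<close>] by (auto simp: eventually_sequentially)
      show ?thesis
        unfolding energy_def
      proof (rule nn_integral_limit_le)
        show "(\<integral>\<^sup>+ \<omega>. (ennreal (cmod (X \<omega> - \<F> (u (n + N)) \<omega>)))\<^sup>2 \<partial>lebesgue) \<le> e" for n
          using N[of "n + N"] by (simp add: energy_def)
        show "AE \<omega> in lebesgue. (\<lambda>n. (ennreal (cmod (X \<omega> - \<F> (u (n + N)) \<omega>)))\<^sup>2) \<longlonglongrightarrow> (ennreal (cmod (X \<omega> - X' \<omega>)))\<^sup>2"
          unfolding ennreal_power[OF norm_ge_zero]
          by (intro AE_I2 tendsto_ennrealI tendsto_intros LIMSEQ_ignore_initial_segment pw)
      qed measurable
    qed
    have "energy (\<lambda>\<omega>. X \<omega> - X' \<omega>) = 0"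
      using le by (metis not_gr_zero dense not_le)
    hence "AE \<omega> in lebesgue. X \<omega> - X' \<omega> = 0"
      unfolding L1(2) by (rule energy_zero_imp_AE) measurable
    thus ?thesis by simp
  next
    case L2
    note [measurable] = has_fourier_L2D(3)[OF L2]
    have lim': "(\<lambda>n. energy (\<lambda>\<omega>. X' \<omega> - \<F> (u n) \<omega>)) \<longlonglongrightarrow> 0"
      using has_fourier_L2D(5)[OF L2] by (simp add: u_def)
    have "(\<lambda>n. 2 * energy (\<lambda>\<omega>. X \<omega> - \<F> (u n) \<omega>) + 2 * energy (\<lambda>\<omega>. X' \<omega> - \<F> (u n) \<omega>)) \<longlonglongrightarrow> 2 * 0 + 2 * 0"
      by (intro tendsto_add tendsto_mult_ennreal tendsto_const lim lim') auto
    moreover have "energy (\<lambda>\<omega>. X \<omega> - X' \<omega>) \<le> 2 * energy (\<lambda>\<omega>. X \<omega> - \<F> (u n) \<omega>) + 2 * energy (\<lambda>\<omega>. X' \<omega> - \<F> (u n) \<omega>)" for n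
      by (rule energy_diff_le) measurable
    ultimately have "energy (\<lambda>\<omega>. X \<omega> - X' \<omega>) \<le> 2 * 0 + 2 * 0"
      by (intro LIMSEQ_le_const) auto
    hence "AE \<omega> in lebesgue. X \<omega> - X' \<omega> = 0"
      by (intro energy_zero_imp_AE) auto
    thus ?thesis by simp
  qed
qed

text \<open>
By the Parseval identity, \<open>2 \<pi> z(t)\<close> is the Fourier integral of the integrable function \<open>X G\<close> at \<open>- t\<close>, where \<open>G\<close> is
the transform of \<open>g\<close>; the energy inequality applies to it.
\<close>

lemma convolution_bounds:
  fixes x X g :: "real \<Rightarrow> complex"
  assumes x: "has_fourier_L2 x X" and g: "tame g"
  defines "z \<equiv> \<lambda>t. LINT s|lebesgue. g (t - s) * x s"
  shows "z \<in> borel_measurable lebesgue"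
    and "2 * pi * energy z \<le> energy (\<lambda>\<omega>. X \<omega> * \<F> g \<omega>)"
    and "2 * pi * ennreal (cmod (z t)) \<le> (\<integral>\<^sup>+ \<omega>. ennreal (cmod (X \<omega> * \<F> g \<omega>)) \<partial>lebesgue)"
proof -
  note [measurable] = has_fourier_L2D(1,3)[OF x] tame_measurable_lebesgue[OF g]
  define P where "P = (\<lambda>\<omega>. X \<omega> * \<F> g \<omega>)"
  have P: "integrable lebesgue P"
    using parseval_integrable[OF has_fourier_L2D(3,4)[OF x] g, of 0] by (simp add: P_def)
  hence [measurable]: "P \<in> borel_measurable lebesgue" by auto
  have z: "2 * pi * z t = \<F> P (- t)" for t
    unfolding z_def parseval_convolution[OF x g] fourier_integral_def[of _ "- t"] P_def
    by (intro Bochner_Integration.integral_cong refl) (simp add: mult_ac)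
  have eq: "z t = inverse (2 * pi) * \<F> P (0 - t)" for t
    unfolding diff_0 z[symmetric] by simp
  show "z \<in> borel_measurable lebesgue"
    unfolding eq[abs_def] using energy_reflect_shift(2)[of "\<F> P" 0] by measurable
  have "(2 * pi) * ((2 * pi) * energy z) = energy (\<lambda>t. 2 * pi * z t)"
  proof -
    have "energy (\<lambda>t. 2 * pi * z t) = (\<integral>\<^sup>+ t. ennreal (2 * pi) * (ennreal (2 * pi) * (ennreal (cmod (z t)))\<^sup>2) \<partial>lebesgue)"
      unfolding energy_def
      by (intro nn_integral_cong) (simp add: norm_mult ennreal_mult power2_eq_square mult_ac)
    also have "\<dots> = ennreal (2 * pi) * (ennreal (2 * pi) * energy z)"
      unfolding energy_def using \<open>z \<in> borel_measurable lebesgue\<close> by (simp add: nn_integral_cmult)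
    finally show ?thesis by simp
  qed
  also have "\<dots> = energy (\<lambda>t. \<F> P (0 - t))" by (simp only: z diff_0)
  also have "\<dots> = energy (\<F> P)" by (rule energy_reflect_shift) measurable
  also have "\<dots> \<le> 2 * pi * energy P" by (rule fourier_energy_le[OF P])
  finally show "2 * pi * energy z \<le> energy (\<lambda>\<omega>. X \<omega> * \<F> g \<omega>)"
    unfolding P_def by (subst (asm) ennreal_mult_le_mult_iff) auto
  have "2 * pi * ennreal (cmod (z t)) = ennreal (cmod (\<F> P (- t)))"
    unfolding z[symmetric] by (simp add: norm_mult ennreal_mult)
  also have "\<dots> \<le> (\<integral>\<^sup>+ \<omega>. ennreal (cmod (exp (- (\<i> * of_real (- t) * of_real \<omega>)) * P \<omega>)) \<partial>lebesgue)"
    unfolding fourier_integral_def by (rule norm_integral_le_nn_integral)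
  also have "\<dots> = (\<integral>\<^sup>+ \<omega>. ennreal (cmod (P \<omega>)) \<partial>lebesgue)"
    unfolding norm_mult cmod_exp_imaginary by simp
  finally show "2 * pi * ennreal (cmod (z t)) \<le> (\<integral>\<^sup>+ \<omega>. ennreal (cmod (X \<omega> * \<F> g \<omega>)) \<partial>lebesgue)"
    by (simp add: P_def)
qed

section \<open>Causal kernels with entire symbols\<close>

lemma power_div_fact_le_exp:
  fixes x :: real
  assumes "x \<ge> 0"
  shows "x ^ n / fact n \<le> exp x"
proof -
  have "(\<Sum>k\<in>{n}. x ^ k / fact k) \<le> (\<Sum>k. x ^ k / fact k)"
    using assms summable_exp[of x] by (intro sum_le_suminf) (auto simp: field_simps)
  thus ?thesis by (simp add: exp_def divide_inverse scaleR_conv_of_real mult.commute)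
qed

lemma monomial_exp_bound:
  assumes "Re z > 0" "t \<ge> 0"
  shows "cmod (of_real t ^ n / fact n * exp (- (z * of_real t))) \<le> (2 / Re z) ^ n * exp (- (Re z / 2 * \<bar>t\<bar>))"
proof -
  have "(Re z / 2 * t) ^ n / fact n \<le> exp (Re z / 2 * t)"
    using assms by (intro power_div_fact_le_exp) simp
  hence "(2 / Re z) ^ n * ((Re z / 2 * t) ^ n / fact n) * exp (- (Re z * t)) \<le> (2 / Re z) ^ n * exp (Re z / 2 * t) * exp (- (Re z * t))"
    using assms by (intro mult_right_mono mult_left_mono) auto
  also have "(2 / Re z) ^ n * ((Re z / 2 * t) ^ n / fact n) = t ^ n / fact n"
    using assms by (simp add: power_mult_distrib power_divide field_simps)
  also have "(2 / Re z) ^ n * exp (Re z / 2 * t) * exp (- (Re z * t)) = (2 / Re z) ^ n * exp (- (Re z / 2 * t))"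
    by (simp add: mult.assoc flip: exp_add)
  finally show ?thesis
    using assms by (simp add: norm_mult norm_divide norm_power)
qed

lemma tame_on_half_line:
  assumes cont: "continuous_on UNIV f" and a: "a > 0"
    and bd: "\<And>t. t \<ge> 0 \<Longrightarrow> cmod (f t) \<le> C * exp (- (a * \<bar>t\<bar>))"
  shows "tame (\<lambda>t. if t < 0 then 0 else f t)"
proof (rule tameI[where S = "{0}" and a = a and C = C])
  show "(\<lambda>t. if t < 0 then 0 else f t) \<in> borel_measurable borel"
    using borel_measurable_continuous_onI[OF cont] by measurable
  have "cmod (f 0) \<le> C" using bd[of 0] by simp
  hence "C \<ge> 0" by (rule order_trans[OF norm_ge_zero])
  thus "cmod (if t < 0 then 0 else f t) \<le> C * exp (- (a * \<bar>t\<bar>))" for t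
    using bd[of t] by simp
  show "isCont (\<lambda>t. if t < 0 then 0 else f t) t" if t: "t \<notin> {0}" for t
  proof (cases "t < 0")
    case True
    have "continuous_on {..<0} (\<lambda>t. if t < 0 then 0 else f t)"
      by (rule continuous_on_eq[of _ "\<lambda>_. 0"]) auto
    with True show ?thesis by (simp add: continuous_on_eq_continuous_at)
  next
    case False
    have "continuous_on {0<..} (\<lambda>t. if t < 0 then 0 else f t)"
      by (rule continuous_on_eq[of _ f]) (use continuous_on_subset[OF cont] in auto)
    with False t show ?thesis by (simp add: continuous_on_eq_continuous_at)
  qed
qed (use a in auto)

definition moment_kernel :: "complex \<Rightarrow> nat \<Rightarrow> real \<Rightarrow> complex" where
  "moment_kernel z n t = (if t < 0 then 0 else of_real t ^ n / fact n * exp (- (z * of_real t)))"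

lemma moment_kernel_tame:
  assumes "Re z > 0"
  shows "tame (moment_kernel z n)"
  unfolding moment_kernel_def[abs_def]
  by (rule tame_on_half_line[OF _ _ monomial_exp_bound[OF assms]]) (use assms in \<open>auto intro!: continuous_intros\<close>)

lemma moment_kernel_deriv:
  fixes z :: complex
  shows "((\<lambda>t. of_real t ^ Suc n / fact (Suc n) * exp (- (z * of_real t))) has_vector_derivative
     (of_real t ^ n / fact n * exp (- (z * of_real t)) - z * (of_real t ^ Suc n / fact (Suc n) * exp (- (z * of_real t))))) (at t within S)"
proof -
  have "((\<lambda>w. w ^ Suc n / fact (Suc n) * exp (- (z * w))) has_field_derivative
      (w ^ n / fact n * exp (- (z * w)) - z * (w ^ Suc n / fact (Suc n) * exp (- (z * w))))) (at w within T)" for w :: complex and T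
  proof -
    have "of_nat (Suc n) * w ^ n / fact (Suc n) = w ^ n / fact n"
      by (simp add: fact_Suc del: of_nat_Suc)
    moreover have "((\<lambda>w. w ^ Suc n / fact (Suc n)) has_field_derivative of_nat (Suc n) * w ^ n / fact (Suc n)) (at w within T)"
      by (rule DERIV_cdivide) (auto intro!: derivative_eq_intros simp del: of_nat_Suc power_Suc)
    ultimately have "((\<lambda>w. w ^ Suc n / fact (Suc n)) has_field_derivative w ^ n / fact n) (at w within T)"
      by simp
    moreover have "((\<lambda>w. exp (- (z * w))) has_field_derivative - z * exp (- (z * w))) (at w within T)"
      by (auto intro!: derivative_eq_intros)
    ultimately show ?thesis
      by (rule DERIV_cong[OF DERIV_mult]) (simp add: mult_ac)
  qed
  from field_vector_diff_chain_within[OF has_vector_derivative_of_real[OF DERIV_ident] this]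
  show ?thesis by (simp add: o_def)
qed

lemma integral_half_line_derivative:
  fixes F f :: "real \<Rightarrow> complex"
  assumes F: "\<And>t. (F has_vector_derivative f t) (at t)" and cont: "continuous_on UNIV f"
    and int: "integrable lebesgue (\<lambda>t. if t < 0 then 0 else f t)"
    and lim: "(F \<longlongrightarrow> L) at_top"
  shows "(LINT t|lebesgue. (if t < 0 then 0 else f t)) = L - F 0"
proof (rule LIMSEQ_unique)
  define g where "g = (\<lambda>t. if t < 0 then 0 else f t)"
  have g: "integrable lebesgue g" using int by (simp add: g_def)
  have eq: "(\<lambda>t. indicat_real {0..real n} t *\<^sub>R f t) = (\<lambda>t. indicator {0..real n} t * g t)" for n
    by (auto simp: g_def indicator_def)
  have "(LINT t|lborel. indicat_real {0..real n} t *\<^sub>R f t) = F (real n) - F 0" for n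
    by (rule integral_FTC_atLeastAtMost)
      (auto intro: has_vector_derivative_at_within[OF F] continuous_on_subset[OF cont])
  moreover have "(LINT t|lebesgue. indicat_real {0..real n} t *\<^sub>R f t) = (LINT t|lborel. indicat_real {0..real n} t *\<^sub>R f t)" for n
    using borel_measurable_continuous_onI[OF cont] by (subst integral_completion) auto
  ultimately have FTC: "(LINT t|lebesgue. indicator {0..real n} t * g t) = F (real n) - F 0" for n
    by (simp add: eq)
  show "(\<lambda>n. LINT t|lebesgue. indicator {0..real n} t * g t) \<longlonglongrightarrow> L - F 0"
    unfolding FTC by (intro tendsto_intros filterlim_compose[OF lim filterlim_real_sequentially])
  have "(\<lambda>n. LINT t|lebesgue. indicator {0..real n} t * g t) \<longlonglongrightarrow> (LINT t|lebesgue. g t)"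
  proof (rule integral_dominated_convergence)
    show "integrable lebesgue (\<lambda>t. cmod (g t))" using g by simp
    show "AE t in lebesgue. norm (indicator {0..real n} t * g t) \<le> cmod (g t)" for n
      by (intro AE_I2) (auto simp: indicator_def)
    show "g \<in> borel_measurable lebesgue" using g by auto
    thus "(\<lambda>t. indicator {0..real n} t * g t) \<in> borel_measurable lebesgue" for n
      by (intro borel_measurable_times borel_imp_lebesgue[of "indicator {0..real n}"]) auto
    show "AE t in lebesgue. (\<lambda>n. indicator {0..real n} t * g t) \<longlonglongrightarrow> g t"
    proof (rule AE_I2)
      fix t
      have "(\<lambda>n. indicator {0..real n} t * g t) = (\<lambda>n. indicator {- real n..real n} t * g t)"
        by (auto simp: indicator_def g_def)
      thus "(\<lambda>n. indicator {0..real n} t * g t) \<longlonglongrightarrow> g t"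
        using truncation_tendsto[of t g] by presburger
    qed
  qed
  thus "(\<lambda>n. LINT t|lebesgue. indicator {0..real n} t * g t) \<longlonglongrightarrow> (LINT t|lebesgue. (if t < 0 then 0 else f t))"
    by (simp add: g_def)
qed

lemma monomial_exp_tendsto_zero:
  assumes "Re z > 0"
  shows "((\<lambda>t. of_real t ^ n / fact n * exp (- (z * of_real t))) \<longlongrightarrow> 0) at_top"
proof (rule Lim_null_comparison)
  show "\<forall>\<^sub>F t in at_top. norm (of_real t ^ n / fact n * exp (- (z * of_real t))) \<le> (2 / Re z) ^ n * exp (- (Re z / 2 * \<bar>t\<bar>))"
    using eventually_ge_at_top[of 0] by eventually_elim (rule monomial_exp_bound[OF assms])
  have "((\<lambda>t. exp (- (Re z / 2 * \<bar>t\<bar>))) \<longlongrightarrow> 0) at_top"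
    using assms by real_asymp
  from tendsto_mult_left[OF this, of "(2 / Re z) ^ n"]
  show "((\<lambda>t. (2 / Re z) ^ n * exp (- (Re z / 2 * \<bar>t\<bar>))) \<longlongrightarrow> 0) at_top" by simp
qed

text \<open>
Integration by parts: \<open>t\<^sup>n\<^sup>+\<^sup>1 e\<^sup>-\<^sup>z\<^sup>t / (n+1)!\<close> vanishes at 0 and at infinity, so the integral of its
derivative is zero.
\<close>

lemma moment_kernel_integral:
  assumes z: "Re z > 0"
  shows "(LINT t|lebesgue. moment_kernel z n t) = 1 / z ^ Suc n"
proof (induction n)
  case 0
  have "(LINT t|lebesgue. (if t < 0 then 0 else - z * exp (- (z * of_real t)))) = 0 - exp (- (z * of_real 0))"
  proof (rule integral_half_line_derivative)
    fix t
    have "((\<lambda>w. exp (- (z * w))) has_field_derivative - z * exp (- (z * w))) (at w within T)" for w T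
      by (auto intro!: derivative_eq_intros)
    from field_vector_diff_chain_within[OF has_vector_derivative_of_real[OF DERIV_ident] this]
    show "((\<lambda>t. exp (- (z * of_real t))) has_vector_derivative - z * exp (- (z * of_real t))) (at t)"
      by (simp add: o_def)
    have eq: "(\<lambda>t. if t < 0 then 0 else - z * exp (- (z * of_real t))) = (\<lambda>t. - z * moment_kernel z 0 t)"
      by (auto simp: moment_kernel_def)
    show "integrable lebesgue (\<lambda>t. if t < 0 then 0 else - z * exp (- (z * of_real t)))"
      unfolding eq using tame_integrable[OF moment_kernel_tame[OF z]] by simp
    show "((\<lambda>t. exp (- (z * of_real t))) \<longlongrightarrow> 0) at_top"
      using monomial_exp_tendsto_zero[OF z, of 0] by simp
  qed (intro continuous_intros)
  moreover have "(LINT t|lebesgue. (if t < 0 then 0 else - z * exp (- (z * of_real t)))) = (LINT t|lebesgue. - z * moment_kernel z 0 t)"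
    by (intro Bochner_Integration.integral_cong refl) (auto simp: moment_kernel_def)
  ultimately have "- z * (LINT t|lebesgue. moment_kernel z 0 t) = -1" by simp
  moreover have "z \<noteq> 0" using z by auto
  ultimately show ?case by (simp add: field_simps)
next
  case (Suc n)
  let ?f = "\<lambda>n t. of_real t ^ n / fact n * exp (- (z * of_real t)) :: complex"
  have eq: "(\<lambda>t. if t < 0 then 0 else ?f n t - z * ?f (Suc n) t) = (\<lambda>t. moment_kernel z n t - z * moment_kernel z (Suc n) t)"
    by (auto simp: moment_kernel_def)
  have int: "integrable lebesgue (moment_kernel z n)" "integrable lebesgue (\<lambda>t. z * moment_kernel z (Suc n) t)"
    using tame_integrable[OF moment_kernel_tame[OF z]] by simp_all
  have "(LINT t|lebesgue. (if t < 0 then 0 else ?f n t - z * ?f (Suc n) t)) = 0 - ?f (Suc n) 0"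
  proof (rule integral_half_line_derivative)
    show "(?f (Suc n) has_vector_derivative ?f n t - z * ?f (Suc n) t) (at t)" for t
      by (rule moment_kernel_deriv)
    show "integrable lebesgue (\<lambda>t. if t < 0 then 0 else ?f n t - z * ?f (Suc n) t)"
      unfolding eq using int by simp
    show "(?f (Suc n) \<longlongrightarrow> 0) at_top"
      by (rule monomial_exp_tendsto_zero[OF z])
  qed (auto intro!: continuous_intros simp del: fact_Suc of_nat_Suc)
  hence "(LINT t|lebesgue. moment_kernel z n t - z * moment_kernel z (Suc n) t) = 0"
    unfolding eq by simp
  hence "(LINT t|lebesgue. moment_kernel z n t) = z * (LINT t|lebesgue. moment_kernel z (Suc n) t)"
    using int by simp
  moreover have "z \<noteq> 0" using z by auto
  ultimately show ?case using Suc.IH by (simp add: field_simps)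
qed

lemma laplace_eq_integral:
  "laplace v p = (LINT t|lebesgue. (if t < 0 then 0 else exp (- (p * of_real t)) * v t))"
  unfolding laplace_def set_lebesgue_integral_def
  by (intro Bochner_Integration.integral_cong refl) (auto simp: indicator_def)

lemma laplace_eq_fourier:
  assumes "\<And>t. t < 0 \<Longrightarrow> v t = 0"
  shows "laplace v (Complex s \<omega>) = \<F> (\<lambda>t. exp (- of_real (s * t)) * v t) \<omega>"
  unfolding laplace_eq_integral fourier_integral_def
proof (intro Bochner_Integration.integral_cong refl)
  fix t
  have "exp (- (Complex s \<omega> * of_real t)) = exp (- (\<i> * of_real \<omega> * of_real t)) * exp (- of_real (s * t))"
    by (simp add: Complex_eq algebra_simps flip: exp_add)
  thus "(if t < 0 then 0 else exp (- (Complex s \<omega> * of_real t)) * v t) = exp (- (\<i> * of_real \<omega> * of_real t)) * (exp (- of_real (s * t)) * v t)"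
    using assms[of t] by (simp add: mult.assoc)
qed

text \<open>
If \<open>E(u) = \<Sum> e\<^sub>n u\<^sup>n\<close> with \<open>e\<^sub>0 = 0\<close>, then termwise inversion of \<open>(p + \<mu>)\<^sup>-\<^sup>n\<close> suggests the kernel
\<open>v(t) = e\<^sup>-\<^sup>\<mu>\<^sup>t \<Sum> e\<^sub>n\<^sub>+\<^sub>1 t\<^sup>n / n!\<close>. The coefficients of an entire function decay faster than any geometric
sequence, which gives exponential decay of \<open>v\<close> and justifies the termwise integration.
\<close>

theorem entire_function_laplace_kernel:
  assumes E: "E holomorphic_on UNIV" and E0: "E 0 = 0" and \<mu>: "Re \<mu> > 0"
  shows "\<exists>v. tame v \<and> (\<forall>t<0. v t = 0) \<and> (\<forall>p. Re p \<ge> 0 \<longrightarrow> laplace v p = E (1 / (p + \<mu>)))"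
proof -
  define e where "e = (\<lambda>n. (deriv ^^ n) E 0 / fact n)"
  have E_sums: "(\<lambda>n. e n * u ^ n) sums E u" for u
    using holomorphic_power_series[of E 0 "cmod u + 1" u] holomorphic_on_subset[OF E]
    by (simp add: e_def)
  have "e 0 = 0" using E0 by (simp add: e_def)
  with E_sums have E_sums': "(\<lambda>n. e (Suc n) * u ^ Suc n) sums E u" for u
    using sums_Suc_iff[of "\<lambda>n. e n * u ^ n" "E u"] by simp
  \<comment> \<open>Half of the decay rate absorbs the growth of the power series, the other half remains for \<open>v\<close>.\<close>
  define r where "r = Re \<mu> / 2"
  have r: "r > 0" using \<mu> by (simp add: r_def)
  obtain C where C: "\<And>n. cmod (e (Suc n)) \<le> C * r ^ n"
  proof -
    \<comment> \<open>Convergence of the series at the point \<open>1 / r\<close> bounds its terms.\<close>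
    have "(\<lambda>n. e (Suc n) * of_real (1 / r) ^ Suc n) \<longlonglongrightarrow> 0"
      using E_sums'[of "of_real (1 / r)"] by (intro summable_LIMSEQ_zero) (rule sums_summable)
    hence "Bseq (\<lambda>n. e (Suc n) * of_real (1 / r) ^ Suc n)"
      by (intro convergent_imp_Bseq convergentI)
    then obtain K where K: "\<And>n. cmod (e (Suc n) * of_real (1 / r) ^ Suc n) \<le> K"
      unfolding Bseq_def by blast
    show ?thesis
    proof (rule that)
      fix n
      have "cmod (e (Suc n)) * (1 / r) ^ Suc n \<le> K"
        using K[of n] r by (simp add: norm_mult norm_power norm_divide del: power_Suc)
      from mult_right_mono[OF this, of "r ^ Suc n"] r
      show "cmod (e (Suc n)) \<le> (K * r) * r ^ n"
        by (simp add: power_divide mult_ac)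
    qed
  qed
  have C0: "C \<ge> 0" using order_trans[OF norm_ge_zero C[of 0]] by simp
  define S where "S = (\<lambda>w. \<Sum>n. e (Suc n) / fact n * w ^ n)"
  have S_le: "cmod (e (Suc n) / fact n * w ^ n) \<le> C * ((r * cmod w) ^ n / fact n)" for n w
  proof -
    have "cmod (e (Suc n) / fact n * w ^ n) = cmod (e (Suc n)) * (cmod w ^ n / fact n)"
      by (simp add: norm_mult norm_divide norm_power)
    also have "\<dots> \<le> (C * r ^ n) * (cmod w ^ n / fact n)"
      by (intro mult_right_mono C) simp
    finally show ?thesis by (simp add: power_mult_distrib mult_ac)
  qed
  have sum_exp: "(\<lambda>n. C * (x ^ n / fact n)) sums (C * exp x)" for x :: real
    using sums_mult[OF exp_converges[of x], of C] by (simp add: scaleR_conv_of_real field_simps)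
  have S_abs: "summable (\<lambda>n. cmod (e (Suc n) / fact n * w ^ n))" for w
    by (rule summable_comparison_test'[OF sums_summable[OF sum_exp[of "r * cmod w"]]]) (use S_le in simp)
  have S_bound: "cmod (S w) \<le> C * exp (r * cmod w)" for w
  proof -
    have "cmod (S w) \<le> (\<Sum>n. cmod (e (Suc n) / fact n * w ^ n))"
      unfolding S_def by (rule summable_norm[OF S_abs])
    also have "\<dots> \<le> (\<Sum>n. C * ((r * cmod w) ^ n / fact n))"
      by (rule suminf_le[OF S_le S_abs sums_summable[OF sum_exp]])
    also have "\<dots> = C * exp (r * cmod w)" by (rule sums_unique[OF sum_exp, symmetric])
    finally show ?thesis .
  qed
  have S_cont: "isCont S w" for w
    unfolding S_def by (rule isCont_powser_converges_everywhere) (rule summable_norm_cancel[OF S_abs])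
  define v where "v = (\<lambda>t. if t < 0 then 0 else exp (- (\<mu> * of_real t)) * S (of_real t))"
  have "tame v"
    unfolding v_def
  proof (rule tame_on_half_line)
    show "continuous_on UNIV (\<lambda>t. exp (- (\<mu> * complex_of_real t)) * S (complex_of_real t))"
      by (auto intro!: continuous_intros continuous_at_imp_continuous_on isCont_o2[OF _ S_cont])
    show "r > 0" by (rule r)
    fix t :: real assume t: "t \<ge> 0"
    have "cmod (exp (- (\<mu> * of_real t)) * S (of_real t)) = exp (- (Re \<mu> * t)) * cmod (S (of_real t))"
      by (simp add: norm_mult)
    also have "\<dots> \<le> exp (- (Re \<mu> * t)) * (C * exp (r * t))"
      using S_bound[of "of_real t"] t by (intro mult_left_mono) auto
    also have "\<dots> = C * exp (- (r * \<bar>t\<bar>))"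
    proof -
      have "exp (- (Re \<mu> * t)) * exp (r * t) = exp (- (r * \<bar>t\<bar>))"
        using t by (simp add: r_def algebra_simps flip: exp_add)
      thus ?thesis by (simp add: mult.left_commute)
    qed
    finally show "cmod (exp (- (\<mu> * of_real t)) * S (of_real t)) \<le> C * exp (- (r * \<bar>t\<bar>))" .
  qed
  moreover have "\<forall>t<0. v t = 0" by (simp add: v_def)
  moreover have "laplace v p = E (1 / (p + \<mu>))" if p: "Re p \<ge> 0" for p
  proof -
    define z where "z = p + \<mu>"
    have z: "Re z \<ge> 2 * r" using p by (simp add: z_def r_def)
    hence z0: "Re z > 0" using r by linarith
    define f where "f = (\<lambda>n t. e (Suc n) * moment_kernel z n t)"
    have f_int: "integrable lebesgue (f n)" for n
      unfolding f_def using tame_integrable[OF moment_kernel_tame[OF z0]] by simp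
    have f_eq: "f n t = (if t < 0 then 0 else exp (- (z * of_real t)) * (e (Suc n) / fact n * of_real t ^ n))" for n t
      by (simp add: f_def moment_kernel_def)
    have norm_moment: "complex_of_real (cmod (moment_kernel z n t)) = moment_kernel (of_real (Re z)) n t" for n t
    proof (cases "t < 0")
      case False
      hence "complex_of_real (cmod (moment_kernel z n t)) = complex_of_real (t ^ n / fact n * exp (- (Re z * t)))"
        by (simp add: moment_kernel_def norm_mult norm_divide norm_power)
      also have "\<dots> = moment_kernel (of_real (Re z)) n t"
        using False by (simp add: moment_kernel_def exp_of_real[symmetric])
      finally show ?thesis .
    qed (simp add: moment_kernel_def)
    have norm_int: "(LINT t|lebesgue. cmod (moment_kernel z n t)) = 1 / Re z ^ Suc n" for n
    proof -
      have "complex_of_real (LINT t|lebesgue. cmod (moment_kernel z n t)) = (LINT t|lebesgue. moment_kernel (of_real (Re z)) n t)"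
        unfolding norm_moment[symmetric] by simp
      also have "\<dots> = 1 / (of_real (Re z)) ^ Suc n"
        using z0 by (intro moment_kernel_integral) simp
      also have "\<dots> = complex_of_real (1 / Re z ^ Suc n)" by simp
      finally show ?thesis by (simp only: of_real_eq_iff)
    qed
    have sums: "(\<lambda>n. integral\<^sup>L lebesgue (f n)) sums (LINT t|lebesgue. (\<Sum>n. f n t))"
    proof (rule sums_integral[OF f_int])
      show "AE t in lebesgue. summable (\<lambda>n. norm (f n t))"
      proof (rule AE_I2)
        fix t :: real
        have "summable (\<lambda>n. cmod (exp (- (z * of_real t))) * cmod (e (Suc n) / fact n * of_real t ^ n))"
          by (rule summable_mult[OF S_abs])
        thus "summable (\<lambda>n. norm (f n t))"
          by (cases "t < 0") (simp_all only: f_eq norm_mult[symmetric] if_True if_False norm_zero summable_zero)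
      qed
      show "summable (\<lambda>n. LINT t|lebesgue. norm (f n t))"
      proof (rule summable_comparison_test')
        show "summable (\<lambda>n. C / (2 * r) * (1 / 2) ^ n)"
          by (intro summable_mult summable_geometric) simp
        fix n :: nat
        have "norm (LINT t|lebesgue. norm (f n t)) = cmod (e (Suc n)) * (1 / Re z ^ Suc n)"
          using z0 by (simp add: f_def norm_mult norm_int)
        also have "\<dots> \<le> (C * r ^ n) * (1 / (2 * r) ^ Suc n)"
          using C[of n] z z0 r C0 by (intro mult_mono divide_left_mono power_mono mult_pos_pos) auto
        also have "\<dots> = C / (2 * r) * (1 / 2) ^ n"
          using r by (simp add: power_mult_distrib power_divide field_simps)
        finally show "norm (LINT t|lebesgue. norm (f n t)) \<le> C / (2 * r) * (1 / 2) ^ n" .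
      qed
    qed
    have "(\<Sum>n. f n t) = (if t < 0 then 0 else exp (- (p * of_real t)) * v t)" for t
    proof (cases "t < 0")
      case False
      have "(\<Sum>n. f n t) = exp (- (z * of_real t)) * S (of_real t)"
        unfolding S_def using False suminf_mult[OF summable_norm_cancel[OF S_abs], of "exp (- (z * of_real t))" "of_real t"]
        by (simp add: f_eq)
      also have "exp (- (z * of_real t)) = exp (- (p * of_real t)) * exp (- (\<mu> * of_real t))"
        by (simp add: z_def algebra_simps flip: exp_add)
      finally show ?thesis using False by (simp add: v_def mult.assoc)
    qed (simp add: f_eq)
    hence "laplace v p = (LINT t|lebesgue. (\<Sum>n. f n t))"
      by (simp add: laplace_eq_integral)
    with sums have "(\<lambda>n. integral\<^sup>L lebesgue (f n)) sums laplace v p" by simp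
    moreover have "integral\<^sup>L lebesgue (f n) = e (Suc n) * (1 / z) ^ Suc n" for n
      unfolding f_def by (simp add: moment_kernel_integral[OF z0] power_one_over)
    ultimately have "(\<lambda>n. e (Suc n) * (1 / z) ^ Suc n) sums laplace v p" by simp
    from sums_unique2[OF this E_sums'] show ?thesis by (simp add: z_def)
  qed
  ultimately show ?thesis by blast
qed

section \<open>Approximating rational symbols on a band\<close>

definition causal_predictor :: "(real \<Rightarrow> complex) \<Rightarrow> bool" where
  "causal_predictor v \<longleftrightarrow> tame v \<and> (\<forall>t<0. v t = 0) \<and> laplace v holomorphic_on {p. Re p > 0}"

text \<open>
The majorant \<open>C / (1 + \<bar>\<omega>\<bar>)\<close>, uniform in \<open>m\<close>, is bounded and lies in \<open>L\<^sub>s\<close> for all \<open>s > 1\<close>. This one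
condition therefore serves the limit theorems in all the norms considered. All conditions are linear in
\<open>K\<close>, so that partial fractions can be treated term by term.
\<close>

definition predictable_symbol :: "real set \<Rightarrow> (real \<Rightarrow> complex) \<Rightarrow> bool" where
  "predictable_symbol D K \<longleftrightarrow> (\<exists>k v C.
     tame k \<and> (\<forall>t>0. k t = 0) \<and> (\<forall>\<omega>. \<F> k \<omega> = K \<omega>) \<and>
     (\<forall>m::nat. causal_predictor (v m)) \<and>
     (\<forall>m. \<forall>\<omega>\<in>D. cmod (K \<omega> - \<F> (v m) \<omega>) \<le> C / (1 + \<bar>\<omega>\<bar>)) \<and>
     (\<forall>\<omega>\<in>D. (\<lambda>m. \<F> (v m) \<omega>) \<longlonglongrightarrow> K \<omega>))"

lemma fourier_integral_add:
  assumes "integrable lebesgue f" "integrable lebesgue g"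
  shows "\<F> (\<lambda>t. f t + g t) \<omega> = \<F> f \<omega> + \<F> g \<omega>"
  unfolding fourier_integral_def
  using integrable_fourier_kernel[OF assms(1), of \<omega>] integrable_fourier_kernel[OF assms(2), of \<omega>]
  by (simp add: distrib_left)

lemma fourier_integral_cmult:
  "\<F> (\<lambda>t. c * f t) \<omega> = c * \<F> f \<omega>"
  unfolding fourier_integral_def by (simp add: mult.left_commute)

lemma fourier_integral_diff:
  assumes "integrable lebesgue f" "integrable lebesgue g"
  shows "\<F> (\<lambda>t. f t - g t) \<omega> = \<F> f \<omega> - \<F> g \<omega>"
  using fourier_integral_add[of f "\<lambda>t. (-1) * g t" \<omega>] fourier_integral_cmult[of "-1" g \<omega>] assms by simp

lemma laplace_integrable:
  assumes "tame v" "Re p > 0"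
  shows "integrable lebesgue (\<lambda>t. if t < 0 then 0 else exp (- (p * of_real t)) * v t)"
proof -
  have [measurable]: "(\<lambda>t. if t < 0 then 0 else exp (- (p * complex_of_real t))) \<in> borel_measurable lebesgue"
    by measurable
  have "integrable lebesgue (\<lambda>t. (if t < 0 then 0 else exp (- (p * of_real t))) * v t)"
    by (rule integrable_modulate[OF tame_integrable[OF assms(1)], where B = 1]) (use assms(2) in auto)
  moreover have "(\<lambda>t. (if t < 0 then 0 else exp (- (p * of_real t))) * v t) = (\<lambda>t. if t < 0 then 0 else exp (- (p * of_real t)) * v t)"
    by auto
  ultimately show ?thesis by simp
qed

lemma laplace_add:
  assumes "tame v" "tame w" "Re p > 0"
  shows "laplace (\<lambda>t. v t + w t) p = laplace v p + laplace w p"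
proof -
  have "(\<lambda>t. if t < 0 then 0 else exp (- (p * of_real t)) * (v t + w t))
      = (\<lambda>t. (if t < 0 then 0 else exp (- (p * of_real t)) * v t) + (if t < 0 then 0 else exp (- (p * of_real t)) * w t))"
    by (auto simp: distrib_left)
  thus ?thesis
    unfolding laplace_eq_integral
    using laplace_integrable[OF assms(1,3)] laplace_integrable[OF assms(2,3)] by simp
qed

lemma laplace_cmult: "laplace (\<lambda>t. c * v t) p = c * laplace v p"
proof -
  have "(\<lambda>t. if t < 0 then 0 else exp (- (p * of_real t)) * (c * v t)) = (\<lambda>t. c * (if t < 0 then 0 else exp (- (p * of_real t)) * v t))"
    by auto
  thus ?thesis by (simp add: laplace_eq_integral)
qed

lemma laplace_cnj: "laplace (\<lambda>t. cnj (v t)) p = cnj (laplace v (cnj p))"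
proof -
  have "(\<lambda>t. if t < 0 then 0 else exp (- (p * of_real t)) * cnj (v t)) = (\<lambda>t. cnj (if t < 0 then 0 else exp (- (cnj p * of_real t)) * v t))"
    by (auto simp: exp_cnj)
  thus ?thesis by (simp only: laplace_eq_integral Bochner_Integration.integral_cnj)
qed

lemma causal_predictor_add:
  assumes "causal_predictor v" "causal_predictor w"
  shows "causal_predictor (\<lambda>t. v t + w t)"
proof -
  have "(\<lambda>p. laplace v p + laplace w p) holomorphic_on {p. Re p > 0}"
    using assms by (intro holomorphic_intros) (auto simp: causal_predictor_def)
  hence "laplace (\<lambda>t. v t + w t) holomorphic_on {p. Re p > 0}"
    by (rule holomorphic_transform) (use assms in \<open>auto simp: causal_predictor_def laplace_add\<close>)
  thus ?thesis using assms by (auto simp: causal_predictor_def tame_add)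
qed

lemma causal_predictor_cmult:
  assumes "causal_predictor v"
  shows "causal_predictor (\<lambda>t. c * v t)"
  unfolding causal_predictor_def laplace_cmult[abs_def]
  using assms by (auto simp: causal_predictor_def laplace_cmult tame_cmult intro!: holomorphic_intros)

lemma causal_predictor_cnj:
  assumes "causal_predictor v"
  shows "causal_predictor (\<lambda>t. cnj (v t))"
proof -
  have "cnj ` {p. Re p > 0} = {p. Re p > 0}"
    by (auto simp: image_iff intro!: exI[of _ "cnj _"])
  moreover have "open {p. Re p > 0}" by (rule open_halfspace_Re_gt)
  ultimately have "cnj \<circ> laplace v \<circ> cnj holomorphic_on {p. Re p > 0}"
    using assms by (intro holomorphic_on_compose_cnj_cnj) (auto simp: causal_predictor_def)
  moreover have "cnj \<circ> laplace v \<circ> cnj = laplace (\<lambda>t. cnj (v t))"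
    by (auto simp: laplace_cnj)
  ultimately show ?thesis
    using assms by (auto simp: causal_predictor_def tame_cnj)
qed

lemma predictable_symbol_zero: "predictable_symbol D (\<lambda>\<omega>. 0)"
proof -
  have t: "tame (\<lambda>t. 0)" using tame_cmult[OF tame_indicator, of 0] by simp
  have l: "laplace (\<lambda>t. 0) = (\<lambda>p. 0)" by (intro ext) (simp add: laplace_def set_lebesgue_integral_def)
  show ?thesis
    unfolding predictable_symbol_def
    by (rule exI[of _ "\<lambda>t. 0"], rule exI[of _ "\<lambda>m t. 0"], rule exI[of _ 0])
      (auto simp: t causal_predictor_def l fourier_integral_def)
qed

lemma predictable_symbol_cmult:
  assumes "predictable_symbol D K"
  shows "predictable_symbol D (\<lambda>\<omega>. c * K \<omega>)"
proof -
  from assms obtain k v C where k: "tame k" "\<forall>t>0. k t = 0" "\<forall>\<omega>. \<F> k \<omega> = K \<omega>"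
    and v: "\<forall>m::nat. causal_predictor (v m)"
    and C: "\<forall>m. \<forall>\<omega>\<in>D. cmod (K \<omega> - \<F> (v m) \<omega>) \<le> C / (1 + \<bar>\<omega>\<bar>)"
    and lim: "\<forall>\<omega>\<in>D. (\<lambda>m. \<F> (v m) \<omega>) \<longlonglongrightarrow> K \<omega>"
    unfolding predictable_symbol_def by (elim exE conjE)
  have "cmod (c * K \<omega> - c * \<F> (v m) \<omega>) \<le> (cmod c * C) / (1 + \<bar>\<omega>\<bar>)" if "\<omega> \<in> D" for m \<omega>
  proof -
    have "cmod (c * K \<omega> - c * \<F> (v m) \<omega>) = cmod c * cmod (K \<omega> - \<F> (v m) \<omega>)"
      by (simp add: norm_mult flip: right_diff_distrib)
    also have "\<dots> \<le> cmod c * (C / (1 + \<bar>\<omega>\<bar>))"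
      using C that by (intro mult_left_mono) auto
    finally show ?thesis by simp
  qed
  thus ?thesis
    unfolding predictable_symbol_def
    using k v lim
    by (intro exI[of _ "\<lambda>t. c * k t"] exI[of _ "\<lambda>m t. c * v m t"] exI[of _ "cmod c * C"])
      (auto simp: fourier_integral_cmult tame_cmult causal_predictor_cmult intro!: tendsto_mult_left)
qed

lemma predictable_symbol_add:
  assumes "predictable_symbol D K" "predictable_symbol D L"
  shows "predictable_symbol D (\<lambda>\<omega>. K \<omega> + L \<omega>)"
proof -
  from assms(1) obtain k v C where k: "tame k" "\<forall>t>0. k t = 0" "\<forall>\<omega>. \<F> k \<omega> = K \<omega>"
    and v: "\<forall>m::nat. causal_predictor (v m)"
    and C: "\<forall>m. \<forall>\<omega>\<in>D. cmod (K \<omega> - \<F> (v m) \<omega>) \<le> C / (1 + \<bar>\<omega>\<bar>)"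
    and lim: "\<forall>\<omega>\<in>D. (\<lambda>m. \<F> (v m) \<omega>) \<longlonglongrightarrow> K \<omega>"
    unfolding predictable_symbol_def by (elim exE conjE)
  from assms(2) obtain l w B where l: "tame l" "\<forall>t>0. l t = 0" "\<forall>\<omega>. \<F> l \<omega> = L \<omega>"
    and w: "\<forall>m::nat. causal_predictor (w m)"
    and B: "\<forall>m. \<forall>\<omega>\<in>D. cmod (L \<omega> - \<F> (w m) \<omega>) \<le> B / (1 + \<bar>\<omega>\<bar>)"
    and lim': "\<forall>\<omega>\<in>D. (\<lambda>m. \<F> (w m) \<omega>) \<longlonglongrightarrow> L \<omega>"
    unfolding predictable_symbol_def by (elim exE conjE)
  have F: "\<F> (\<lambda>t. v m t + w m t) \<omega> = \<F> (v m) \<omega> + \<F> (w m) \<omega>" for m \<omega>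
    using v w by (intro fourier_integral_add tame_integrable) (auto simp: causal_predictor_def)
  have F': "\<F> (\<lambda>t. k t + l t) \<omega> = K \<omega> + L \<omega>" for \<omega>
    using k l fourier_integral_add[OF tame_integrable tame_integrable, of k l] by simp
  have "cmod (K \<omega> + L \<omega> - (\<F> (v m) \<omega> + \<F> (w m) \<omega>)) \<le> (C + B) / (1 + \<bar>\<omega>\<bar>)" if "\<omega> \<in> D" for m \<omega>
  proof -
    have "cmod (K \<omega> + L \<omega> - (\<F> (v m) \<omega> + \<F> (w m) \<omega>))
        \<le> cmod (K \<omega> - \<F> (v m) \<omega>) + cmod (L \<omega> - \<F> (w m) \<omega>)"
      by (rule norm_diff_triangle_ineq)
    also have "\<dots> \<le> C / (1 + \<bar>\<omega>\<bar>) + B / (1 + \<bar>\<omega>\<bar>)"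
      using C B that by (intro add_mono) auto
    finally show ?thesis by (simp add: add_divide_distrib)
  qed
  thus ?thesis
    unfolding predictable_symbol_def
    using k l v w lim lim'
    by (intro exI[of _ "\<lambda>t. k t + l t"] exI[of _ "\<lambda>m t. v m t + w m t"] exI[of _ "C + B"])
      (auto simp: F F' tame_add causal_predictor_add intro!: tendsto_add)
qed

lemma one_plus_abs_le:
  assumes "Re \<alpha> > 0"
  shows "1 + \<bar>\<omega>\<bar> \<le> ((1 + \<bar>Im \<alpha>\<bar>) / Re \<alpha> + 1) * cmod (\<i> * of_real \<omega> - \<alpha>)"
proof -
  have "Re \<alpha> \<le> cmod (\<i> * of_real \<omega> - \<alpha>)"
    using abs_Re_le_cmod[of "\<i> * of_real \<omega> - \<alpha>"] assms by simp
  from mult_left_mono[OF this, of "(1 + \<bar>Im \<alpha>\<bar>) / Re \<alpha>"]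
  have "1 + \<bar>Im \<alpha>\<bar> \<le> (1 + \<bar>Im \<alpha>\<bar>) / Re \<alpha> * cmod (\<i> * of_real \<omega> - \<alpha>)"
    using assms by simp
  moreover have "\<bar>\<omega>\<bar> - \<bar>Im \<alpha>\<bar> \<le> cmod (\<i> * of_real \<omega> - \<alpha>)"
    using abs_Im_le_cmod[of "\<i> * of_real \<omega> - \<alpha>"] by simp
  ultimately show ?thesis by (simp add: distrib_right)
qed

lemma pole_distance_pos:
  assumes "Re \<alpha> > 0" shows "Re \<alpha> \<le> cmod (\<i> * of_real \<omega> - \<alpha>)" "\<i> * of_real \<omega> - \<alpha> \<noteq> 0"
  using abs_Re_le_cmod[of "\<i> * of_real \<omega> - \<alpha>"] assms by (auto simp: complex_eq_iff)

text \<open>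
The numerator is \<open>Re ((\<i>\<omega> - \<alpha>) cnj (\<i>\<omega> + \<mu>)) = - Re \<alpha> Re \<mu> + (\<omega> - Im \<alpha>) (\<omega> + Im \<mu>)\<close>, a quadratic polynomial
in \<open>\<omega>\<close>. Requiring its roots to be \<open>\<plusminus>\<Omega>\<close> determines \<open>\<mu>\<close>.
\<close>

lemma Re_exponent_on_axis:
  assumes "Re \<alpha> > 0" and \<mu>: "\<mu> = Complex ((\<Omega>\<^sup>2 - (Im \<alpha>)\<^sup>2) / Re \<alpha>) (Im \<alpha>)"
  shows "Re ((\<i> * of_real \<omega> - \<alpha>) / (\<i> * of_real \<omega> + \<mu>)) = (\<omega>\<^sup>2 - \<Omega>\<^sup>2) / (cmod (\<i> * of_real \<omega> + \<mu>))\<^sup>2"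
proof -
  have "Re \<alpha> * Re \<mu> = \<Omega>\<^sup>2 - (Im \<alpha>)\<^sup>2" "Im \<mu> = Im \<alpha>"
    using assms by simp_all
  hence "Re ((\<i> * of_real \<omega> - \<alpha>) * cnj (\<i> * of_real \<omega> + \<mu>)) = \<omega>\<^sup>2 - \<Omega>\<^sup>2"
    by (simp add: algebra_simps power2_eq_square)
  thus ?thesis
    by (subst complex_div_cnj) (simp add: Re_divide_of_real del: cnj.simps complex_cnj_add complex_cnj_mult)
qed

text \<open>
The sign \<open>\<sigma>\<close> is 1 for the low band and -1 for the high band, so that \<open>exp (\<sigma> m W)\<close> is small on the band.
\<close>

lemma predictable_symbol_pole:
  assumes \<alpha>: "Re \<alpha> > 0" "\<bar>Im \<alpha>\<bar> < \<Omega>" and l: "l \<ge> 1"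
    and \<sigma>: "\<And>\<omega>. \<omega> \<in> D \<Longrightarrow> \<sigma> * (\<omega>\<^sup>2 - \<Omega>\<^sup>2) < 0"
  shows "predictable_symbol D (\<lambda>\<omega>. 1 / (\<i> * of_real \<omega> - \<alpha>) ^ l)"
proof -
  have "(\<lambda>u. (- u) ^ l) holomorphic_on (UNIV :: complex set)" by (intro holomorphic_intros)
  from entire_function_laplace_kernel[OF this _ \<alpha>(1)] l
  obtain k' where k': "tame k'" "\<forall>t<0. k' t = 0" "\<forall>p. Re p \<ge> 0 \<longrightarrow> laplace k' p = (- (1 / (p + \<alpha>))) ^ l"
    by auto
  define k where "k = (\<lambda>t. k' (- t))"
  have k: "tame k" "\<forall>t>0. k t = 0" using k' by (auto simp: k_def tame_reflect)
  \<comment> \<open>The anticausal kernel is the reflection of the causal kernel with entire symbol \<open>(- u)\<^sup>l\<close> and \<open>\<mu> = \<alpha>\<close>.\<close>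
  have Fk: "\<F> k \<omega> = 1 / (\<i> * of_real \<omega> - \<alpha>) ^ l" for \<omega>
  proof -
    have "\<F> k \<omega> = \<F> k' (- \<omega>)"
      unfolding fourier_integral_def k_def
      by (subst lebesgue_integral_real_affine[of "-1" _ 0]) simp_all
    also have "\<dots> = laplace k' (Complex 0 (- \<omega>))"
      using laplace_eq_fourier[of k' 0 "- \<omega>"] k'(2) by simp
    also have "\<dots> = (- (1 / (Complex 0 (- \<omega>) + \<alpha>))) ^ l"
      using k'(3) by simp
    also have "- (1 / (Complex 0 (- \<omega>) + \<alpha>)) = 1 / (\<i> * of_real \<omega> - \<alpha>)"
      by (simp add: Complex_eq flip: divide_minus_right)
    finally show ?thesis by (simp add: power_one_over)
  qed
  define \<mu> where "\<mu> = Complex ((\<Omega>\<^sup>2 - (Im \<alpha>)\<^sup>2) / Re \<alpha>) (Im \<alpha>)"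
  have \<mu>: "Re \<mu> > 0"
  proof -
    have "(Im \<alpha>)\<^sup>2 < \<Omega>\<^sup>2" using power_strict_mono[OF \<alpha>(2), of 2] by simp
    thus ?thesis using \<alpha>(1) by (simp add: \<mu>_def)
  qed
  \<comment> \<open>With \<open>u = 1 / (p + \<mu>)\<close> the exponent is \<open>W = 1 - c u\<close>, and \<open>1 / (p - \<alpha>) = u / W\<close>.\<close>
  define c where "c = \<alpha> + \<mu>"
  define \<gamma> where "\<gamma> = (\<lambda>m::nat. complex_of_real (\<sigma> * real m))"
  \<comment> \<open>The entire function \<open>(1 - exp (\<gamma> z)) / z\<close>, written as a difference quotient to apply the removable singularity theorem.\<close>
  define S where "S = (\<lambda>m z. if z = 0 then deriv (\<lambda>w. - exp (\<gamma> m * w)) 0 else (- exp (\<gamma> m * z) - (- exp (\<gamma> m * 0))) / (z - 0))"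
  have S_hol: "S m holomorphic_on UNIV" for m
    unfolding S_def by (rule pole_lemma) (auto intro!: holomorphic_intros)
  define E where "E = (\<lambda>m u. (u * S m (1 - c * u)) ^ l)"
  have E_hol: "E m holomorphic_on UNIV" for m
  proof -
    have "S m \<circ> (\<lambda>u. 1 - c * u) holomorphic_on UNIV"
      by (intro holomorphic_on_compose_gen[OF _ S_hol] holomorphic_intros) auto
    thus ?thesis unfolding E_def by (intro holomorphic_intros) (simp add: o_def)
  qed
  have E0: "E m 0 = 0" for m using l by (simp add: E_def)
  have "\<forall>m. \<exists>v. tame v \<and> (\<forall>t<0. v t = 0) \<and> (\<forall>p. Re p \<ge> 0 \<longrightarrow> laplace v p = E m (1 / (p + \<mu>)))"
    using entire_function_laplace_kernel[OF E_hol E0 \<mu>] by blast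
  then obtain v where v: "\<And>m. tame (v m)" "\<And>m t. t < 0 \<Longrightarrow> v m t = 0"
      "\<And>m p. Re p \<ge> 0 \<Longrightarrow> laplace (v m) p = E m (1 / (p + \<mu>))"
    by metis
  have "causal_predictor (v m)" for m
  proof -
    have "p + \<mu> \<noteq> 0" if "Re p > 0" for p using that \<mu> by (auto simp: complex_eq_iff)
    hence "E m \<circ> (\<lambda>p. 1 / (p + \<mu>)) holomorphic_on {p. Re p > 0}"
      by (intro holomorphic_on_compose_gen[OF _ E_hol] holomorphic_intros) auto
    hence "laplace (v m) holomorphic_on {p. Re p > 0}"
      by (rule holomorphic_transform) (simp add: v(3))
    with v show ?thesis by (simp add: causal_predictor_def)
  qed
  moreover define q where "q = (\<lambda>m \<omega>. exp (\<gamma> m * ((\<i> * of_real \<omega> - \<alpha>) / (\<i> * of_real \<omega> + \<mu>))))"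
  have Fv: "\<F> (v m) \<omega> = ((1 - q m \<omega>) / (\<i> * of_real \<omega> - \<alpha>)) ^ l" for m \<omega>
  proof -
    define p where "p = \<i> * complex_of_real \<omega>"
    have p: "p + \<mu> \<noteq> 0" "p - \<alpha> \<noteq> 0" using \<mu> \<alpha> by (auto simp: complex_eq_iff p_def)
    have "\<F> (v m) \<omega> = laplace (v m) (Complex 0 \<omega>)"
      using laplace_eq_fourier[of "v m" 0 \<omega>] v(2) by simp
    also have "\<dots> = E m (1 / (p + \<mu>))"
      by (subst v(3)) (simp_all add: Complex_eq p_def)
    also have "1 / (p + \<mu>) * S m (1 - c * (1 / (p + \<mu>))) = (1 - q m \<omega>) / (p - \<alpha>)"
    proof -
      have "1 - c * (1 / (p + \<mu>)) = (p - \<alpha>) / (p + \<mu>)"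
        using p by (simp add: c_def field_simps)
      moreover have "(p - \<alpha>) / (p + \<mu>) \<noteq> 0" using p by simp
      ultimately show ?thesis using p by (simp add: S_def q_def p_def)
    qed
    hence "E m (1 / (p + \<mu>)) = ((1 - q m \<omega>) / (p - \<alpha>)) ^ l"
      by (simp add: E_def)
    finally show ?thesis by (simp add: p_def)
  qed
  have q_norm: "cmod (q m \<omega>) = exp (\<sigma> * (\<omega>\<^sup>2 - \<Omega>\<^sup>2) / (cmod (\<i> * of_real \<omega> + \<mu>))\<^sup>2 * real m)" for m \<omega>
  proof -
    have "cmod (q m \<omega>) = exp (\<sigma> * real m * Re ((\<i> * of_real \<omega> - \<alpha>) / (\<i> * of_real \<omega> + \<mu>)))"
      unfolding q_def \<gamma>_def norm_exp_eq_Re by (simp only: Re_complex_of_real times_complex.sel Im_complex_of_real mult_zero_left diff_0_right)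
    also have "Re ((\<i> * of_real \<omega> - \<alpha>) / (\<i> * of_real \<omega> + \<mu>)) = (\<omega>\<^sup>2 - \<Omega>\<^sup>2) / (cmod (\<i> * of_real \<omega> + \<mu>))\<^sup>2"
      by (rule Re_exponent_on_axis[OF \<alpha>(1) \<mu>_def])
    finally show ?thesis by (simp add: mult_ac)
  qed
  have exponent_neg: "\<sigma> * (\<omega>\<^sup>2 - \<Omega>\<^sup>2) / (cmod (\<i> * of_real \<omega> + \<mu>))\<^sup>2 < 0" if "\<omega> \<in> D" for \<omega>
  proof -
    have "\<i> * of_real \<omega> + \<mu> \<noteq> 0" using \<mu> by (auto simp: complex_eq_iff)
    thus ?thesis using \<sigma>[OF that] by (intro divide_neg_pos) auto
  qed
  have q_le: "cmod (q m \<omega>) \<le> 1" if "\<omega> \<in> D" for m \<omega>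
    unfolding q_norm exp_le_one_iff using exponent_neg[OF that] by (intro mult_nonpos_nonneg) auto
  have q_lim: "(\<lambda>m. q m \<omega>) \<longlonglongrightarrow> 0" if "\<omega> \<in> D" for \<omega>
  proof -
    have "filterlim (\<lambda>m. \<sigma> * (\<omega>\<^sup>2 - \<Omega>\<^sup>2) / (cmod (\<i> * of_real \<omega> + \<mu>))\<^sup>2 * real m) at_bot sequentially"
      using exponent_neg[OF that] by (intro filterlim_tendsto_neg_mult_at_bot[OF tendsto_const _ filterlim_real_sequentially])
    hence "(\<lambda>m. cmod (q m \<omega>)) \<longlonglongrightarrow> 0"
      unfolding q_norm by (rule filterlim_compose[OF exp_at_bot])
    thus ?thesis by (simp add: tendsto_norm_zero_iff)
  qed
  define A where "A = (1 + \<bar>Im \<alpha>\<bar>) / Re \<alpha> + 1"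
  define C where "C = (1 + 2 ^ l) * (1 / Re \<alpha>) ^ (l - 1) * A"
  have "cmod (1 / (\<i> * of_real \<omega> - \<alpha>) ^ l - \<F> (v m) \<omega>) \<le> C / (1 + \<bar>\<omega>\<bar>)" if "\<omega> \<in> D" for m \<omega>
  proof -
    define \<rho> where "\<rho> = cmod (\<i> * of_real \<omega> - \<alpha>)"
    have \<rho>: "Re \<alpha> \<le> \<rho>" "\<rho> > 0" "1 + \<bar>\<omega>\<bar> \<le> A * \<rho>"
      using pole_distance_pos[OF \<alpha>(1), of \<omega>] \<alpha>(1) one_plus_abs_le[OF \<alpha>(1), of \<omega>] by (auto simp: \<rho>_def A_def)
    have "cmod (1 - q m \<omega>) \<le> 2"
      using norm_triangle_ineq4[of 1 "q m \<omega>"] q_le[OF that, of m] by simp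
    hence "cmod (1 - (1 - q m \<omega>) ^ l) \<le> 1 + 2 ^ l"
      using norm_triangle_ineq4[of 1 "(1 - q m \<omega>) ^ l"] power_mono[of "cmod (1 - q m \<omega>)" 2 l]
      by (simp add: norm_power)
    moreover have "(1 / \<rho>) ^ l \<le> (1 / Re \<alpha>) ^ (l - 1) * (A / (1 + \<bar>\<omega>\<bar>))"
    proof -
      have "(1 / \<rho>) ^ l = (1 / \<rho>) ^ (l - 1) * (1 / \<rho>)"
        using l by (metis power_minus_mult less_le_trans zero_less_one)
      also have "\<dots> \<le> (1 / Re \<alpha>) ^ (l - 1) * (A / (1 + \<bar>\<omega>\<bar>))"
        using \<rho> \<alpha>(1) by (intro mult_mono power_mono) (auto simp: field_simps)
      finally show ?thesis .
    qed
    ultimately have "cmod (1 - (1 - q m \<omega>) ^ l) * (1 / \<rho>) ^ l \<le> (1 + 2 ^ l) * ((1 / Re \<alpha>) ^ (l - 1) * (A / (1 + \<bar>\<omega>\<bar>)))"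
      using \<rho> by (intro mult_mono) auto
    moreover have "1 / (\<i> * of_real \<omega> - \<alpha>) ^ l - \<F> (v m) \<omega> = (1 - (1 - q m \<omega>) ^ l) / (\<i> * of_real \<omega> - \<alpha>) ^ l"
      unfolding Fv power_divide by (simp add: diff_divide_distrib)
    ultimately show ?thesis
      by (simp add: norm_divide norm_power \<rho>_def[symmetric] C_def power_divide mult_ac)
  qed
  moreover have "(\<lambda>m. \<F> (v m) \<omega>) \<longlonglongrightarrow> 1 / (\<i> * of_real \<omega> - \<alpha>) ^ l" if "\<omega> \<in> D" for \<omega>
  proof -
    have "(\<lambda>m. ((1 - q m \<omega>) / (\<i> * of_real \<omega> - \<alpha>)) ^ l) \<longlonglongrightarrow> ((1 - 0) / (\<i> * of_real \<omega> - \<alpha>)) ^ l"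
      using pole_distance_pos(2)[OF \<alpha>(1), of \<omega>] by (intro tendsto_intros q_lim that) auto
    thus ?thesis by (simp add: Fv power_divide)
  qed
  ultimately show ?thesis
    unfolding predictable_symbol_def using k Fk
    by (intro exI[of _ k] exI[of _ v] exI[of _ C]) auto
qed

text \<open>
Partial fractions by induction on the degree of the denominator: write \<open>\<delta> = (p - \<alpha>)\<^sup>l \<rho>\<close> with
\<open>\<rho>(\<alpha>) \<noteq> 0\<close> and choose \<open>c\<close> with \<open>d - c \<rho>\<close> divisible by \<open>p - \<alpha>\<close>. Then \<open>d / \<delta>\<close> is \<open>c / (p - \<alpha>)\<^sup>l\<close> plus a proper
fraction whose denominator has smaller degree. The case \<open>d = 0\<close> is allowed separately because the
denominator may become constant.
\<close>

theorem predictable_symbol_rational: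
  fixes d \<delta> :: "complex poly"
  assumes roots: "\<And>p. poly \<delta> p = 0 \<Longrightarrow> Re p > 0 \<and> \<bar>Im p\<bar> < \<Omega>"
    and deg: "d = 0 \<or> degree d < degree \<delta>"
    and \<sigma>: "\<And>\<omega>. \<omega> \<in> D \<Longrightarrow> \<sigma> * (\<omega>\<^sup>2 - \<Omega>\<^sup>2) < 0"
  shows "predictable_symbol D (\<lambda>\<omega>. poly d (\<i> * of_real \<omega>) / poly \<delta> (\<i> * of_real \<omega>))"
  using roots deg
proof (induction "degree \<delta>" arbitrary: d \<delta> rule: less_induct)
  case less
  show ?case
  proof (cases "d = 0")
    case True
    thus ?thesis using predictable_symbol_zero by simp
  next
    case False
    with less.prems have deg: "degree d < degree \<delta>" by auto
    hence "\<delta> \<noteq> 0" by auto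
    from deg have "\<not> constant (poly \<delta>)" by (simp add: constant_degree)
    then obtain \<alpha> where root: "poly \<delta> \<alpha> = 0" using Fundamental_Theorem_Algebra.fundamental_theorem_of_algebra by blast
    from less.prems(1)[OF this] have \<alpha>: "Re \<alpha> > 0" "\<bar>Im \<alpha>\<bar> < \<Omega>" by auto
    define l where "l = order \<alpha> \<delta>"
    obtain \<rho> where \<rho>: "\<delta> = [:- \<alpha>, 1:] ^ l * \<rho>" "\<not> [:- \<alpha>, 1:] dvd \<rho>"
      using order_decomp[OF \<open>\<delta> \<noteq> 0\<close>] unfolding l_def by blast
    have l: "l \<ge> 1" using root \<open>\<delta> \<noteq> 0\<close> by (simp add: l_def order_root Suc_le_eq)
    have \<rho>0: "poly \<rho> \<alpha> \<noteq> 0" using \<rho>(2) by (simp add: poly_eq_0_iff_dvd)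
    hence "\<rho> \<noteq> 0" by auto
    define c where "c = poly d \<alpha> / poly \<rho> \<alpha>"
    have "poly (d - smult c \<rho>) \<alpha> = 0" using \<rho>0 by (simp add: c_def)
    then obtain d' where d': "d - smult c \<rho> = [:- \<alpha>, 1:] * d'"
      unfolding poly_eq_0_iff_dvd by (elim dvdE)
    define \<delta>' where "\<delta>' = [:- \<alpha>, 1:] ^ (l - 1) * \<rho>"
    have \<delta>: "\<delta> = [:- \<alpha>, 1:] * \<delta>'"
      using \<rho>(1) l unfolding \<delta>'_def mult.assoc[symmetric] by (metis power_minus_mult mult.commute less_le_trans zero_less_one)
    have "\<delta>' \<noteq> 0" using \<open>\<delta> \<noteq> 0\<close> \<delta> by auto
    hence deg_\<delta>: "degree \<delta> = Suc (degree \<delta>')"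
      by (subst \<delta>, subst degree_mult_eq) auto
    have deg_\<rho>: "degree \<rho> < degree \<delta>"
      using \<open>\<rho> \<noteq> 0\<close> l unfolding \<rho>(1) by (subst degree_mult_eq) (auto simp: degree_power_eq)
    have "d' = 0 \<or> degree d' < degree \<delta>'"
    proof (cases "d' = 0")
      case False
      have "Suc (degree d') = degree (d - smult c \<rho>)"
        unfolding d' using False by (subst degree_mult_eq) auto
      also have "\<dots> < degree \<delta>"
        using degree_diff_le_max[of d "smult c \<rho>"] deg deg_\<rho> degree_smult_le[of c \<rho>] by linarith
      finally show ?thesis by (simp add: deg_\<delta>)
    qed auto
    moreover have "Re p > 0 \<and> \<bar>Im p\<bar> < \<Omega>" if "poly \<delta>' p = 0" for p
      using that less.prems(1)[of p] by (simp add: \<delta>)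
    ultimately have IH: "predictable_symbol D (\<lambda>\<omega>. poly d' (\<i> * of_real \<omega>) / poly \<delta>' (\<i> * of_real \<omega>))"
      using less.hyps[of \<delta>' d'] deg_\<delta> by simp
    have "predictable_symbol D (\<lambda>\<omega>. c * (1 / (\<i> * of_real \<omega> - \<alpha>) ^ l) + poly d' (\<i> * of_real \<omega>) / poly \<delta>' (\<i> * of_real \<omega>))"
      by (intro predictable_symbol_add[OF predictable_symbol_cmult IH] predictable_symbol_pole[OF \<alpha> l \<sigma>])
    moreover have "c * (1 / (\<i> * of_real \<omega> - \<alpha>) ^ l) + poly d' (\<i> * of_real \<omega>) / poly \<delta>' (\<i> * of_real \<omega>)
        = poly d (\<i> * of_real \<omega>) / poly \<delta> (\<i> * of_real \<omega>)" for \<omega>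
    proof -
      define p where "p = \<i> * complex_of_real \<omega>"
      have p: "p - \<alpha> \<noteq> 0" using pole_distance_pos(2)[OF \<alpha>(1)] by (simp add: p_def)
      have "poly \<delta> p \<noteq> 0" using less.prems(1)[of p] by (auto simp: p_def)
      hence \<rho>p: "poly \<rho> p \<noteq> 0" by (auto simp: \<rho>(1))
      have dp: "poly d p = c * poly \<rho> p + (p - \<alpha>) * poly d' p"
        using arg_cong[OF d', of "\<lambda>q. poly q p"] by (simp add: algebra_simps)
      have \<delta>'p: "poly \<delta>' p = (p - \<alpha>) ^ (l - 1) * poly \<rho> p"
        by (simp add: \<delta>'_def poly_power)
      have \<delta>p: "poly \<delta> p = (p - \<alpha>) ^ l * poly \<rho> p"
        by (simp add: \<rho>(1) poly_power)
      have pl: "(p - \<alpha>) ^ l = (p - \<alpha>) * (p - \<alpha>) ^ (l - 1)"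
        using l by (metis power_minus_mult mult.commute less_le_trans zero_less_one)
      have "poly d p / poly \<delta> p = c * poly \<rho> p / ((p - \<alpha>) ^ l * poly \<rho> p) + (p - \<alpha>) * poly d' p / ((p - \<alpha>) ^ l * poly \<rho> p)"
        unfolding dp \<delta>p by (rule add_divide_distrib)
      also have "c * poly \<rho> p / ((p - \<alpha>) ^ l * poly \<rho> p) = c * (1 / (p - \<alpha>) ^ l)"
        using \<rho>p by simp
      also have "(p - \<alpha>) * poly d' p / ((p - \<alpha>) ^ l * poly \<rho> p) = poly d' p / poly \<delta>' p"
        unfolding pl \<delta>'p using p by (simp add: mult.assoc)
      finally show ?thesis by (simp add: p_def)
    qed
    ultimately show ?thesis by simp
  qed
qed

section \<open>Prediction errors of real kernels\<close>

lemma ennreal_square_le_imp_le: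
  fixes x y :: ennreal
  assumes "x\<^sup>2 \<le> y\<^sup>2"
  shows "x \<le> y"
proof (cases y)
  case (real b)
  show ?thesis
  proof (cases x)
    case (real a)
    with assms \<open>y = ennreal b\<close> \<open>0 \<le> b\<close> have "a\<^sup>2 \<le> b\<^sup>2"
      by (simp add: ennreal_power ennreal_le_iff)
    hence "a \<le> b" using \<open>0 \<le> b\<close> by (rule power2_le_imp_le)
    thus ?thesis using real \<open>y = ennreal b\<close> by (simp add: ennreal_leI)
  next
    case top
    with assms real show ?thesis by (simp add: power2_eq_square top_unique flip: ennreal_mult)
  qed
qed simp

lemma Lnorm_2_le:
  assumes "f \<in> borel_measurable lebesgue" "energy f \<le> Y\<^sup>2"
  shows "Lnorm 2 f \<le> Y"
  by (rule ennreal_square_le_imp_le) (simp only: Lnorm_2_square[OF assms(1)] assms(2))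

lemma Lnorm_infinity:
  assumes "f \<in> borel_measurable lebesgue"
  shows "Lnorm \<infinity> f = esssup lebesgue (\<lambda>t. ennreal (cmod (f t)))"
  using assms by (simp add: Lnorm_def)

lemma Lnorm_infinity_le:
  assumes [measurable]: "f \<in> borel_measurable lebesgue" and "\<And>t. ennreal (cmod (f t)) \<le> B"
  shows "Lnorm \<infinity> f \<le> B"
  unfolding Lnorm_infinity[OF assms(1)] using assms(2) by (intro esssup_I) simp_all

lemma Lnorm_cong_AE:
  assumes [measurable]: "f \<in> borel_measurable lebesgue" "g \<in> borel_measurable lebesgue"
    and eq: "AE t in lebesgue. f t = g t"
  shows "Lnorm r f = Lnorm r g"
proof -
  have "esssup lebesgue (\<lambda>t. ennreal (cmod (f t))) = esssup lebesgue (\<lambda>t. ennreal (cmod (g t)))"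
    using eq by (intro esssup_AE_cong) (auto elim!: eventually_mono)
  moreover have "(\<integral>\<^sup>+ t. ennreal (cmod (f t) powr enn2real r) \<partial>lebesgue) = (\<integral>\<^sup>+ t. ennreal (cmod (g t) powr enn2real r) \<partial>lebesgue)"
    using eq by (intro nn_integral_cong_AE) (auto elim!: eventually_mono)
  ultimately show ?thesis by (simp add: Lnorm_def)
qed

text \<open>
On the line \<open>Re p = s\<close> the Laplace transform is the Fourier integral of a function dominated by the kernel, so
the energy inequality bounds the \<open>H\<^sup>2\<close> norm and the integral of the kernel bounds the \<open>H\<^sup>\<infinity>\<close> norm.
\<close>

lemma causal_predictor_imp_causal_kernel:
  assumes "causal_predictor (\<lambda>t. complex_of_real (k t))"
  shows "k \<in> causal_kernels"
proof -
  define v where "v = (\<lambda>t. complex_of_real (k t))"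
  have v: "tame v" "\<And>t. t < 0 \<Longrightarrow> v t = 0" "laplace v holomorphic_on {p. Re p > 0}"
    using assms by (auto simp: causal_predictor_def v_def)
  note [measurable] = tame_measurable_lebesgue[OF v(1)]
  define u where "u = (\<lambda>s t. exp (- complex_of_real (s * t)) * v t)"
  have u_le: "cmod (u s t) \<le> cmod (v t)" if "s > 0" for s t
    using that v(2)[of t] by (cases "t < 0") (simp_all add: u_def norm_mult mult_left_le_one_le)
  have [measurable]: "u s \<in> borel_measurable lebesgue" for s unfolding u_def by measurable
  have u_int: "integrable lebesgue (u s)" if "s > 0" for s
    by (rule Bochner_Integration.integrable_bound[OF tame_integrable[OF v(1)]]) (use u_le[OF that] in auto)
  have laplace: "(\<lambda>\<omega>. laplace v (Complex s \<omega>)) = \<F> (u s)" for s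
    unfolding u_def using laplace_eq_fourier[of v, OF v(2)] by auto
  have "v \<in> Lspace 2"
    unfolding Lspace_2_iff using tame_energy[OF v(1)] by simp
  moreover have "laplace v \<in> hardy 2"
  proof -
    define B where "B = ennreal (2 * pi) * energy v"
    have "B < \<infinity>" using tame_energy[OF v(1)] by (simp add: B_def ennreal_mult_less_top)
    have "Lnorm 2 (\<lambda>\<omega>. laplace v (Complex s \<omega>)) \<le> B + 1" if "s > 0" for s
    proof (rule Lnorm_2_le)
      have "energy (\<F> (u s)) \<le> ennreal (2 * pi) * energy (u s)"
        by (rule fourier_energy_le[OF u_int[OF that]])
      also have "energy (u s) \<le> energy v"
        unfolding energy_def using u_le[OF that] by (intro nn_integral_mono power_mono ennreal_leI) auto
      \<comment> \<open>The bound \<open>B + 1\<close> avoids a square root: \<open>B \<le> (B + 1)\<^sup>2\<close>.\<close>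
      finally have "energy (\<F> (u s)) \<le> B" by (simp add: B_def mult_left_mono)
      also have "B \<le> (B + 1)\<^sup>2"
      proof -
        have "B * 1 \<le> (B + 1) * (B + 1)" by (intro mult_mono) auto
        thus ?thesis by (simp add: power2_eq_square)
      qed
      finally show "energy (\<lambda>\<omega>. laplace v (Complex s \<omega>)) \<le> (B + 1)\<^sup>2" by (simp add: laplace)
    qed (simp add: laplace)
    hence "(SUP s\<in>{0<..}. Lnorm 2 (\<lambda>\<omega>. laplace v (Complex s \<omega>))) \<le> B + 1"
      by (intro SUP_least) auto
    also have "\<dots> < \<infinity>" using \<open>B < \<infinity>\<close> by simp
    finally show ?thesis using v(3) by (simp add: hardy_def)
  qed
  moreover have "laplace v \<in> hardy \<infinity>"
  proof -
    have "Lnorm \<infinity> (\<lambda>\<omega>. laplace v (Complex s \<omega>)) \<le> ennreal (LINT t|lebesgue. cmod (v t))" if "s > 0" for s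
    proof (rule Lnorm_infinity_le)
      fix \<omega>
      have "cmod (\<F> (u s) \<omega>) \<le> (LINT t|lebesgue. cmod (u s t))"
        by (rule fourier_integral_bound[OF u_int[OF that]])
      also have "\<dots> \<le> (LINT t|lebesgue. cmod (v t))"
        using u_int[OF that] tame_integrable[OF v(1)] u_le[OF that] by (intro integral_mono) auto
      finally show "ennreal (cmod (laplace v (Complex s \<omega>))) \<le> ennreal (LINT t|lebesgue. cmod (v t))"
        using fun_cong[OF laplace, of s \<omega>] by (simp add: ennreal_leI)
    qed (simp add: laplace)
    hence "(SUP s\<in>{0<..}. Lnorm \<infinity> (\<lambda>\<omega>. laplace v (Complex s \<omega>))) \<le> ennreal (LINT t|lebesgue. cmod (v t))"
      by (intro SUP_least) auto
    also have "\<dots> < \<infinity>" by simp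
    finally show ?thesis using v(3) by (simp add: hardy_def)
  qed
  moreover have "\<forall>t<0. k t = 0" using v(2) by (auto simp: v_def)
  ultimately show ?thesis by (simp add: causal_kernels_def v_def)
qed

lemma fourier_integral_cnj: "\<F> (\<lambda>t. cnj (f t)) \<omega> = cnj (\<F> f (- \<omega>))"
proof -
  have "(\<lambda>t. exp (- (\<i> * of_real \<omega> * of_real t)) * cnj (f t)) = (\<lambda>t. cnj (exp (- (\<i> * of_real (- \<omega>) * of_real t)) * f t))"
    by (simp add: exp_cnj)
  thus ?thesis by (simp only: fourier_integral_def Bochner_Integration.integral_cnj)
qed

lemma AE_eq_reflect_shift:
  fixes f g :: "real \<Rightarrow> complex"
  assumes [measurable]: "f \<in> borel_measurable lebesgue" "g \<in> borel_measurable lebesgue"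
    and "AE t in lebesgue. f t = g t"
  shows "AE s in lebesgue. f (t - s) = g (t - s)"
proof -
  have "energy (\<lambda>t. f t - g t) = 0"
    unfolding energy_def using assms(3) by (subst nn_integral_0_iff_AE) (auto elim!: eventually_mono)
  hence "energy (\<lambda>s. f (t - s) - g (t - s)) = 0"
    using energy_reflect_shift(1)[of "\<lambda>t. f t - g t" t] by simp
  hence "AE s in lebesgue. f (t - s) - g (t - s) = 0"
    using energy_reflect_shift(2)[OF assms(1), of t] energy_reflect_shift(2)[OF assms(2), of t]
    by (intro energy_zero_imp_AE) auto
  thus ?thesis by simp
qed

definition prediction_error_kernel :: "(real \<Rightarrow> real) \<Rightarrow> (real \<Rightarrow> real) \<Rightarrow> (real \<Rightarrow> complex) \<Rightarrow> bool" where
  "prediction_error_kernel k kh g \<longleftrightarrow> (\<forall>x t. x \<in> borel_measurable lebesgue \<longrightarrow> energy x < \<infinity> \<longrightarrow>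
     anticausal_conv k x t - causal_conv kh x t = (LINT s|lebesgue. g (t - s) * x s))"

text \<open>
The given \<open>k\<close> coincides almost everywhere with the exponential kernel \<open>\<kappa>\<close> having the same transform, and the
predictors are the real parts of the causal kernels approximating it. As \<open>\<kappa>\<close> is real almost everywhere, the
error symbol becomes the mean of \<open>a(\<omega>)\<close> and \<open>cnj (a (- \<omega>))\<close>, where \<open>a\<close> is the error symbol of the complex
kernels. Hence the symmetry of \<open>D\<close>.
\<close>

lemma kernel_prediction_errors:
  assumes k: "k \<in> kernels \<Omega>" and sym: "\<And>\<omega>. \<omega> \<in> D \<Longrightarrow> - \<omega> \<in> D"
    and \<sigma>: "\<And>\<omega>. \<omega> \<in> D \<Longrightarrow> \<sigma> * (\<omega>\<^sup>2 - \<Omega>\<^sup>2) < 0"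
  shows "\<exists>kh g C. (\<forall>m::nat. kh m \<in> causal_kernels) \<and> (\<forall>m. tame (g m)) \<and>
     (\<forall>m. prediction_error_kernel k (kh m) (g m)) \<and>
     (\<forall>m. \<forall>\<omega>\<in>D. cmod (\<F> (g m) \<omega>) \<le> C / (1 + \<bar>\<omega>\<bar>)) \<and>
     (\<forall>\<omega>\<in>D. (\<lambda>m. \<F> (g m) \<omega>) \<longlonglongrightarrow> 0)"
proof -
  from k obtain K d \<delta> where k0: "\<forall>t>0. k t = 0"
    and K: "has_fourier (\<lambda>t. of_real (k t)) K"
      "AE \<omega> in lebesgue. K \<omega> = poly d (\<i> * of_real \<omega>) / poly \<delta> (\<i> * of_real \<omega>)"
    and deg: "degree d < degree \<delta>" and roots: "\<forall>p. poly \<delta> p = 0 \<longrightarrow> Re p > 0 \<and> \<bar>Im p\<bar> < \<Omega>"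
    unfolding kernels_def by blast
  have "predictable_symbol D (\<lambda>\<omega>. poly d (\<i> * of_real \<omega>) / poly \<delta> (\<i> * of_real \<omega>))"
    using roots deg \<sigma> by (intro predictable_symbol_rational) auto
  then obtain \<kappa> v C where \<kappa>: "tame \<kappa>" "\<forall>t>0. \<kappa> t = 0"
      "\<forall>\<omega>. \<F> \<kappa> \<omega> = poly d (\<i> * of_real \<omega>) / poly \<delta> (\<i> * of_real \<omega>)"
    and v: "\<forall>m::nat. causal_predictor (v m)"
    and C: "\<forall>m. \<forall>\<omega>\<in>D. cmod (poly d (\<i> * of_real \<omega>) / poly \<delta> (\<i> * of_real \<omega>) - \<F> (v m) \<omega>) \<le> C / (1 + \<bar>\<omega>\<bar>)"
    and lim: "\<forall>\<omega>\<in>D. (\<lambda>m. \<F> (v m) \<omega>) \<longlonglongrightarrow> poly d (\<i> * of_real \<omega>) / poly \<delta> (\<i> * of_real \<omega>)"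
    unfolding predictable_symbol_def by (elim exE conjE)
  have [measurable]: "(\<lambda>t. complex_of_real (k t)) \<in> borel_measurable lebesgue"
    using K(1) by (auto simp: has_fourier_def has_fourier_L2_def Lspace_def)
  note [measurable] = tame_measurable_lebesgue[OF \<kappa>(1)]
  have k_eq: "AE t in lebesgue. of_real (k t) = \<kappa> t"
    using K(2) \<kappa>(3) by (intro fourier_determines_tame[OF K(1) \<kappa>(1)]) simp
  have F\<kappa>_real: "\<F> \<kappa> \<omega> = cnj (\<F> \<kappa> (- \<omega>))" for \<omega>
  proof -
    have "\<F> \<kappa> \<omega> = \<F> (\<lambda>t. cnj (\<kappa> t)) \<omega>"
      unfolding fourier_integral_def
    proof (rule integral_cong_AE)
      show "AE t in lebesgue. exp (- (\<i> * of_real \<omega> * of_real t)) * \<kappa> t = exp (- (\<i> * of_real \<omega> * of_real t)) * cnj (\<kappa> t)"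
        using k_eq by eventually_elim (metis complex_cnj_complex_of_real)
      show "(\<lambda>t. exp (- (\<i> * of_real \<omega> * of_real t)) * cnj (\<kappa> t)) \<in> borel_measurable lebesgue"
        using tame_measurable_lebesgue[OF tame_cnj[OF \<kappa>(1)]] by measurable
    qed measurable
    thus ?thesis by (simp add: fourier_integral_cnj)
  qed
  \<comment> \<open>The real part of \<open>v m\<close>, in a form linear in \<open>v m\<close> and its conjugate.\<close>
  define w where "w = (\<lambda>m t. (1/2) * v m t + (1/2) * cnj (v m t))"
  define kh where "kh = (\<lambda>m t. Re (v m t))"
  have w_eq: "w m t = of_real (kh m t)" for m t
    by (simp add: w_def kh_def complex_eq_iff)
  have w: "causal_predictor (w m)" for m
    unfolding w_def using v by (intro causal_predictor_add causal_predictor_cmult causal_predictor_cnj) auto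
  have w_tame: "tame (w m)" and w_causal: "\<And>t. t < 0 \<Longrightarrow> w m t = 0" for m
    using w[of m] by (auto simp: causal_predictor_def)
  have kh: "kh m \<in> causal_kernels" for m
    using w[of m] unfolding w_eq by (rule causal_predictor_imp_causal_kernel)
  define g where "g = (\<lambda>m t. \<kappa> t - w m t)"
  have g: "tame (g m)" for m unfolding g_def by (rule tame_diff[OF \<kappa>(1) w_tame])
  define a where "a = (\<lambda>m \<omega>. \<F> \<kappa> \<omega> - \<F> (v m) \<omega>)"
  have Fg: "\<F> (g m) \<omega> = (a m \<omega> + cnj (a m (- \<omega>))) / 2" for m \<omega>
  proof -
    have vt: "tame (v m)" using v by (simp add: causal_predictor_def)
    have "\<F> (w m) \<omega> = (1/2) * \<F> (v m) \<omega> + (1/2) * cnj (\<F> (v m) (- \<omega>))"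
      unfolding w_def
      by (subst fourier_integral_add)
        (use tame_integrable[OF tame_cmult[OF vt, of "1/2"]] tame_integrable[OF tame_cmult[OF tame_cnj[OF vt], of "1/2"]]
          in \<open>simp_all only: fourier_integral_cmult fourier_integral_cnj\<close>)
    moreover have "\<F> (g m) \<omega> = \<F> \<kappa> \<omega> - \<F> (w m) \<omega>"
      unfolding g_def by (intro fourier_integral_diff tame_integrable \<kappa> w_tame)
    moreover have "\<F> \<kappa> \<omega> = (\<F> \<kappa> \<omega> + cnj (\<F> \<kappa> (- \<omega>))) / 2"
      using F\<kappa>_real[of \<omega>] by simp
    ultimately show ?thesis
      by (simp add: a_def add_divide_distrib diff_divide_distrib)
  qed
  have a_le: "cmod (a m \<omega>) \<le> C / (1 + \<bar>\<omega>\<bar>)" if "\<omega> \<in> D" for m \<omega>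
    using C that by (simp add: a_def \<kappa>(3))
  have a_lim: "(\<lambda>m. a m \<omega>) \<longlonglongrightarrow> 0" if "\<omega> \<in> D" for \<omega>
    using tendsto_diff[OF tendsto_const[of "\<F> \<kappa> \<omega>"] lim[rule_format, OF that]] by (simp add: a_def \<kappa>(3))
  have "cmod (\<F> (g m) \<omega>) \<le> C / (1 + \<bar>\<omega>\<bar>)" if "\<omega> \<in> D" for m \<omega>
  proof -
    have "cmod (a m \<omega> + cnj (a m (- \<omega>))) \<le> cmod (a m \<omega>) + cmod (a m (- \<omega>))"
      using norm_triangle_ineq[of "a m \<omega>" "cnj (a m (- \<omega>))"] by simp
    also have "\<dots> \<le> C / (1 + \<bar>\<omega>\<bar>) + C / (1 + \<bar>\<omega>\<bar>)"
      using a_le[OF that, of m] a_le[OF sym[OF that], of m] by simp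
    finally have "cmod (a m \<omega> + cnj (a m (- \<omega>))) \<le> C / (1 + \<bar>\<omega>\<bar>) + C / (1 + \<bar>\<omega>\<bar>)" .
    moreover have "cmod (\<F> (g m) \<omega>) = cmod (a m \<omega> + cnj (a m (- \<omega>))) / 2"
      unfolding Fg norm_divide by simp
    ultimately show ?thesis by linarith
  qed
  moreover have "(\<lambda>m. \<F> (g m) \<omega>) \<longlonglongrightarrow> 0" if "\<omega> \<in> D" for \<omega>
  proof -
    have "(\<lambda>m. (a m \<omega> + cnj (a m (- \<omega>))) / 2) \<longlonglongrightarrow> (0 + cnj 0) / 2"
      by (intro tendsto_intros a_lim that sym) simp
    thus ?thesis by (simp add: Fg)
  qed
  moreover have "anticausal_conv k x t - causal_conv (kh m) x t = (LINT s|lebesgue. g m (t - s) * x s)"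
    if x [measurable]: "x \<in> borel_measurable lebesgue" and xe: "energy x < \<infinity>" for m x t
  proof -
    have m1 [measurable]: "(\<lambda>s. complex_of_real (k (t - s))) \<in> borel_measurable lebesgue" "(\<lambda>s. \<kappa> (t - s)) \<in> borel_measurable lebesgue"
        "(\<lambda>s. w m (t - s)) \<in> borel_measurable lebesgue"
      using energy_reflect_shift(2)[of "\<lambda>t. complex_of_real (k t)" t] energy_reflect_shift(2)[of \<kappa> t]
        energy_reflect_shift(2)[OF tame_measurable_lebesgue[OF w_tame[of m]], of t] by auto
    have k_eq': "AE s in lebesgue. complex_of_real (k (t - s)) = \<kappa> (t - s)"
      by (rule AE_eq_reflect_shift[OF _ _ k_eq]) measurable
    have "anticausal_conv k x t = (LINT s|lebesgue. \<kappa> (t - s) * x s)"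
      unfolding anticausal_conv_def set_lebesgue_integral_def
    proof (rule integral_cong_AE)
      show "AE s in lebesgue. indicat_real {t..} s *\<^sub>R (complex_of_real (k (t - s)) * x s) = \<kappa> (t - s) * x s"
        using k_eq'
      proof eventually_elim
        case (elim s)
        thus ?case using \<kappa>(2) by (cases "t \<le> s") (auto simp: indicator_def)
      qed
      have "(indicat_real {t..}) \<in> borel_measurable lebesgue" by (simp add: borel_imp_lebesgue)
      thus "(\<lambda>s. indicat_real {t..} s *\<^sub>R (complex_of_real (k (t - s)) * x s)) \<in> borel_measurable lebesgue"
        by measurable
    qed measurable
    moreover have "causal_conv (kh m) x t = (LINT s|lebesgue. w m (t - s) * x s)"
      unfolding causal_conv_def set_lebesgue_integral_def
      using w_causal by (intro Bochner_Integration.integral_cong refl) (auto simp: indicator_def simp flip: w_eq)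
    moreover have "integrable lebesgue (\<lambda>s. \<kappa> (t - s) * x s)" "integrable lebesgue (\<lambda>s. w m (t - s) * x s)"
      using energy_reflect_shift(1)[OF tame_measurable_lebesgue[OF \<kappa>(1)], of t]
        energy_reflect_shift(1)[OF tame_measurable_lebesgue[OF w_tame[of m]], of t]
        tame_energy[OF \<kappa>(1)] tame_energy[OF w_tame[of m]] xe
      by (intro integrable_L2_product m1 x; simp)+
    ultimately show ?thesis by (simp add: g_def left_diff_distrib)
  qed
  ultimately show ?thesis
    unfolding prediction_error_kernel_def
    using kh g by (intro exI[of _ kh] exI[of _ g] exI[of _ C]) auto
qed

lemma le_two_pi_mult: "x \<le> ennreal (2 * pi) * x"
  using mult_right_mono[of 1 "ennreal (2 * pi)" x] pi_ge_two by simp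

section \<open>Predictability on a band\<close>

definition limited_to_band :: "real set \<Rightarrow> (real \<Rightarrow> complex) \<Rightarrow> (real \<Rightarrow> complex) \<Rightarrow> bool" where
  "limited_to_band D x X \<longleftrightarrow> has_fourier_L2 x X \<and> (AE \<omega> in lebesgue. \<omega> \<notin> D \<longrightarrow> X \<omega> = 0)"

text \<open>
Dominated convergence; for \<open>s \<ge> 2\<close> the majorant \<open>(C / (1 + \<bar>\<omega>\<bar>))\<^sup>s\<close> is at most a multiple of \<open>1 / (1 + \<omega>\<^sup>2)\<close>.
\<close>

lemma nn_integral_symbol_powr_tendsto_zero:
  assumes D [measurable]: "D \<in> sets borel" and s: "s \<ge> 2"
    and [measurable]: "\<And>m::nat. H m \<in> borel_measurable lebesgue"
    and C: "\<And>m \<omega>. \<omega> \<in> D \<Longrightarrow> cmod (H m \<omega>) \<le> C / (1 + \<bar>\<omega>\<bar>)"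
    and lim: "\<And>\<omega>. \<omega> \<in> D \<Longrightarrow> (\<lambda>m. H m \<omega>) \<longlonglongrightarrow> 0"
  shows "(\<lambda>m. \<integral>\<^sup>+ \<omega>. ennreal (indicator D \<omega> * cmod (H m \<omega>) powr s) \<partial>lebesgue) \<longlonglongrightarrow> 0"
proof -
  have Dm [measurable]: "(indicat_real D) \<in> borel_measurable lebesgue" by (simp add: borel_imp_lebesgue)
  have "(\<lambda>m. \<integral>\<^sup>+ \<omega>. ennreal (indicator D \<omega> * cmod (H m \<omega>) powr s) \<partial>lebesgue) \<longlonglongrightarrow> (\<integral>\<^sup>+ (\<omega>::real). 0 \<partial>lebesgue)"
  proof (rule nn_integral_dominated_convergence[where w = "\<lambda>\<omega>. ennreal (\<bar>C\<bar> powr s * inverse (1 + \<omega>\<^sup>2))"])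
    have "integrable lborel (\<lambda>x::real. inverse (1 + x\<^sup>2))"
      using integrable_inverse_1_plus_square by (simp add: set_integrable_def)
    hence "integrable lebesgue (\<lambda>x::real. \<bar>C\<bar> powr s * inverse (1 + x\<^sup>2))"
      by (simp add: integrable_completion)
    hence "(\<integral>\<^sup>+ x. ennreal (norm (\<bar>C\<bar> powr s * inverse (1 + x\<^sup>2))) \<partial>lebesgue) < \<infinity>"
      by (simp only: integrable_iff_bounded)
    moreover have "norm (\<bar>C\<bar> powr s * inverse (1 + x\<^sup>2)) = \<bar>C\<bar> powr s * inverse (1 + x\<^sup>2)" for x :: real
      by (simp add: add_nonneg_nonneg)
    ultimately show "(\<integral>\<^sup>+ \<omega>. ennreal (\<bar>C\<bar> powr s * inverse (1 + \<omega>\<^sup>2)) \<partial>lebesgue) < \<infinity>" by simp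
    show "AE \<omega> in lebesgue. ennreal (indicator D \<omega> * cmod (H m \<omega>) powr s) \<le> ennreal (\<bar>C\<bar> powr s * inverse (1 + \<omega>\<^sup>2))" for m
    proof (intro AE_I2 ennreal_leI)
      fix \<omega> :: real
      show "indicator D \<omega> * cmod (H m \<omega>) powr s \<le> \<bar>C\<bar> powr s * inverse (1 + \<omega>\<^sup>2)"
      proof (cases "\<omega> \<in> D")
        case True
        have "cmod (H m \<omega>) \<le> \<bar>C\<bar> / (1 + \<bar>\<omega>\<bar>)"
          using C[OF True, of m] by (rule order_trans) (auto intro: divide_right_mono)
        hence "cmod (H m \<omega>) powr s \<le> (\<bar>C\<bar> / (1 + \<bar>\<omega>\<bar>)) powr s"
          using s by (intro powr_mono2) auto
        also have "\<dots> = \<bar>C\<bar> powr s * inverse ((1 + \<bar>\<omega>\<bar>) powr s)"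
          by (simp add: powr_divide flip: divide_inverse)
        also have "\<dots> \<le> \<bar>C\<bar> powr s * inverse (1 + \<omega>\<^sup>2)"
        proof (intro mult_left_mono le_imp_inverse_le)
          have "1 + \<omega>\<^sup>2 \<le> (1 + \<bar>\<omega>\<bar>)\<^sup>2" by (simp add: power2_sum)
          also have "\<dots> = (1 + \<bar>\<omega>\<bar>) powr 2" by simp
          also have "\<dots> \<le> (1 + \<bar>\<omega>\<bar>) powr s" using s by (intro powr_mono) auto
          finally show "1 + \<omega>\<^sup>2 \<le> (1 + \<bar>\<omega>\<bar>) powr s" .
        qed (auto simp: add_pos_nonneg)
        finally show ?thesis using True by simp
      qed (simp add: add_nonneg_nonneg)
    qed
    show "AE \<omega> in lebesgue. (\<lambda>m. ennreal (indicator D \<omega> * cmod (H m \<omega>) powr s)) \<longlonglongrightarrow> 0"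
    proof (rule AE_I2)
      fix \<omega> :: real
      show "(\<lambda>m. ennreal (indicator D \<omega> * cmod (H m \<omega>) powr s)) \<longlonglongrightarrow> 0"
      proof (cases "\<omega> \<in> D")
        case True
        have "(\<lambda>m. cmod (H m \<omega>) powr s) \<longlonglongrightarrow> 0 powr s"
          using s tendsto_norm_zero[OF lim[OF True]] by (intro tendsto_powr2 tendsto_const) auto
        hence "(\<lambda>m. ennreal (cmod (H m \<omega>) powr s)) \<longlonglongrightarrow> ennreal 0"
          using s by (intro tendsto_ennrealI) simp
        thus ?thesis using True by simp
      qed simp
    qed
  qed measurable
  thus ?thesis by simp
qed

text \<open>
The error symbols are bounded and tend to zero on the band, so their products with \<open>X\<close> tend to zero in \<open>L\<^sub>2\<close> for
every \<open>X\<close> by dominated convergence.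
\<close>

theorem weakly_predictable_band:
  assumes D [measurable]: "D \<in> sets borel" and sym: "\<And>\<omega>. \<omega> \<in> D \<Longrightarrow> - \<omega> \<in> D"
    and \<sigma>: "\<And>\<omega>. \<omega> \<in> D \<Longrightarrow> \<sigma> * (\<omega>\<^sup>2 - \<Omega>\<^sup>2) < 0"
    and band: "\<And>x. x \<in> \<X> \<Longrightarrow> \<exists>X. limited_to_band D x X"
  shows "weakly_predictable \<Omega> 2 \<X>"
  unfolding weakly_predictable_def
proof
  fix k assume "k \<in> kernels \<Omega>"
  from kernel_prediction_errors[OF this sym \<sigma>] obtain kh g C where
    kh: "\<And>m::nat. kh m \<in> causal_kernels" and g: "\<And>m. tame (g m)"
    and err: "\<And>m. prediction_error_kernel k (kh m) (g m)"
    and C: "\<And>m \<omega>. \<omega> \<in> D \<Longrightarrow> cmod (\<F> (g m) \<omega>) \<le> C / (1 + \<bar>\<omega>\<bar>)"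
    and lim: "\<And>\<omega>. \<omega> \<in> D \<Longrightarrow> (\<lambda>m. \<F> (g m) \<omega>) \<longlonglongrightarrow> 0"
    by blast
  have [measurable]: "g m \<in> borel_measurable lebesgue" for m by (rule tame_measurable_lebesgue[OF g])
  show "\<exists>kh. (\<forall>m. kh m \<in> causal_kernels) \<and>
      (\<forall>x\<in>\<X>. (\<lambda>m. Lnorm 2 (\<lambda>t. anticausal_conv k x t - causal_conv (kh m) x t)) \<longlonglongrightarrow> 0)"
  proof (intro exI[of _ kh] conjI allI kh ballI)
    fix x assume "x \<in> \<X>"
    with band obtain X where X: "has_fourier_L2 x X" and X0: "AE \<omega> in lebesgue. \<omega> \<notin> D \<longrightarrow> X \<omega> = 0"
      unfolding limited_to_band_def by blast
    note xm [measurable] = has_fourier_L2D(1,3)[OF X]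
    define z where "z = (\<lambda>m t. LINT s|lebesgue. g m (t - s) * x s)"
    have z_eq: "(\<lambda>t. anticausal_conv k x t - causal_conv (kh m) x t) = z m" for m
      using err has_fourier_L2D(1,2)[OF X] by (auto simp: prediction_error_kernel_def z_def)
    have "(\<lambda>m. energy (\<lambda>\<omega>. X \<omega> * \<F> (g m) \<omega>)) \<longlonglongrightarrow> (\<integral>\<^sup>+ (\<omega>::real). 0 \<partial>lebesgue)"
      unfolding energy_def
    proof (rule nn_integral_dominated_convergence[where w = "\<lambda>\<omega>. ennreal (C\<^sup>2) * (ennreal (cmod (X \<omega>)))\<^sup>2"])
      have "(\<integral>\<^sup>+ \<omega>. ennreal (C\<^sup>2) * (ennreal (cmod (X \<omega>)))\<^sup>2 \<partial>lebesgue) = ennreal (C\<^sup>2) * energy X"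
        unfolding energy_def by (rule nn_integral_cmult) measurable
      thus "(\<integral>\<^sup>+ \<omega>. ennreal (C\<^sup>2) * (ennreal (cmod (X \<omega>)))\<^sup>2 \<partial>lebesgue) < \<infinity>"
        using has_fourier_L2D(4)[OF X] by (simp add: ennreal_mult_less_top)
      show "AE \<omega> in lebesgue. (ennreal (cmod (X \<omega> * \<F> (g m) \<omega>)))\<^sup>2 \<le> ennreal (C\<^sup>2) * (ennreal (cmod (X \<omega>)))\<^sup>2" for m
        using X0
      proof eventually_elim
        case (elim \<omega>)
        show ?case
        proof (cases "\<omega> \<in> D")
          case True
          have "0 \<le> C / (1 + \<bar>\<omega>\<bar>)" using C[OF True] norm_ge_zero order_trans by blast
          hence "C \<ge> 0" using abs_ge_zero[of \<omega>] by (auto simp: zero_le_divide_iff)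
          hence "C / (1 + \<bar>\<omega>\<bar>) \<le> C" by (simp add: divide_le_eq mult_le_cancel_left1)
          with C[OF True, of m] have "cmod (\<F> (g m) \<omega>) \<le> C" by linarith
          hence "(cmod (\<F> (g m) \<omega>))\<^sup>2 \<le> C\<^sup>2" by (rule power_mono) simp
          from mult_right_mono[OF this, of "(cmod (X \<omega>))\<^sup>2"]
          have "(cmod (X \<omega> * \<F> (g m) \<omega>))\<^sup>2 \<le> C\<^sup>2 * (cmod (X \<omega>))\<^sup>2"
            by (simp add: norm_mult power_mult_distrib mult.commute)
          thus ?thesis by (simp add: ennreal_power ennreal_leI flip: ennreal_mult)
        qed (use elim in auto)
      qed
      show "AE \<omega> in lebesgue. (\<lambda>m. (ennreal (cmod (X \<omega> * \<F> (g m) \<omega>)))\<^sup>2) \<longlonglongrightarrow> 0"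
        using X0
      proof eventually_elim
        case (elim \<omega>)
        show ?case
        proof (cases "\<omega> \<in> D")
          case True
          have "(\<lambda>m. (cmod (X \<omega> * \<F> (g m) \<omega>))\<^sup>2) \<longlonglongrightarrow> (cmod (X \<omega> * 0))\<^sup>2"
            by (intro tendsto_intros lim[OF True])
          hence "(\<lambda>m. ennreal ((cmod (X \<omega> * \<F> (g m) \<omega>))\<^sup>2)) \<longlonglongrightarrow> ennreal ((cmod (X \<omega> * 0))\<^sup>2)"
            by (rule tendsto_ennrealI)
          thus ?thesis by (simp add: ennreal_power)
        qed (use elim in auto)
      qed
    qed measurable
    hence lim_energy: "(\<lambda>m. energy (\<lambda>\<omega>. X \<omega> * \<F> (g m) \<omega>)) \<longlonglongrightarrow> 0" by simp
    show "(\<lambda>m. Lnorm 2 (\<lambda>t. anticausal_conv k x t - causal_conv (kh m) x t)) \<longlonglongrightarrow> 0"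
      unfolding z_eq
    proof (rule order_tendstoI)
      fix e :: ennreal assume "0 < e"
      then obtain c where c: "0 < c" "c < e" using dense by blast
      hence "c \<noteq> \<infinity>" by auto
      have "0 < c\<^sup>2" using c(1) by (simp add: zero_less_iff_neq_zero)
      from order_tendstoD(2)[OF lim_energy this]
      show "\<forall>\<^sub>F m in sequentially. Lnorm 2 (z m) < e"
      proof eventually_elim
        case (elim m)
        have "energy (z m) \<le> ennreal (2 * pi) * energy (z m)" by (rule le_two_pi_mult)
        also have "\<dots> \<le> energy (\<lambda>\<omega>. X \<omega> * \<F> (g m) \<omega>)"
          unfolding z_def by (rule convolution_bounds(2)[OF X g])
        finally have "energy (z m) \<le> c\<^sup>2" using elim by simp
        hence "Lnorm 2 (z m) \<le> c"
          unfolding z_def by (intro Lnorm_2_le convolution_bounds(1)[OF X g])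
        thus ?case using c(2) by simp
      qed
    qed simp
  qed
qed


text \<open>
The uniform statements need one predictor whose error symbol is small in \<open>L\<^sub>s(D)\<close>, independently of \<open>x\<close>.
\<close>

lemma kernel_prediction_error_small:
  assumes k: "k \<in> kernels \<Omega>"
    and D [measurable]: "D \<in> sets borel" and sym: "\<And>\<omega>. \<omega> \<in> D \<Longrightarrow> - \<omega> \<in> D"
    and \<sigma>: "\<And>\<omega>. \<omega> \<in> D \<Longrightarrow> \<sigma> * (\<omega>\<^sup>2 - \<Omega>\<^sup>2) < 0"
    and s: "s \<ge> 2" and e: "e > 0"
  shows "\<exists>kh\<in>causal_kernels. \<exists>g. tame g \<and>
     prediction_error_kernel k kh g \<and>
     (\<integral>\<^sup>+ \<omega>. ennreal (indicator D \<omega> * cmod (\<F> g \<omega>) powr s) \<partial>lebesgue) \<le> e"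
proof -
  from kernel_prediction_errors[OF k sym \<sigma>] obtain kh g C where
    kh: "\<And>m::nat. kh m \<in> causal_kernels" and g: "\<And>m. tame (g m)"
    and err: "\<And>m. prediction_error_kernel k (kh m) (g m)"
    and C: "\<And>m \<omega>. \<omega> \<in> D \<Longrightarrow> cmod (\<F> (g m) \<omega>) \<le> C / (1 + \<bar>\<omega>\<bar>)"
    and lim: "\<And>\<omega>. \<omega> \<in> D \<Longrightarrow> (\<lambda>m. \<F> (g m) \<omega>) \<longlonglongrightarrow> 0"
    by blast
  have "(\<lambda>m. \<integral>\<^sup>+ \<omega>. ennreal (indicator D \<omega> * cmod (\<F> (g m) \<omega>) powr s) \<partial>lebesgue) \<longlonglongrightarrow> 0"
    using fourier_integral_measurable[OF tame_measurable_lebesgue[OF g]]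
    by (rule nn_integral_symbol_powr_tendsto_zero[OF D s _ C lim])
  from order_tendstoD(2)[OF this e]
  obtain m where "(\<integral>\<^sup>+ \<omega>. ennreal (indicator D \<omega> * cmod (\<F> (g m) \<omega>) powr s) \<partial>lebesgue) < e"
    by (auto simp: eventually_sequentially)
  thus ?thesis
    using kh[of m] g[of m] err[of m] by (intro bexI[of _ "kh m"] exI[of _ "g m"]) auto
qed

lemma has_fourier_measurable:
  assumes "has_fourier x X"
  shows "X \<in> borel_measurable lebesgue"
  using assms by (auto simp: has_fourier_def has_fourier_L2_def Lspace_def)

lemma band_energy_eq:
  assumes X0: "AE \<omega> in lebesgue. \<omega> \<notin> D \<longrightarrow> X \<omega> = 0"
  shows "energy (\<lambda>\<omega>. X \<omega> * H \<omega>) = (\<integral>\<^sup>+ \<omega>. ennreal ((cmod (X \<omega>))\<^sup>2 * (indicator D \<omega> * (cmod (H \<omega>))\<^sup>2)) \<partial>lebesgue)"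
  unfolding energy_def using X0
  by (intro nn_integral_cong_AE)
    (auto simp: indicator_def ennreal_power norm_mult power_mult_distrib elim!: eventually_mono)

text \<open>
The error is at most the \<open>L\<^sub>1\<close> norm of \<open>X G\<close>, which Cauchy-Schwarz bounds by the \<open>L\<^sub>2\<close> norm of \<open>X\<close> times the \<open>L\<^sub>2\<close>
norm of \<open>G\<close> over the band.
\<close>

theorem weakly_predictable_uniformly_infinity_band:
  assumes D [measurable]: "D \<in> sets borel" and sym: "\<And>\<omega>. \<omega> \<in> D \<Longrightarrow> - \<omega> \<in> D"
    and \<sigma>: "\<And>\<omega>. \<omega> \<in> D \<Longrightarrow> \<sigma> * (\<omega>\<^sup>2 - \<Omega>\<^sup>2) < 0"
    and band: "\<And>x. x \<in> \<X> \<Longrightarrow> \<exists>X. limited_to_band D x X"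
  shows "weakly_predictable_uniformly \<Omega> \<infinity> \<X> (Lnorm 2)"
  unfolding weakly_predictable_uniformly_def
proof (intro ballI allI impI)
  fix k \<eta> assume k: "k \<in> kernels \<Omega>" and \<eta>: "(\<eta>::real) > 0"
  have "ennreal (\<eta>\<^sup>2) > 0" using \<eta> by simp
  from kernel_prediction_error_small[OF k D sym \<sigma> order_refl this] obtain kh g where
    kh: "kh \<in> causal_kernels" and g: "tame g"
    and err: "prediction_error_kernel k kh g"
    and small: "(\<integral>\<^sup>+ \<omega>. ennreal (indicator D \<omega> * cmod (\<F> g \<omega>) powr 2) \<partial>lebesgue) \<le> ennreal (\<eta>\<^sup>2)"
    by blast
  show "\<exists>kh\<in>causal_kernels. \<forall>x\<in>\<X>. \<forall>X. has_fourier x X \<longrightarrow>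
      Lnorm \<infinity> (\<lambda>t. anticausal_conv k x t - causal_conv kh x t) \<le> ennreal \<eta> * Lnorm 2 X"
  proof (intro bexI[OF _ kh] ballI allI impI)
    fix x X' assume x: "x \<in> \<X>" and X': "has_fourier x X'"
    from band[OF x] obtain X where X: "has_fourier_L2 x X" and X0: "AE \<omega> in lebesgue. \<omega> \<notin> D \<longrightarrow> X \<omega> = 0"
      unfolding limited_to_band_def by blast
    note [measurable] = has_fourier_L2D(1,3)[OF X] tame_measurable_lebesgue[OF g]
    have Dm [measurable]: "(indicator D :: real \<Rightarrow> complex) \<in> borel_measurable lebesgue"
      by (simp add: borel_imp_lebesgue)
    have norm_X: "Lnorm 2 X' = Lnorm 2 X"
      by (rule Lnorm_cong_AE[OF has_fourier_L2D(3)[OF X] has_fourier_measurable[OF X'] fourier_transform_unique[OF X X'], symmetric])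
    define z where "z = (\<lambda>t. LINT s|lebesgue. g (t - s) * x s)"
    have z_eq: "(\<lambda>t. anticausal_conv k x t - causal_conv kh x t) = z"
      using err has_fourier_L2D(1,2)[OF X] by (auto simp: prediction_error_kernel_def z_def)
    define H where "H = (\<lambda>\<omega>. indicator D \<omega> * \<F> g \<omega>)"
    have Hm [measurable]: "H \<in> borel_measurable lebesgue" unfolding H_def by measurable
    have "energy H = (\<integral>\<^sup>+ \<omega>. ennreal (indicator D \<omega> * cmod (\<F> g \<omega>) powr 2) \<partial>lebesgue)"
      unfolding energy_def H_def by (intro nn_integral_cong) (auto simp: indicator_def ennreal_power)
    with small have H_small: "energy H \<le> (ennreal \<eta>)\<^sup>2" using \<eta> by (simp add: ennreal_power)
    have "(\<integral>\<^sup>+ \<omega>. ennreal (cmod (X \<omega> * \<F> g \<omega>)) \<partial>lebesgue) = (\<integral>\<^sup>+ \<omega>. ennreal (cmod (X \<omega> * H \<omega>)) \<partial>lebesgue)"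
      using X0 unfolding H_def by (intro nn_integral_cong_AE) (auto simp: indicator_def elim!: eventually_mono)
    moreover have "(\<integral>\<^sup>+ \<omega>. ennreal (cmod (X \<omega> * H \<omega>)) \<partial>lebesgue) \<le> ennreal \<eta> * Lnorm 2 X"
    proof (rule ennreal_square_le_imp_le)
      have "(\<integral>\<^sup>+ \<omega>. ennreal (cmod (X \<omega> * H \<omega>)) \<partial>lebesgue)\<^sup>2 \<le> energy X * energy H"
        by (rule cauchy_schwarz_energy) measurable
      also have "\<dots> \<le> energy X * (ennreal \<eta>)\<^sup>2"
        by (intro mult_left_mono H_small) simp
      also have "\<dots> = (ennreal \<eta> * Lnorm 2 X)\<^sup>2"
        by (simp only: Lnorm_2_square[OF has_fourier_L2D(3)[OF X], symmetric] power_mult_distrib mult.commute)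
      finally show "(\<integral>\<^sup>+ \<omega>. ennreal (cmod (X \<omega> * H \<omega>)) \<partial>lebesgue)\<^sup>2 \<le> (ennreal \<eta> * Lnorm 2 X)\<^sup>2" .
    qed
    ultimately have bound: "(\<integral>\<^sup>+ \<omega>. ennreal (cmod (X \<omega> * \<F> g \<omega>)) \<partial>lebesgue) \<le> ennreal \<eta> * Lnorm 2 X"
      by simp
    show "Lnorm \<infinity> (\<lambda>t. anticausal_conv k x t - causal_conv kh x t) \<le> ennreal \<eta> * Lnorm 2 X'"
      unfolding z_eq norm_X
    proof (rule Lnorm_infinity_le)
      show "z \<in> borel_measurable lebesgue" unfolding z_def by (rule convolution_bounds(1)[OF X g])
      fix t
      have "ennreal (cmod (z t)) \<le> ennreal (2 * pi) * ennreal (cmod (z t))" by (rule le_two_pi_mult)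
      also have "\<dots> \<le> (\<integral>\<^sup>+ \<omega>. ennreal (cmod (X \<omega> * \<F> g \<omega>)) \<partial>lebesgue)"
        unfolding z_def by (rule convolution_bounds(3)[OF X g])
      also note bound
      finally show "ennreal (cmod (z t)) \<le> ennreal \<eta> * Lnorm 2 X" .
    qed
  qed
qed

lemma Lnorm_zero_imp_AE:
  assumes [measurable]: "X \<in> borel_measurable lebesgue" and q: "2 < (q::ennreal)" "q \<noteq> \<infinity>" and "Lnorm q X = 0"
  shows "AE \<omega> in lebesgue. X \<omega> = 0"
proof -
  define I where "I = (\<integral>\<^sup>+ t. ennreal (cmod (X t) powr enn2real q) \<partial>lebesgue)"
  from assms have "I \<noteq> \<infinity>" "enn2real I powr (1 / enn2real q) \<le> 0"
    by (auto simp: Lnorm_def I_def Let_def ennreal_eq_0_iff split: if_splits)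
  hence "I = 0" by (auto simp: enn2real_eq_0_iff)
  hence "AE \<omega> in lebesgue. ennreal (cmod (X \<omega>) powr enn2real q) = 0"
    unfolding I_def by (subst (asm) nn_integral_0_iff_AE) measurable
  thus ?thesis by (auto elim!: eventually_mono simp: ennreal_eq_0_iff)
qed

lemma ennreal_weighted_sum:
  assumes "0 \<le> c" "0 \<le> a" "0 \<le> b" "0 \<le> x" "0 \<le> y"
  shows "ennreal c * (ennreal a * ennreal x + ennreal b * ennreal y) = ennreal (c * (a * x + b * y))"
  using assms by (simp add: ennreal_mult)

lemma nn_integral_weighted_sum:
  assumes [measurable]: "f \<in> borel_measurable M" "g \<in> borel_measurable M"
  shows "(\<integral>\<^sup>+ x. c * (a * f x + b * g x) \<partial>M) = c * (a * (\<integral>\<^sup>+ x. f x \<partial>M) + b * (\<integral>\<^sup>+ x. g x \<partial>M))"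
  by (simp add: nn_integral_cmult nn_integral_add)

text \<open>
Hoelder's inequality with exponents \<open>P = q / 2\<close> and \<open>P'\<close>: the \<open>L\<^sub>2\<close> norm of \<open>X G\<close> is at most the \<open>L\<^sub>q\<close> norm of \<open>X\<close>
times the \<open>L\<^sub>s\<close> norm of \<open>G\<close> over the band, where \<open>s = 2 P'\<close> is at least 2 (and equal to 2 if \<open>q\<close> is infinite).
It is derived here from Young's inequality, applied pointwise after normalising \<open>X\<close> by its norm \<open>l\<close> and
\<open>G\<close> by \<open>\<eta>\<close>; the two resulting integrals are at most 1.
\<close>

theorem weakly_predictable_uniformly_L2_band:
  assumes D [measurable]: "D \<in> sets borel" and sym: "\<And>\<omega>. \<omega> \<in> D \<Longrightarrow> - \<omega> \<in> D"
    and \<sigma>: "\<And>\<omega>. \<omega> \<in> D \<Longrightarrow> \<sigma> * (\<omega>\<^sup>2 - \<Omega>\<^sup>2) < 0"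
    and band: "\<And>x. x \<in> \<X> \<Longrightarrow> \<exists>X. limited_to_band D x X"
    and q: "2 < (q::ennreal)"
  shows "weakly_predictable_uniformly \<Omega> 2 \<X> (Lnorm q)"
  unfolding weakly_predictable_uniformly_def
proof (intro ballI allI impI)
  fix k \<eta> assume k: "k \<in> kernels \<Omega>" and \<eta>: "(\<eta>::real) > 0"
  define P where "P = enn2real q / 2"
  define P' where "P' = P / (P - 1)"
  define s where "s = (if q = \<infinity> then 2 else 2 * P')"
  have P: "P > 1" if qf: "q \<noteq> \<infinity>"
  proof -
    obtain r where r: "q = ennreal r" "r \<ge> 0" by (cases q) (use qf in auto)
    have "ennreal 2 < ennreal r" using q r by simp
    hence "2 < r" by (subst (asm) ennreal_less_iff) auto
    thus ?thesis using r by (simp add: P_def)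
  qed
  have P': "P' > 1" "1 / P + 1 / P' = 1" if "q \<noteq> \<infinity>"
    using P[OF that] by (auto simp: P'_def field_simps)
  have s: "s \<ge> 2" using P' by (auto simp: s_def)
  have "ennreal (\<eta> powr s) > 0" using \<eta> by simp
  from kernel_prediction_error_small[OF k D sym \<sigma> s this] obtain kh g where
    kh: "kh \<in> causal_kernels" and g: "tame g"
    and err: "prediction_error_kernel k kh g"
    and small: "(\<integral>\<^sup>+ \<omega>. ennreal (indicator D \<omega> * cmod (\<F> g \<omega>) powr s) \<partial>lebesgue) \<le> ennreal (\<eta> powr s)"
    by blast
  define G where "G = \<F> g"
  have Gm [measurable]: "G \<in> borel_measurable lebesgue"
    unfolding G_def using tame_measurable_lebesgue[OF g] by measurable
  have Dm [measurable]: "(indicat_real D) \<in> borel_measurable lebesgue"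
    by (simp add: borel_imp_lebesgue)
  show "\<exists>kh\<in>causal_kernels. \<forall>x\<in>\<X>. \<forall>X. has_fourier x X \<longrightarrow>
      Lnorm 2 (\<lambda>t. anticausal_conv k x t - causal_conv kh x t) \<le> ennreal \<eta> * Lnorm q X"
  proof (intro bexI[OF _ kh] ballI allI impI)
    fix x X' assume x: "x \<in> \<X>" and X': "has_fourier x X'"
    from band[OF x] obtain X where X: "has_fourier_L2 x X" and X0: "AE \<omega> in lebesgue. \<omega> \<notin> D \<longrightarrow> X \<omega> = 0"
      unfolding limited_to_band_def by blast
    note Xm [measurable] = has_fourier_L2D(3)[OF X]
    have norm_X: "Lnorm q X' = Lnorm q X"
      by (rule Lnorm_cong_AE[OF has_fourier_L2D(3)[OF X] has_fourier_measurable[OF X'] fourier_transform_unique[OF X X'], symmetric])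
    define z where "z = (\<lambda>t. LINT s|lebesgue. g (t - s) * x s)"
    have z_eq: "(\<lambda>t. anticausal_conv k x t - causal_conv kh x t) = z"
      using err has_fourier_L2D(1,2)[OF X] by (auto simp: prediction_error_kernel_def z_def)
    have bound: "energy (\<lambda>\<omega>. X \<omega> * G \<omega>) \<le> (ennreal \<eta> * Lnorm q X)\<^sup>2"
    proof (cases "Lnorm q X = \<infinity>")
      case True
      thus ?thesis using \<eta> by (simp add: ennreal_mult_top power2_eq_square)
    next
      case finite: False
      show ?thesis
      proof (cases "q = \<infinity>")
        case True
        define L where "L = Lnorm q X"
        have "AE \<omega> in lebesgue. ennreal (cmod (X \<omega>)) \<le> L"
          unfolding L_def True Lnorm_infinity[OF Xm] by (rule esssup_AE)
        hence "energy (\<lambda>\<omega>. X \<omega> * G \<omega>) \<le> (\<integral>\<^sup>+ \<omega>. L\<^sup>2 * ennreal (indicator D \<omega> * cmod (G \<omega>) powr s) \<partial>lebesgue)"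
          unfolding energy_def using X0
        proof (intro nn_integral_mono_AE, eventually_elim)
          case (elim \<omega>)
          show ?case
          proof (cases "\<omega> \<in> D")
            case True
            have "(ennreal (cmod (X \<omega> * G \<omega>)))\<^sup>2 = (ennreal (cmod (X \<omega>)))\<^sup>2 * ennreal ((cmod (G \<omega>))\<^sup>2)"
              by (simp add: norm_mult ennreal_mult power_mult_distrib ennreal_power)
            also have "\<dots> \<le> L\<^sup>2 * ennreal ((cmod (G \<omega>))\<^sup>2)"
              using elim by (intro mult_right_mono power_mono) auto
            finally show ?thesis using True \<open>q = \<infinity>\<close> by (simp add: s_def)
          qed (use elim in auto)
        qed
        also have "\<dots> = L\<^sup>2 * (\<integral>\<^sup>+ \<omega>. ennreal (indicator D \<omega> * cmod (G \<omega>) powr s) \<partial>lebesgue)"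
          by (rule nn_integral_cmult) measurable
        also have "\<dots> \<le> L\<^sup>2 * ennreal (\<eta> powr s)"
          using small by (intro mult_left_mono) (auto simp: G_def)
        also have "\<dots> = (ennreal \<eta> * L)\<^sup>2"
          using \<eta> \<open>q = \<infinity>\<close> by (simp add: s_def power_mult_distrib ennreal_power mult.commute)
        finally show ?thesis by (simp add: L_def)
      next
        case qf: False
        show ?thesis
        proof (cases "Lnorm q X = 0")
          case True
          from Lnorm_zero_imp_AE[OF Xm q qf this]
          have "energy (\<lambda>\<omega>. X \<omega> * G \<omega>) = (\<integral>\<^sup>+ (\<omega>::real). 0 \<partial>lebesgue)"
            unfolding energy_def by (intro nn_integral_cong_AE) (auto elim!: eventually_mono)
          thus ?thesis by simp
        next
          case False
          define I where "I = (\<integral>\<^sup>+ \<omega>. ennreal (cmod (X \<omega>) powr (2 * P)) \<partial>lebesgue)"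
          have I: "I \<noteq> \<infinity>" using finite qf Xm by (auto simp: Lnorm_def I_def P_def Let_def split: if_splits)
          define l where "l = enn2real I powr (1 / (2 * P))"
          have L: "Lnorm q X = ennreal l"
            using qf Xm I by (simp add: Lnorm_def I_def P_def Let_def l_def)
          have "l \<ge> 0" by (simp add: l_def)
          with False L have l: "l > 0" by (cases "l = 0") auto
          hence "enn2real I > 0" using enn2real_nonneg[of I] by (auto simp: l_def simp del: enn2real_nonneg)
          hence lI: "l powr (2 * P) = enn2real I"
            using P[OF qf] by (simp add: l_def powr_powr)
          define A B where "A = 1 / P * inverse (l powr (2 * P))" and "B = 1 / P' * inverse (\<eta> powr s)"
          have AB: "0 \<le> A" "0 \<le> B"
            using P[OF qf] P'[OF qf] by (auto simp: A_def B_def)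
          \<comment> \<open>Young for \<open>a = (\<bar>X\<bar> / l)\<^sup>2\<close> and \<open>b = (\<bar>G\<bar> / \<eta>)\<^sup>2\<close>; \<open>A\<close> and \<open>B\<close> collect the normalising factors.\<close>
          have pw: "(cmod (X \<omega>))\<^sup>2 * (indicator D \<omega> * (cmod (G \<omega>))\<^sup>2)
             \<le> (\<eta> * l)\<^sup>2 * (A * cmod (X \<omega>) powr (2 * P)
                + B * (indicator D \<omega> * cmod (G \<omega>) powr s))" for \<omega>
          proof (cases "\<omega> \<in> D")
            case True
            define a where "a = (cmod (X \<omega>) / l)\<^sup>2"
            define b where "b = (cmod (G \<omega>) / \<eta>)\<^sup>2"
            have ab: "a * b \<le> a powr P / P + b powr P' / P'"
              using P[OF qf] P'[OF qf] by (intro Youngs_inequality) (auto simp: a_def b_def)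
            have sq: "(y\<^sup>2) powr r = y powr (2 * r)" if "y \<ge> 0" for y r :: real
              using that by (cases "y = 0") (simp_all add: powr_powr flip: powr_numeral)
            have "a powr P = inverse (l powr (2 * P)) * cmod (X \<omega>) powr (2 * P)"
              unfolding a_def using l by (subst sq) (simp_all add: powr_divide field_simps)
            moreover have "b powr P' = inverse (\<eta> powr s) * cmod (G \<omega>) powr s"
              unfolding b_def using \<eta> qf by (subst sq) (simp_all add: powr_divide s_def field_simps)
            moreover have "(cmod (X \<omega>))\<^sup>2 * (indicator D \<omega> * (cmod (G \<omega>))\<^sup>2) = (\<eta> * l)\<^sup>2 * (a * b)"
              using True l \<eta> by (simp add: a_def b_def power_mult_distrib power_divide)
            ultimately show ?thesis
              using mult_left_mono[OF ab, of "(\<eta> * l)\<^sup>2"] True by (simp add: A_def B_def mult_ac)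
          qed (use AB in simp)
          have "energy (\<lambda>\<omega>. X \<omega> * G \<omega>) = (\<integral>\<^sup>+ \<omega>. ennreal ((cmod (X \<omega>))\<^sup>2 * (indicator D \<omega> * (cmod (G \<omega>))\<^sup>2)) \<partial>lebesgue)"
            by (rule band_energy_eq[OF X0])
          also have "\<dots> \<le> (\<integral>\<^sup>+ \<omega>. ennreal ((\<eta> * l)\<^sup>2) * (ennreal A * ennreal (cmod (X \<omega>) powr (2 * P))
                + ennreal B * ennreal (indicator D \<omega> * cmod (G \<omega>) powr s)) \<partial>lebesgue)"
          proof (rule nn_integral_mono)
            fix \<omega>
            have "ennreal ((\<eta> * l)\<^sup>2) * (ennreal A * ennreal (cmod (X \<omega>) powr (2 * P))
                + ennreal B * ennreal (indicator D \<omega> * cmod (G \<omega>) powr s))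
              = ennreal ((\<eta> * l)\<^sup>2 * (A * cmod (X \<omega>) powr (2 * P)
                + B * (indicator D \<omega> * cmod (G \<omega>) powr s)))"
              by (rule ennreal_weighted_sum) (use AB in auto)
            thus "ennreal ((cmod (X \<omega>))\<^sup>2 * (indicator D \<omega> * (cmod (G \<omega>))\<^sup>2)) \<le> ennreal ((\<eta> * l)\<^sup>2) * (ennreal A * ennreal (cmod (X \<omega>) powr (2 * P))
                + ennreal B * ennreal (indicator D \<omega> * cmod (G \<omega>) powr s))"
              using ennreal_leI[OF pw[of \<omega>]] by simp
          qed
          also have "\<dots> = ennreal ((\<eta> * l)\<^sup>2) * (ennreal A * I
                + ennreal B * (\<integral>\<^sup>+ \<omega>. ennreal (indicator D \<omega> * cmod (G \<omega>) powr s) \<partial>lebesgue))"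
            unfolding I_def
            by (rule nn_integral_weighted_sum) measurable
          also have "\<dots> \<le> ennreal ((\<eta> * l)\<^sup>2) * (ennreal A * ennreal (l powr (2 * P))
                + ennreal B * ennreal (\<eta> powr s))"
            using small I by (intro mult_left_mono add_mono) (auto simp: G_def lI less_top)
          also have "\<dots> = ennreal ((\<eta> * l)\<^sup>2)"
          proof -
            have "ennreal A * ennreal (l powr (2 * P)) = ennreal (1 / P)"
              unfolding A_def using P[OF qf] l by (subst ennreal_mult[symmetric]) auto
            moreover have "ennreal B * ennreal (\<eta> powr s) = ennreal (1 / P')"
              unfolding B_def using P'[OF qf] \<eta> by (subst ennreal_mult[symmetric]) auto
            moreover have "ennreal (1 / P) + ennreal (1 / P') = 1"
              using P[OF qf] P'[OF qf] by (subst ennreal_plus[symmetric]) auto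
            ultimately show ?thesis by simp
          qed
          also have "\<dots> = (ennreal \<eta> * Lnorm q X)\<^sup>2"
            using \<eta> l by (simp add: L ennreal_power flip: ennreal_mult)
          finally show ?thesis .
        qed
      qed
    qed
    show "Lnorm 2 (\<lambda>t. anticausal_conv k x t - causal_conv kh x t) \<le> ennreal \<eta> * Lnorm q X'"
      unfolding z_eq norm_X
    proof (rule Lnorm_2_le)
      show "z \<in> borel_measurable lebesgue" unfolding z_def by (rule convolution_bounds(1)[OF X g])
      have "energy z \<le> ennreal (2 * pi) * energy z" by (rule le_two_pi_mult)
      also have "\<dots> \<le> energy (\<lambda>\<omega>. X \<omega> * G \<omega>)"
        unfolding z_def G_def by (rule convolution_bounds(2)[OF X g])
      also note bound
      finally show "energy z \<le> (ennreal \<eta> * Lnorm q X)\<^sup>2" .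
    qed
  qed
qed

lemma AE_not_boundary: "AE \<omega> in lebesgue. \<bar>\<omega>\<bar> \<noteq> (\<Omega>::real)"
proof -
  have "AE \<omega> in lebesgue. \<omega> \<notin> {\<Omega>, - \<Omega>}"
    by (intro AE_not_in null_sets_completionI finite_imp_null_set_lborel) simp
  thus ?thesis by eventually_elim auto
qed

theorem theorem1:
  fixes \<Omega> :: real
  assumes "\<Omega> > 0"
  shows "(weakly_predictable \<Omega> 2 (low_freq \<Omega>) \<and> weakly_predictable \<Omega> 2 (high_freq \<Omega>)) \<and>
    (weakly_predictable_uniformly \<Omega> \<infinity> (low_freq \<Omega>) (Lnorm 2) \<and>
     weakly_predictable_uniformly \<Omega> \<infinity> (high_freq \<Omega>) (Lnorm 2)) \<and>
    (\<forall>q::ennreal. q > 2 \<longrightarrow>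
       weakly_predictable_uniformly \<Omega> 2 (low_freq \<Omega>) (Lnorm q) \<and>
       weakly_predictable_uniformly \<Omega> 2 (high_freq \<Omega>) (Lnorm q))"
proof -
  define Low High where "Low = {\<omega>::real. \<bar>\<omega>\<bar> < \<Omega>}" and "High = {\<omega>::real. \<bar>\<omega>\<bar> > \<Omega>}"
  have sets: "Low \<in> sets borel" "High \<in> sets borel"
    unfolding Low_def High_def by measurable
  have sym: "\<omega> \<in> Low \<Longrightarrow> - \<omega> \<in> Low" "\<omega> \<in> High \<Longrightarrow> - \<omega> \<in> High" for \<omega>
    by (auto simp: Low_def High_def)
  have low: "1 * (\<omega>\<^sup>2 - \<Omega>\<^sup>2) < 0" if "\<omega> \<in> Low" for \<omega>
    using that power_strict_mono[of "\<bar>\<omega>\<bar>" \<Omega> 2] by (simp add: Low_def)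
  have high: "(-1) * (\<omega>\<^sup>2 - \<Omega>\<^sup>2) < 0" if "\<omega> \<in> High" for \<omega>
    using that power_strict_mono[of \<Omega> "\<bar>\<omega>\<bar>" 2] assms by (simp add: High_def)
  have low_band: "\<exists>X. limited_to_band Low x X" if "x \<in> low_freq \<Omega>" for x
  proof -
    from that obtain X where X: "has_fourier_L2 x X" "AE \<omega> in lebesgue. \<bar>\<omega>\<bar> > \<Omega> \<longrightarrow> X \<omega> = 0"
      by (auto simp: low_freq_def)
    from X(2) AE_not_boundary[of \<Omega>] have "AE \<omega> in lebesgue. \<omega> \<notin> Low \<longrightarrow> X \<omega> = 0"
      by eventually_elim (auto simp: Low_def)
    with X(1) show ?thesis by (auto simp: limited_to_band_def)
  qed
  have high_band: "\<exists>X. limited_to_band High x X" if "x \<in> high_freq \<Omega>" for x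
  proof -
    from that obtain X where X: "has_fourier_L2 x X" "AE \<omega> in lebesgue. \<bar>\<omega>\<bar> < \<Omega> \<longrightarrow> X \<omega> = 0"
      by (auto simp: high_freq_def)
    from X(2) AE_not_boundary[of \<Omega>] have "AE \<omega> in lebesgue. \<omega> \<notin> High \<longrightarrow> X \<omega> = 0"
      by eventually_elim (auto simp: High_def)
    with X(1) show ?thesis by (auto simp: limited_to_band_def)
  qed
  show ?thesis
    using weakly_predictable_band[OF sets(1) sym(1) low low_band]
      weakly_predictable_band[OF sets(2) sym(2) high high_band]
      weakly_predictable_uniformly_infinity_band[OF sets(1) sym(1) low low_band]
      weakly_predictable_uniformly_infinity_band[OF sets(2) sym(2) high high_band]
      weakly_predictable_uniformly_L2_band[OF sets(1) sym(1) low low_band]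
      weakly_predictable_uniformly_L2_band[OF sets(2) sym(2) high high_band]
    by (intro conjI allI impI) assumption+
qed

end
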